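(* Let $G$ be a locally compact second countable group, $\mu\in\mathrm{Prob}(G)$ an admissible measure, and $(B,\nu_B)$ the Poisson boundary of $(G,\mu)$. Let $(X,\nu_X)$ be a $\mu$-unique stationary $(G,\mu)$-space and $(Y,\nu_Y)$ an amenable $(G,\mu)$-space. Then $$h_\mu(X,\nu_X)\leq h_\mu(Y,\nu_Y).$$ In particular, let $$h_{\mathrm{us}}(\mu)=\sup\{h_\mu(X,\nu_X)\mid (X,\nu_X)\text{ is a }\mu\text{-unique stationary }(G,\mu)\text{-space}\},$$ $$h_{\mathrm{am}}(\mu)=\inf\{h_\mu(Y,\nu_Y)\mid (Y,\nu_Y)\text{ is an amenable }(G,\mu)\text{-space}\}.$$ Then $h_{\mathrm{us}}(\mu)\leq h_{\mathrm{am}}(\mu)$. Moreover, if $h_\mu(B,\nu_B)<+\infty$, then up to isomorphism $G$ admits at most one RN-irreducible $(G,\mu)$-space that is $\mu$-unique stationary and amenable.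
   Context: Admissible: there exists $k\ge1$ such that $\mu^{*k}$ is absolutely continuous with respect to the left Haar measure of $G$, and $\bigcup_{n\ge1}(\operatorname{supp}\mu)^n=G$. A $(G,\mu)$-space $(X,\nu_X)$ is a (standard) nonsingular probability $G$-space whose measure is $\mu$-stationary: $\mu*\nu_X=\nu_X$. Isomorphisms are measure preserving $G$-equivariant isomorphisms (modulo null sets). Amenable means amenable in the sense of Zimmer. Furstenberg entropy: $h_\mu(X,\nu_X)=-\int_G\int_X\log\frac{dg^{-1}\nu_X}{d\nu_X}(x)\,d\nu_X(x)\,d\mu(g)\in[0,+\infty]$. Unique stationarity: a $(G,\mu)$-space $(X,\nu_X)$ is $\mu$-unique stationary if it admits a compact metrizable model $(\bar X,\nu_{\bar X})$ (a compact metrizable space with continuous $G$-action and Borel probability measure, isomorphic to $(X,\nu_X)$ as a $G$-space) such that $\nu_{\bar X}$ is the unique $\mu$-stationary Borel probability measure on $\bar X$. Radon-Nikodym factor: $(X_{\mathrm{RN}},\nu_{X_{\mathrm{RN}}})$ is the $G$-factor of $(X,\nu_X)$ for which $L^\infty(X_{\mathrm{RN}})\subset L^\infty(X)$ is the von Neumann subalgebra generated by $\{(\frac{dg\nu_X}{d\nu_X})^{it}\}_{g\in G,t\in\mathbb{R}}$; $(X,\nu_X)$ is RN-irreducible if $(X_{\mathrm{RN}},\nu_{X_{\mathrm{RN}}})=(X,\nu_X)$. *)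

theory Defs
  imports "HOL-Probability.Probability"
begin

text \<open>
  Topological groups are types of class \<^class>\<open>topological_group_add\<close>.  This class is not
  commutative: the group law is written \<open>+\<close>, the unit \<open>0\<close> and the inverse of \<open>g\<close> is \<open>- g\<close>.
  A \<open>G\<close>-space is given by a measure \<open>M\<close> and an action \<open>act\<close>, where \<open>G\<close> is the type \<open>'g\<close>.
\<close>

section \<open>Standard Borel spaces and extended integrals\<close>

definition borel_of :: "'a topology \<Rightarrow> 'a measure" where
  "borel_of T = sigma (topspace T) {U. openin T U}"

definition standard_borel :: "'a measure \<Rightarrow> bool" where
  "standard_borel M \<longleftrightarrow>
     (\<exists>T. completely_metrizable_space T \<and> second_countable T \<and> sets M = sets (borel_of T))"

text \<open>
  The integral of an extended real function as the difference of the integrals of its positive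
  and negative parts.  It is meaningful as soon as one of the two is finite.
\<close>

definition ext_integral :: "'a measure \<Rightarrow> ('a \<Rightarrow> ereal) \<Rightarrow> ereal" where
  "ext_integral M f =
     enn2ereal (\<integral>\<^sup>+x. e2ennreal (f x) \<partial>M) - enn2ereal (\<integral>\<^sup>+x. e2ennreal (- f x) \<partial>M)"

section \<open>Admissible measures\<close>

definition left_haar :: "'g::topological_group_add measure \<Rightarrow> bool" where
  "left_haar m \<longleftrightarrow>
     sets m = sets borel \<and> emeasure m UNIV \<noteq> 0 \<and>
     (\<forall>K. compact K \<longrightarrow> emeasure m K < \<infinity>) \<and>
     (\<forall>g. distr m borel (\<lambda>x. g + x) = m)"

primrec convolution_power :: "'g::topological_group_add measure \<Rightarrow> nat \<Rightarrow> 'g measure" where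
  "convolution_power \<mu> 0 = return borel 0"
| "convolution_power \<mu> (Suc n) =
     distr (\<mu> \<Otimes>\<^sub>M convolution_power \<mu> n) borel (\<lambda>(g, h). g + h)"

definition measure_supp :: "'g::topological_space measure \<Rightarrow> 'g set" where
  "measure_supp \<mu> = {x. \<forall>U. open U \<and> x \<in> U \<longrightarrow> emeasure \<mu> U > 0}"

primrec set_power :: "'g::monoid_add set \<Rightarrow> nat \<Rightarrow> 'g set" where
  "set_power A 0 = {0}"
| "set_power A (Suc n) = {a + b |a b. a \<in> A \<and> b \<in> set_power A n}"

text \<open>
  The left Haar measure of a locally compact group is unique up to a positive factor, so it does
  not matter which one witnesses the absolute continuity.
\<close>

definition admissible :: "'g::topological_group_add measure \<Rightarrow> bool" where
  "admissible \<mu> \<longleftrightarrow>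
     (\<exists>m. left_haar m \<and> (\<exists>k\<ge>1. absolutely_continuous m (convolution_power \<mu> k))) \<and>
     (\<Union>n\<in>{1..}. set_power (measure_supp \<mu>) n) = UNIV"

section \<open>Stationary spaces, isomorphisms, factors and entropy\<close>

definition group_action_on :: "'x set \<Rightarrow> ('g::group_add \<Rightarrow> 'x \<Rightarrow> 'x) \<Rightarrow> bool" where
  "group_action_on S act \<longleftrightarrow>
     (\<forall>x\<in>S. (\<forall>g. act g x \<in> S) \<and> act 0 x = x \<and> (\<forall>g h. act (g + h) x = act g (act h x)))"

definition nonsingular_space ::
    "'x measure \<Rightarrow> ('g::topological_group_add \<Rightarrow> 'x \<Rightarrow> 'x) \<Rightarrow> bool" where
  "nonsingular_space M act \<longleftrightarrow>
     prob_space M \<and> standard_borel M \<and> group_action_on (space M) act \<and>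
     (\<lambda>(g, x). act g x) \<in> borel \<Otimes>\<^sub>M M \<rightarrow>\<^sub>M M \<and>
     (\<forall>g. absolutely_continuous M (distr M M (act g)) \<and>
          absolutely_continuous (distr M M (act g)) M)"

definition stationary ::
    "'g measure \<Rightarrow> 'x measure \<Rightarrow> ('g \<Rightarrow> 'x \<Rightarrow> 'x) \<Rightarrow> bool" where
  "stationary \<mu> M act \<longleftrightarrow> distr (\<mu> \<Otimes>\<^sub>M M) M (\<lambda>(g, x). act g x) = M"

definition stationary_space ::
    "'g::topological_group_add measure \<Rightarrow> 'x measure \<Rightarrow> ('g \<Rightarrow> 'x \<Rightarrow> 'x) \<Rightarrow> bool" where
  "stationary_space \<mu> M act \<longleftrightarrow> nonsingular_space M act \<and> stationary \<mu> M act"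

definition factor_map ::
    "'x measure \<Rightarrow> ('g \<Rightarrow> 'x \<Rightarrow> 'x) \<Rightarrow> 'y measure \<Rightarrow> ('g \<Rightarrow> 'y \<Rightarrow> 'y) \<Rightarrow> ('x \<Rightarrow> 'y) \<Rightarrow> bool" where
  "factor_map M act N act' p \<longleftrightarrow>
     p \<in> M \<rightarrow>\<^sub>M N \<and> distr M N p = N \<and> (\<forall>g. AE x in M. p (act g x) = act' g (p x))"

definition isomorphic_spaces ::
    "'x measure \<Rightarrow> ('g \<Rightarrow> 'x \<Rightarrow> 'x) \<Rightarrow> 'y measure \<Rightarrow> ('g \<Rightarrow> 'y \<Rightarrow> 'y) \<Rightarrow> bool" where
  "isomorphic_spaces M act N act' \<longleftrightarrow>
     (\<exists>p q. factor_map M act N act' p \<and> factor_map N act' M act q \<and>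
        (AE x in M. q (p x) = x) \<and> (AE y in N. p (q y) = y))"

definition furstenberg_entropy ::
    "'g::group_add measure \<Rightarrow> 'x measure \<Rightarrow> ('g \<Rightarrow> 'x \<Rightarrow> 'x) \<Rightarrow> ereal" where
  "furstenberg_entropy \<mu> M act =
     - ext_integral \<mu> (\<lambda>g. ext_integral M
         (\<lambda>x. ereal (ln (enn2real (RN_deriv M (distr M M (act (- g))) x)))))"

section \<open>Unique stationarity\<close>

text \<open>
  A compact metrizable space has at most the cardinality of the continuum, so quantifying over
  the topologies on subsets of \<^typ>\<open>real\<close> reaches all of them up to homeomorphism.  These
  topologies are unrelated to the usual one of \<^typ>\<open>real\<close>.
\<close>

definition compact_model ::
    "'x measure \<Rightarrow> ('g::topological_group_add \<Rightarrow> 'x \<Rightarrow> 'x) \<Rightarrow>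
     real topology \<Rightarrow> real measure \<Rightarrow> ('g \<Rightarrow> real \<Rightarrow> real) \<Rightarrow> bool" where
  "compact_model M act T N act' \<longleftrightarrow>
     compact_space T \<and> metrizable_space T \<and> group_action_on (topspace T) act' \<and>
     continuous_map (prod_topology euclidean T) T (\<lambda>(g, x). act' g x) \<and>
     prob_space N \<and> sets N = sets (borel_of T) \<and> isomorphic_spaces M act N act'"

definition unique_stationary ::
    "'g::topological_group_add measure \<Rightarrow> 'x measure \<Rightarrow> ('g \<Rightarrow> 'x \<Rightarrow> 'x) \<Rightarrow> bool" where
  "unique_stationary \<mu> M act \<longleftrightarrow>
     stationary_space \<mu> M act \<and>
     (\<exists>T N act'. compact_model M act T N act' \<and> stationary \<mu> N act' \<and>
        (\<forall>N'. prob_space N' \<and> sets N' = sets (borel_of T) \<and> stationary \<mu> N' act' \<longrightarrow> N' = N))"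

section \<open>Amenability in the sense of Zimmer\<close>

text \<open>
  Amenability is the fixed point property for affine \<open>G\<close>-spaces over \<open>(M, act)\<close>: given a separable
  Banach space \<open>E\<close>, a Borel cocycle \<open>\<alpha>\<close> with values in the isometry group of \<open>E\<close> and an
  \<open>\<alpha>\<close>-invariant Borel field of nonempty convex weak-* compact subsets of the dual unit ball, there
  is an invariant measurable section.

  Every separable Banach space is isometric to a closed subspace of \<open>\<ell>\<^sup>\<infinity>\<close>, that is, of
  \<^typ>\<open>nat \<Rightarrow>\<^sub>C real\<close>, so \<open>E\<close> ranges over these subspaces.  Maps defined on \<open>E\<close> are extensional.
\<close>

type_synonym linf = "nat \<Rightarrow>\<^sub>C real"

definition separable_banach :: "linf set \<Rightarrow> bool" where
  "separable_banach E \<longleftrightarrow> subspace E \<and> closed E \<and> separable_space (top_of_set E)"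

definition linear_on_subspace :: "linf set \<Rightarrow> (linf \<Rightarrow> 'b::real_vector) \<Rightarrow> bool" where
  "linear_on_subspace E f \<longleftrightarrow>
     (\<forall>u\<in>E. \<forall>v\<in>E. f (u + v) = f u + f v) \<and> (\<forall>c. \<forall>v\<in>E. f (c *\<^sub>R v) = c *\<^sub>R f v)"

definition isometries :: "linf set \<Rightarrow> (linf \<Rightarrow> linf) set" where
  "isometries E =
     {U \<in> extensional E. bij_betw U E E \<and> linear_on_subspace E U \<and> (\<forall>v\<in>E. norm (U v) = norm v)}"

definition strong_topology :: "linf set \<Rightarrow> (linf \<Rightarrow> linf) topology" where
  "strong_topology E = subtopology (product_topology (\<lambda>_. euclidean) E) (isometries E)"

definition dual_ball :: "linf set \<Rightarrow> (linf \<Rightarrow> real) set" where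
  "dual_ball E = {\<xi> \<in> extensional E. linear_on_subspace E \<xi> \<and> (\<forall>v\<in>E. \<bar>\<xi> v\<bar> \<le> norm v)}"

definition dual_ball_topology :: "linf set \<Rightarrow> (linf \<Rightarrow> real) topology" where
  "dual_ball_topology E = subtopology (product_topology (\<lambda>_. euclidean) E) (dual_ball E)"

text \<open>The isometry of the dual space induced by \<open>U\<close>, namely the adjoint of the inverse of \<open>U\<close>.\<close>

definition dual_isometry ::
    "linf set \<Rightarrow> (linf \<Rightarrow> linf) \<Rightarrow> (linf \<Rightarrow> real) \<Rightarrow> (linf \<Rightarrow> real)" where
  "dual_isometry E U \<xi> = (\<lambda>v\<in>E. \<xi> (inv_into E U v))"

definition isometric_cocycle ::
    "'x measure \<Rightarrow> ('g::topological_group_add \<Rightarrow> 'x \<Rightarrow> 'x) \<Rightarrow> linf set \<Rightarrow>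
     ('g \<Rightarrow> 'x \<Rightarrow> linf \<Rightarrow> linf) \<Rightarrow> bool" where
  "isometric_cocycle M act E \<alpha> \<longleftrightarrow>
     (\<lambda>(g, x). \<alpha> g x) \<in> borel \<Otimes>\<^sub>M M \<rightarrow>\<^sub>M borel_of (strong_topology E) \<and>
     (\<forall>g h. AE x in M. \<alpha> (g + h) x = compose E (\<alpha> g (act h x)) (\<alpha> h x))"

definition affine_field ::
    "'x measure \<Rightarrow> ('g \<Rightarrow> 'x \<Rightarrow> 'x) \<Rightarrow> linf set \<Rightarrow>
     ('g \<Rightarrow> 'x \<Rightarrow> linf \<Rightarrow> linf) \<Rightarrow> ('x \<Rightarrow> (linf \<Rightarrow> real) set) \<Rightarrow> bool" where
  "affine_field M act E \<alpha> A \<longleftrightarrow>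
     (\<forall>x\<in>space M. A x \<noteq> {} \<and> compactin (dual_ball_topology E) (A x) \<and>
        (\<forall>\<xi>\<in>A x. \<forall>\<eta>\<in>A x. \<forall>t\<in>{0..1}. (\<lambda>v\<in>E. (1 - t) * \<xi> v + t * \<eta> v) \<in> A x)) \<and>
     (SIGMA x:space M. A x) \<in> sets (M \<Otimes>\<^sub>M borel_of (dual_ball_topology E)) \<and>
     (\<forall>g. AE x in M. dual_isometry E (\<alpha> g x) ` A x = A (act g x))"

definition invariant_section ::
    "'x measure \<Rightarrow> ('g \<Rightarrow> 'x \<Rightarrow> 'x) \<Rightarrow> linf set \<Rightarrow>
     ('g \<Rightarrow> 'x \<Rightarrow> linf \<Rightarrow> linf) \<Rightarrow> ('x \<Rightarrow> (linf \<Rightarrow> real) set) \<Rightarrow> ('x \<Rightarrow> linf \<Rightarrow> real) \<Rightarrow> bool" where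
  "invariant_section M act E \<alpha> A \<phi> \<longleftrightarrow>
     \<phi> \<in> M \<rightarrow>\<^sub>M borel_of (dual_ball_topology E) \<and> (AE x in M. \<phi> x \<in> A x) \<and>
     (\<forall>g. AE x in M. dual_isometry E (\<alpha> g x) (\<phi> x) = \<phi> (act g x))"

definition zimmer_amenable ::
    "'x measure \<Rightarrow> ('g::topological_group_add \<Rightarrow> 'x \<Rightarrow> 'x) \<Rightarrow> bool" where
  "zimmer_amenable M act \<longleftrightarrow>
     (\<forall>E \<alpha> A. separable_banach E \<and> isometric_cocycle M act E \<alpha> \<and> affine_field M act E \<alpha> A \<longrightarrow>
        (\<exists>\<phi>. invariant_section M act E \<alpha> A \<phi>))"

section \<open>Bounded functions, the Poisson boundary and Radon-Nikodym factors\<close>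

text \<open>
  \<open>Linf M\<close> consists of functions rather than of classes modulo null sets.
\<close>

definition Linf :: "'x measure \<Rightarrow> ('x \<Rightarrow> complex) set" where
  "Linf M = {f \<in> borel_measurable M. \<exists>c. AE x in M. cmod (f x) \<le> c}"

definition poisson_transform ::
    "'x measure \<Rightarrow> ('g \<Rightarrow> 'x \<Rightarrow> 'x) \<Rightarrow> ('x \<Rightarrow> complex) \<Rightarrow> 'g \<Rightarrow> complex" where
  "poisson_transform M act f = (\<lambda>g. \<integral>x. f (act g x) \<partial>M)"

definition bounded_harmonic :: "'g::topological_group_add measure \<Rightarrow> ('g \<Rightarrow> complex) set" where
  "bounded_harmonic \<mu> =
     {F \<in> borel_measurable borel. bounded (range F) \<and> (\<forall>g. F g = (\<integral>h. F (g + h) \<partial>\<mu>))}"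

text \<open>
  The Poisson boundary is the stationary space, unique up to isomorphism, whose Poisson transform
  is an isometric bijection from \<open>L\<^sup>\<infinity>\<close> onto the space of bounded harmonic functions.
\<close>

definition poisson_boundary ::
    "'g::topological_group_add measure \<Rightarrow> 'x measure \<Rightarrow> ('g \<Rightarrow> 'x \<Rightarrow> 'x) \<Rightarrow> bool" where
  "poisson_boundary \<mu> M act \<longleftrightarrow>
     stationary_space \<mu> M act \<and>
     poisson_transform M act ` Linf M = bounded_harmonic \<mu> \<and>
     (\<forall>f\<in>Linf M. (SUP g. ereal (cmod (poisson_transform M act f g))) =
        esssup M (\<lambda>x. ereal (cmod (f x))))"

text \<open>
  The ultraweak topology of \<open>L\<^sup>\<infinity>\<close>, given by the pairing with \<open>L\<^sup>1\<close>.  It does not separate functions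
  that agree almost everywhere, hence closed sets are unions of classes modulo null sets.
\<close>

definition ultraweak_topology :: "'x measure \<Rightarrow> ('x \<Rightarrow> complex) topology" where
  "ultraweak_topology M =
     pullback_topology (Linf M) (\<lambda>f. \<lambda>k\<in>{k. integrable M k}. \<integral>x. f x * k x \<partial>M)
       (product_topology (\<lambda>_. euclidean) {k. integrable M k})"

definition von_neumann_subalgebra :: "'x measure \<Rightarrow> ('x \<Rightarrow> complex) set \<Rightarrow> bool" where
  "von_neumann_subalgebra M A \<longleftrightarrow>
     closedin (ultraweak_topology M) A \<and> (\<lambda>_. 1) \<in> A \<and>
     (\<forall>f\<in>A. \<forall>k\<in>A. (\<lambda>x. f x + k x) \<in> A \<and> (\<lambda>x. f x * k x) \<in> A) \<and>
     (\<forall>c. \<forall>f\<in>A. (\<lambda>x. c * f x) \<in> A) \<and> (\<forall>f\<in>A. (\<lambda>x. cnj (f x)) \<in> A)"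

definition von_neumann_generated ::
    "'x measure \<Rightarrow> ('x \<Rightarrow> complex) set \<Rightarrow> ('x \<Rightarrow> complex) set" where
  "von_neumann_generated M S = \<Inter>{A. von_neumann_subalgebra M A \<and> S \<subseteq> A}"

definition RN_powers :: "'x measure \<Rightarrow> ('g \<Rightarrow> 'x \<Rightarrow> 'x) \<Rightarrow> ('x \<Rightarrow> complex) set" where
  "RN_powers M act =
     {(\<lambda>x. complex_of_real (enn2real (RN_deriv M (distr M M (act g)) x)) powr (\<i> * of_real t))
       |g t. True}"

definition RN_factor ::
    "'x measure \<Rightarrow> ('g::topological_group_add \<Rightarrow> 'x \<Rightarrow> 'x) \<Rightarrow>
     'z measure \<Rightarrow> ('g \<Rightarrow> 'z \<Rightarrow> 'z) \<Rightarrow> ('x \<Rightarrow> 'z) \<Rightarrow> bool" where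
  "RN_factor M act N act' p \<longleftrightarrow>
     nonsingular_space N act' \<and> factor_map M act N act' p \<and>
     {f \<in> Linf M. \<exists>k\<in>Linf N. AE x in M. f x = k (p x)} = von_neumann_generated M (RN_powers M act)"

definition RN_irreducible ::
    "'x measure \<Rightarrow> ('g::topological_group_add \<Rightarrow> 'x \<Rightarrow> 'x) \<Rightarrow> bool" where
  "RN_irreducible M act \<longleftrightarrow> RN_factor M act M act (\<lambda>x. x)"

section \<open>The two extremal entropies\<close>

text \<open>
  Every standard Borel space is Borel isomorphic to a subset of \<^typ>\<open>real\<close>, and the
  classes of spaces considered as well as the entropy are invariant under isomorphism.  So it
  suffices to take the bounds over the spaces carried by subsets of \<^typ>\<open>real\<close>.
\<close>

definition h_us :: "'g::topological_group_add measure \<Rightarrow> ereal" where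
  "h_us \<mu> = Sup {furstenberg_entropy \<mu> M act |(M :: real measure) act. unique_stationary \<mu> M act}"

definition h_am :: "'g::topological_group_add measure \<Rightarrow> ereal" where
  "h_am \<mu> = Inf {furstenberg_entropy \<mu> M act |(M :: real measure) act.
     stationary_space \<mu> M act \<and> zimmer_amenable M act}"

end

theory Submission
  imports Defs
begin

text \<open>
  Let \<open>r\<^sub>X(g)\<close> be the density of \<open>g \<nu>\<^sub>X\<close> with respect to \<open>\<nu>\<^sub>X\<close>, put \<open>\<phi>(r) = r - 1 - ln r \<ge> 0\<close> and let
  \<open>D\<^sub>X(g)\<close> be the integral of \<open>\<phi>(r\<^sub>X(-g))\<close>, a relative entropy; then \<open>h(X)\<close> is the integral of \<open>D\<^sub>X\<close>.
  Amenability of \<open>Y\<close> yields an equivariant family \<open>\<kappa>\<^sub>y\<close> of probability measures on the compact model of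
  \<open>X\<close>.  Its barycenter is stationary, hence equal to \<open>\<nu>\<^sub>X\<close>, so it defines a coupling \<open>Z\<close> of \<open>Y\<close> and \<open>X\<close>
  that is relatively measure preserving over \<open>Y\<close>.  A computation gives
  \<open>D\<^sub>Y(g) = D\<^sub>X(g) + \<integral> \<phi>(r\<^sub>Y(-g) / r\<^sub>X(-g)) dZ\<close>, which proves the inequality.

  If the entropies are equal and finite, then \<open>r\<^sub>X(g) = r\<^sub>Y(g)\<close> holds \<open>Z\<close>-almost everywhere for
  \<open>\<mu>\<close>-almost every \<open>g\<close>.  The set of these \<open>g\<close> is a Borel subgroup of full measure, so its indicator is a
  bounded harmonic function.  It is the Poisson transform of some \<open>f\<close> with \<open>\<bar>f\<bar> \<le> 1\<close> and integral \<open>1\<close>,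
  that is, of \<open>f = 1\<close>, and the subgroup is everything.  The functions on \<open>X\<close> that agree on \<open>Z\<close> with a
  function on \<open>Y\<close> form a von Neumann subalgebra, which now contains the powers of the \<open>r\<^sub>X(g)\<close>; by
  irreducibility it is everything and \<open>x\<close> is a function of \<open>y\<close>.  By symmetry \<open>X\<close> and \<open>Y\<close> are isomorphic.

  Finiteness comes from \<open>D\<^sub>X \<le> D\<^sub>B\<close>: the harmonic function of a bounded \<open>f\<close> on \<open>X\<close> is the Poisson
  transform of some \<open>f'\<close> on \<open>B\<close>, where \<open>exp f' \<le> (exp f)'\<close>, and \<open>D\<^sub>X\<close> is a supremum of expressions
  in the integrals of \<open>f\<close> and \<open>exp f\<close>.
\<close>

section \<open>Borel sets of a topology\<close>

text \<open>The densities are chosen separately for each \<open>g\<close>, so nothing is measurable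
  in \<open>g\<close> by itself. The inequality holds for every single \<open>g\<close> and survives
  this. In the equality case it is the obstacle: the integrals of \<open>D\<close> are compared
  through a jointly measurable density, and the subgroup is described by integrals in which
  \<open>g\<close> enters only through the action. The coupling computation is a chain rule: since
  the kernel is equivariant, the translate of \<open>Z\<close> has density \<open>r_Y\<close>; its
  second marginal has density \<open>r_X\<close>, which is therefore the conditional expectation of
  \<open>r_Y\<close> given the point of \<open>X\<close>. The identity is kept free of subtraction
  because \<open>D\<close> may be infinite. Amenability speaks of duals of subspaces of bounded
  sequences. Hence continuous functions on the compact model are embedded there along a dense
  sequence, the fixed points are states, and a Riesz theorem for abstract topologies turns them into
  measures. In the comparison with the boundary the expression is the integral of
  \<open>f + r - exp f * r\<close>, which is largest at \<open>f = - ln r\<close>; truncations of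
  this \<open>f\<close> are the test functions.\<close>

text \<open>The witness is the distance to \<open>C\<close>, which is 1-Lipschitz. For empty
  \<open>C\<close> the infimum would range over nothing, and the constant 1 takes its place.\<close>

lemma closedin_zero_set:
  assumes "metrizable_space T" "closedin T C"
  obtains h :: "'a \<Rightarrow> real" where "continuous_map T euclideanreal h" "\<And>x. x \<in> topspace T \<Longrightarrow> 0 \<le> h x"
    "\<And>x. x \<in> topspace T \<Longrightarrow> h x = 0 \<longleftrightarrow> x \<in> C"
proof (cases "C = {}")
  case True
  show ?thesis by (rule that[of "\<lambda>_. 1"]) (use True in auto)
next
  case False
  obtain M d where M: "Metric_space M d" "T = Metric_space.mtopology M d"
    using assms(1) unfolding metrizable_space_def by blast
  interpret Metric_space M d by fact
  have T: "T = mtopology" by fact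
  have CM: "C \<subseteq> M" using closedin_subset[OF assms(2)] by (simp add: T)
  define h where "h x = (INF c\<in>C. d x c)" for x
  have bdd: "bdd_below (d x ` C)" for x by (rule bdd_belowI[of _ 0]) auto
  have h0: "0 \<le> h x" for x unfolding h_def by (rule cINF_greatest) (use False in auto)
  have lip: "h x \<le> h y + d x y" if "x \<in> M" "y \<in> M" for x y
  proof -
    have "h x - d x y \<le> d y c" if "c \<in> C" for c
    proof -
      have "h x \<le> d x c" unfolding h_def by (rule cINF_lower[OF bdd that])
      also have "\<dots> \<le> d x y + d y c" using that CM \<open>x \<in> M\<close> \<open>y \<in> M\<close> by (intro triangle) auto
      finally show ?thesis by simp
    qed
    then have "h x - d x y \<le> h y" unfolding h_def[of y] by (intro cINF_greatest False) auto
    then show ?thesis by simp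
  qed
  show ?thesis
  proof (rule that[of h])
    have "Lipschitz_continuous_map (metric (M,d)) euclidean_metric h"
      unfolding Lipschitz_continuous_map_def
    proof (intro conjI exI[of _ 1] ballI)
      fix x y assume "x \<in> mspace (metric (M, d))" "y \<in> mspace (metric (M, d))"
      then have xy: "x \<in> M" "y \<in> M" by auto
      then show "mdist euclidean_metric (h x) (h y) \<le> 1 * mdist (metric (M, d)) x y"
        using lip[OF xy] lip[OF xy(2,1)] by (simp add: dist_real_def commute abs_le_iff)
    qed auto
    then have "continuous_map (mtopology_of (metric (M,d))) (mtopology_of euclidean_metric) h"
      by (rule Lipschitz_continuous_imp_continuous_map)
    then show "continuous_map T euclideanreal h" by (simp add: T)
  next
    fix x assume "x \<in> topspace T" then have xM: "x \<in> M" by (simp add: T)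
    show "0 \<le> h x" by (rule h0)
    show "h x = 0 \<longleftrightarrow> x \<in> C"
    proof
      assume "x \<in> C"
      then have "h x \<le> d x x" unfolding h_def by (intro cINF_lower[OF bdd])
      then show "h x = 0" using h0[of x] xM by simp
    next
      assume hx: "h x = 0"
      show "x \<in> C"
      proof (rule ccontr)
        assume "x \<notin> C"
        then have "x \<in> M - C" using xM by auto
        moreover have "openin mtopology (M - C)" using assms(2) by (auto simp: T closedin_def)
        ultimately obtain r where r: "r > 0" "mball x r \<subseteq> M - C"
          unfolding openin_mtopology by blast
        have "r \<le> d x c" if "c \<in> C" for c
          using r that CM xM by (metis DiffD2 in_mball not_le subset_eq)
        then have "r \<le> h x" unfolding h_def by (intro cINF_greatest False)
        then show False using r hx by simp
      qed
    qed
  qed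
qed

lemma space_borel_of[simp]: "space (borel_of T) = topspace T"
  unfolding borel_of_def by (simp add: space_measure_of_conv)

lemma sets_borel_of: "sets (borel_of T) = sigma_sets (topspace T) {U. openin T U}"
  unfolding borel_of_def by (rule sets_measure_of) (auto dest: openin_subset)

lemma borel_of_openin: "openin T U \<Longrightarrow> U \<in> sets (borel_of T)"
  by (simp add: sets_borel_of sigma_sets.Basic)

lemma borel_of_closedin: assumes "closedin T C" shows "C \<in> sets (borel_of T)"
proof -
  have "topspace T - (topspace T - C) \<in> sets (borel_of T)"
    using borel_of_openin[of T "topspace T - C"] assms sets.compl_sets[of "topspace T - C" "borel_of T"]
    by (auto simp: closedin_def)
  then show ?thesis using closedin_subset[OF assms] by (simp add: double_diff)
qed

lemma continuous_map_measurable_borel_of: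
  assumes "continuous_map T T' f" shows "f \<in> borel_of T \<rightarrow>\<^sub>M borel_of T'"
  unfolding borel_of_def[of T']
proof (rule measurable_measure_of)
  show "f \<in> space (borel_of T) \<rightarrow> topspace T'" using assms by (auto simp: continuous_map_def)
  fix U assume "U \<in> {U. openin T' U}"
  then have "openin T {x \<in> topspace T. f x \<in> U}" using assms by (auto simp: continuous_map_def)
  then show "f -` U \<inter> space (borel_of T) \<in> sets (borel_of T)"
    by (intro borel_of_openin) (simp add: vimage_def Int_def conj_commute)
qed (auto dest: openin_subset)

lemma sets_borel_of_euclidean: "sets (borel_of euclidean) = sets borel"
  by (simp add: sets_borel_of borel_def)

lemma continuous_map_borel_measurable:
  assumes "continuous_map T euclideanreal f" shows "f \<in> borel_measurable (borel_of T)"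
  using continuous_map_measurable_borel_of[OF assms]
  by (simp cong: measurable_cong_sets add: sets_borel_of_euclidean)

lemma continuous_map_compact_bounded:
  assumes "compact_space T" "continuous_map T euclideanreal f"
  obtains c :: real where "\<And>x. x \<in> topspace T \<Longrightarrow> \<bar>f x\<bar> \<le> c"
proof -
  have "compactin euclideanreal (f ` topspace T)"
    using assms image_compactin[of T "topspace T" euclideanreal f] by (simp add: compact_space_def)
  then have "bounded (f ` topspace T)" by (simp add: compact_imp_bounded)
  then show ?thesis using that by (auto simp: bounded_iff)
qed

section \<open>The Riesz representation theorem for compact metrizable spaces\<close>

text \<open>The topology is a value and not a type class, because compact models are topologies on
  sets of reals that are unrelated to the topology of the type.\<close>

locale positive_functional =
  fixes T :: "'a topology" and L :: "('a \<Rightarrow> real) \<Rightarrow> real"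
  assumes compact: "compact_space T" and metrizable: "metrizable_space T"
    and add: "continuous_map T euclideanreal f \<Longrightarrow> continuous_map T euclideanreal g \<Longrightarrow>
      L (\<lambda>x. f x + g x) = L f + L g"
    and scale: "continuous_map T euclideanreal f \<Longrightarrow> L (\<lambda>x. c * f x) = c * L f"
    and pos: "continuous_map T euclideanreal f \<Longrightarrow> (\<And>x. x \<in> topspace T \<Longrightarrow> 0 \<le> f x) \<Longrightarrow> 0 \<le> L f"
    and one: "L (\<lambda>_. 1) = 1"
begin

definition Cpos :: "('a \<Rightarrow> real) set" where
  "Cpos = {f. continuous_map T euclideanreal f \<and> (\<forall>x\<in>topspace T. 0 \<le> f x)}"

text \<open>Covering by series of continuous functions makes countable subadditivity immediate;
  compactness is needed only to see that the constant \<open>1\<close> keeps its value.\<close>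
definition upper :: "('a \<Rightarrow> ennreal) \<Rightarrow> ennreal" where
  "upper F = Inf {\<Sum>k. ennreal (L (f k)) |f. (\<forall>k. f k \<in> Cpos) \<and>
     (\<forall>x\<in>topspace T. F x \<le> (\<Sum>k. ennreal (f k x)))}"

lemma Cpos_cont: "f \<in> Cpos \<Longrightarrow> continuous_map T euclideanreal f"
  and Cpos_nonneg: "f \<in> Cpos \<Longrightarrow> x \<in> topspace T \<Longrightarrow> 0 \<le> f x"
  and Cpos_L: "f \<in> Cpos \<Longrightarrow> 0 \<le> L f"
  by (auto simp: Cpos_def pos)

lemma Cpos_mult: "f \<in> Cpos \<Longrightarrow> g \<in> Cpos \<Longrightarrow> (\<lambda>x. f x * g x) \<in> Cpos"
  by (auto simp: Cpos_def intro: continuous_map_real_mult)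

lemma L_mono:
  assumes f: "continuous_map T euclideanreal f" and g: "continuous_map T euclideanreal g"
    and le: "\<And>x. x \<in> topspace T \<Longrightarrow> f x \<le> g x"
  shows "L f \<le> L g"
proof -
  have c: "continuous_map T euclideanreal (\<lambda>x. g x - f x)" using f g by (intro continuous_intros)
  have "0 \<le> L (\<lambda>x. g x - f x)" by (rule pos[OF c]) (use le in auto)
  moreover have "L (\<lambda>x. f x + (g x - f x)) = L f + L (\<lambda>x. g x - f x)" by (rule add[OF f c])
  ultimately show ?thesis by simp
qed

lemma L_zero: "L (\<lambda>_. 0) = 0"
  using scale[of "\<lambda>_. 1" 0] by simp

lemma L_sum:
  fixes n :: nat
  assumes "\<And>i. i < n \<Longrightarrow> continuous_map T euclideanreal (f i)"
  shows "L (\<lambda>x. \<Sum>i<n. f i x) = (\<Sum>i<n. L (f i))"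
  using assms
proof (induction n)
  case (Suc n)
  have "continuous_map T euclideanreal (\<lambda>x. \<Sum>i<n. f i x)"
    using Suc.prems by (intro continuous_map_sum) auto
  then show ?case using Suc by (simp add: add)
qed (simp add: L_zero)

lemma upper_leI:
  assumes "\<And>k. f k \<in> Cpos" "\<And>x. x \<in> topspace T \<Longrightarrow> F x \<le> (\<Sum>k. ennreal (f k x))"
  shows "upper F \<le> (\<Sum>k. ennreal (L (f k)))"
  unfolding upper_def by (rule Inf_lower) (use assms in blast)

lemma upper_geI:
  assumes "\<And>f. (\<And>k. f k \<in> Cpos) \<Longrightarrow> (\<And>x. x \<in> topspace T \<Longrightarrow> F x \<le> (\<Sum>k. ennreal (f k x))) \<Longrightarrow>
     c \<le> (\<Sum>k. ennreal (L (f k)))"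
  shows "c \<le> upper F"
  unfolding upper_def by (rule Inf_greatest) (use assms in blast)

lemma upper_le:
  assumes "f \<in> Cpos" "\<And>x. x \<in> topspace T \<Longrightarrow> F x \<le> ennreal (f x)"
  shows "upper F \<le> ennreal (L f)"
proof -
  define g where "g k = (if k = 0 then f else (\<lambda>_. 0))" for k :: nat
  have eq: "(\<Sum>k. ennreal (g k x)) = f x" for x
    by (subst suminf_finite[of "{0}"]) (auto simp: g_def)
  have "upper F \<le> (\<Sum>k. ennreal (L (g k)))"
    by (rule upper_leI, use assms in \<open>auto simp: eq\<close>) (auto simp: g_def Cpos_def)
  also have "\<dots> = ennreal (L f)"
    by (subst suminf_finite[of "{0}"]) (auto simp: g_def L_zero)
  finally show ?thesis .
qed

lemma upper_mono: "(\<And>x. x \<in> topspace T \<Longrightarrow> F x \<le> G x) \<Longrightarrow> upper F \<le> upper G"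
  by (intro upper_geI upper_leI) (auto intro: order_trans)

text \<open>Covering series that are optimal up to \<open>e * (1/2)^Suc n\<close> are merged into
  one series along \<open>prod_decode\<close>; the errors add up to \<open>e\<close>.\<close>

lemma upper_countably_subadditive: "upper (\<lambda>x. \<Sum>n. F n x) \<le> (\<Sum>n. upper (F n))"
proof (rule ennreal_le_epsilon)
  fix e :: real assume e: "0 < e" "(\<Sum>n. upper (F n)) < top"
  then have *: "upper (F n) < upper (F n) + e * (1/2)^Suc n" for n
    by (auto simp add: less_top dest!: ennreal_suminf_lessD)
  have "\<exists>f. (\<forall>k. f k \<in> Cpos) \<and> (\<forall>x\<in>topspace T. F n x \<le> (\<Sum>k. ennreal (f k x))) \<and>
      (\<Sum>k. ennreal (L (f k))) \<le> upper (F n) + e * (1/2)^Suc n" for n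
    using *[of n] unfolding upper_def[of "F n"] Inf_less_iff by (force dest: less_imp_le)
  then obtain f where f: "\<And>n k. f n k \<in> Cpos"
      "\<And>n x. x \<in> topspace T \<Longrightarrow> F n x \<le> (\<Sum>k. ennreal (f n k x))"
      "\<And>n. (\<Sum>k. ennreal (L (f n k))) \<le> upper (F n) + e * (1/2)^Suc n"
    by metis
  define C where "C = case_prod f o prod_decode"
  have "upper (\<lambda>x. \<Sum>n. F n x) \<le> (\<Sum>k. ennreal (L (C k)))"
  proof (rule upper_leI)
    show "C k \<in> Cpos" for k using f by (auto simp: C_def split: prod.split)
    fix x assume x: "x \<in> topspace T"
    have "(\<Sum>n. F n x) \<le> (\<Sum>n. \<Sum>k. ennreal (f n k x))"
      by (intro suminf_le summableI f x)
    also have "\<dots> = (\<Sum>k. ennreal (C k x))"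
      unfolding C_def comp_def using suminf_ennreal_2dimen[of "\<lambda>n. \<Sum>k. ennreal (f n k x)" "\<lambda>(n,k). ennreal (f n k x)"]
      by (simp add: split_def)
    finally show "(\<Sum>n. F n x) \<le> (\<Sum>k. ennreal (C k x))" .
  qed
  also have "\<dots> = (\<Sum>n. \<Sum>k. ennreal (L (f n k)))"
    unfolding C_def comp_def
    using suminf_ennreal_2dimen[of "\<lambda>n. \<Sum>k. ennreal (L (f n k))" "\<lambda>(n,k). ennreal (L (f n k))"]
    by (simp add: split_def)
  also have "\<dots> \<le> (\<Sum>n. upper (F n) + e * (1/2) ^ Suc n)"
    by (intro suminf_le summableI f)
  also have "\<dots> = (\<Sum>n. upper (F n)) + (\<Sum>n. ennreal e * ennreal ((1/2) ^ Suc n))"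
    using \<open>0 < e\<close> by (subst suminf_add[symmetric])
                     (auto simp del: ennreal_suminf_cmult simp add: ennreal_mult[symmetric])
  also have "\<dots> = (\<Sum>n. upper (F n)) + e"
    unfolding ennreal_suminf_cmult
    by (subst suminf_ennreal_eq[OF zero_le_power power_half_series]) auto
  finally show "upper (\<lambda>x. \<Sum>n. F n x) \<le> (\<Sum>n. upper (F n)) + e" .
qed

text \<open>The \<open>w i\<close> together with the remainder form a partition of unity.
  Multiplying a covering series of \<open>A\<close> by one weight covers the weighted indicator, and
  by linearity of \<open>L\<close> the costs of all these series add up to the cost of the original
  one. This supplies the superadditive half of the Caratheodory condition.\<close>

lemma upper_split:
  fixes n :: nat
  assumes w: "\<And>i. i < n \<Longrightarrow> w i \<in> Cpos" and le: "\<And>x. x \<in> topspace T \<Longrightarrow> (\<Sum>i<n. w i x) \<le> 1"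
  shows "(\<Sum>i<n. upper (\<lambda>x. indicator A x * ennreal (w i x))) +
      upper (\<lambda>x. indicator A x * ennreal (1 - (\<Sum>i<n. w i x))) \<le> upper (indicator A)"
proof (rule upper_geI)
  fix f assume f: "\<And>k::nat. f k \<in> Cpos"
    and A: "\<And>x. x \<in> topspace T \<Longrightarrow> indicator A x \<le> (\<Sum>k. ennreal (f k x))"
  let ?v = "\<lambda>x. 1 - (\<Sum>i<n. w i x)"
  have "continuous_map T euclideanreal ?v"
    by (intro continuous_map_diff continuous_map_sum) (auto intro: w[THEN Cpos_cont])
  then have v: "?v \<in> Cpos" using le by (simp add: Cpos_def)
  have part: "upper (\<lambda>x. indicator A x * ennreal (u x)) \<le> (\<Sum>k. ennreal (L (\<lambda>x. f k x * u x)))"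
    if u: "u \<in> Cpos" for u
  proof (rule upper_leI)
    show "(\<lambda>x. f k x * u x) \<in> Cpos" for k by (rule Cpos_mult[OF f u])
    fix x assume x: "x \<in> topspace T"
    have "indicator A x * ennreal (u x) \<le> (\<Sum>k. ennreal (f k x)) * ennreal (u x)"
      by (rule mult_right_mono[OF A[OF x]]) simp
    also have "\<dots> = (\<Sum>k. ennreal (f k x * u x))"
      using Cpos_nonneg[OF f x] Cpos_nonneg[OF u x] by (simp add: ennreal_mult)
    finally show "indicator A x * ennreal (u x) \<le> (\<Sum>k. ennreal (f k x * u x))" .
  qed
  have "(\<Sum>i<n. upper (\<lambda>x. indicator A x * ennreal (w i x))) + upper (\<lambda>x. indicator A x * ennreal (?v x))
     \<le> (\<Sum>i<n. \<Sum>k. ennreal (L (\<lambda>x. f k x * w i x))) + (\<Sum>k. ennreal (L (\<lambda>x. f k x * ?v x)))"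
    by (intro add_mono sum_mono part v w) auto
  also have "\<dots> = (\<Sum>k. (\<Sum>i<n. ennreal (L (\<lambda>x. f k x * w i x))) + ennreal (L (\<lambda>x. f k x * ?v x)))"
    by (subst suminf_sum[symmetric]) (auto simp: suminf_add)
  also have "\<dots> = (\<Sum>k. ennreal (L (f k)))"
  proof (intro arg_cong[where f=suminf] ext)
    fix k
    have "(\<Sum>i<n. ennreal (L (\<lambda>x. f k x * w i x))) + ennreal (L (\<lambda>x. f k x * ?v x)) =
      ennreal ((\<Sum>i<n. L (\<lambda>x. f k x * w i x)) + L (\<lambda>x. f k x * ?v x))"
      using w v f by (subst ennreal_plus) (auto intro!: sum_nonneg Cpos_L Cpos_mult sum_ennreal)
    also have "(\<Sum>i<n. L (\<lambda>x. f k x * w i x)) = L (\<lambda>x. \<Sum>i<n. f k x * w i x)"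
      using w f by (intro L_sum[symmetric]) (auto intro!: Cpos_cont Cpos_mult)
    also have "\<dots> + L (\<lambda>x. f k x * ?v x) = L (\<lambda>x. (\<Sum>i<n. f k x * w i x) + f k x * ?v x)"
      using w f v by (intro add[symmetric]) (auto intro!: continuous_map_sum Cpos_cont[OF Cpos_mult] v)
    also have "(\<lambda>x. (\<Sum>i<n. f k x * w i x) + f k x * ?v x) = f k"
      by (auto simp: sum_distrib_left[symmetric] algebra_simps)
    finally show "(\<Sum>i<n. ennreal (L (\<lambda>x. f k x * w i x))) + ennreal (L (\<lambda>x. f k x * ?v x)) = ennreal (L (f k))" .
  qed
  finally show "(\<Sum>i<n. upper (\<lambda>x. indicator A x * ennreal (w i x))) +
      upper (\<lambda>x. indicator A x * ennreal (?v x)) \<le> (\<Sum>k. ennreal (L (f k)))" .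
qed

lemma upper_zero: "upper (\<lambda>_. 0) = 0"
proof -
  have "upper (\<lambda>_. 0) \<le> ennreal (L (\<lambda>_. 0))" by (rule upper_le) (auto simp: Cpos_def)
  then show ?thesis by (simp add: L_zero)
qed

text \<open>The lower bound is a Dini argument: the partial sums of a covering series exceed
  \<open>1 - e\<close> on increasing open sets that cover the space, so by compactness a single
  partial sum exceeds \<open>1 - e\<close> everywhere.\<close>

lemma upper_one: "upper (\<lambda>_. 1) = 1"
proof (rule antisym)
  show "upper (\<lambda>_. 1) \<le> 1" using upper_le[of "\<lambda>_. 1" "\<lambda>_. 1"] by (simp add: Cpos_def one)
  show "1 \<le> upper (\<lambda>_. 1)"
  proof (rule upper_geI)
    fix f assume f: "\<And>k::nat. f k \<in> Cpos" and ge: "\<And>x. x \<in> topspace T \<Longrightarrow> 1 \<le> (\<Sum>k. ennreal (f k x))"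
    show "1 \<le> (\<Sum>k. ennreal (L (f k)))"
    proof (rule ennreal_le_epsilon)
      fix e :: real assume e: "0 < e"
      define S where "S n x = (\<Sum>k<n. f k x)" for n :: nat and x
      have S: "continuous_map T euclideanreal (S n)" for n
        unfolding S_def by (intro continuous_map_sum Cpos_cont f) auto
      have Smono: "S m x \<le> S n x" if "m \<le> n" "x \<in> topspace T" for m n x
        unfolding S_def using that f by (intro sum_mono2) (auto intro: Cpos_nonneg)
      define W where "W n = {x \<in> topspace T. S n x \<in> {1 - e<..}}" for n
      have "openin T (W n)" for n
        unfolding W_def
        by (rule openin_continuous_map_preimage[OF S]) (rule open_openin[THEN iffD1, OF open_greaterThan])
      then have oW: "\<And>U. U \<in> range W \<Longrightarrow> openin T U" by blast
      have "\<exists>n. x \<in> W n" if x: "x \<in> topspace T" for x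
      proof -
        have "ennreal (1 - e) < 1" using e by (simp add: ennreal_less_one_iff)
        then have "ennreal (1 - e) < (\<Sum>k. ennreal (f k x))" using ge[OF x] by (rule less_le_trans)
        then obtain n where "ennreal (1 - e) < (\<Sum>k<n. ennreal (f k x))"
          unfolding suminf_eq_SUP less_SUP_iff by blast
        also have "(\<Sum>k<n. ennreal (f k x)) = ennreal (S n x)"
          unfolding S_def by (intro sum_ennreal Cpos_nonneg[OF f x])
        finally have "1 - e < S n x" using ennreal_leI[of "S n x" "1 - e"] by (meson not_less)
        then show ?thesis using x by (auto simp: W_def)
      qed
      then have "topspace T \<subseteq> \<Union>(range W)" by blast
      then have "\<exists>\<F>. finite \<F> \<and> \<F> \<subseteq> range W \<and> topspace T \<subseteq> \<Union>\<F>"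
        by (rule compactinD[OF compact[unfolded compact_space_def] oW, rotated])
      then obtain \<F> where \<F>: "finite \<F>" "\<F> \<subseteq> range W" "topspace T \<subseteq> \<Union>\<F>"
        by (elim exE conjE) (rule that)
      have "\<exists>I\<subseteq>UNIV. finite I \<and> \<F> = W ` I" by (rule finite_subset_image[OF \<F>(1,2)])
      then obtain I where I: "finite I" "\<F> = W ` I" by (elim exE conjE) (rule that)
      define n where "n = Max (insert 0 I)"
      have "1 - e \<le> S n x" if x: "x \<in> topspace T" for x
      proof -
        obtain m where m: "m \<in> I" "x \<in> W m" using \<F>(3) x I by auto
        then have "m \<le> n" unfolding n_def using I by auto
        then show ?thesis using Smono[of m n x] m x by (simp add: W_def)
      qed
      then have "L (\<lambda>_. (1 - e) * 1) \<le> L (S n)" by (intro L_mono S) auto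
      also have "L (\<lambda>_. (1 - e) * 1) = 1 - e" using scale[of "\<lambda>_. 1" "1 - e"] one by simp
      also have "L (S n) = (\<Sum>k<n. L (f k))" unfolding S_def by (intro L_sum Cpos_cont f)
      finally have "1 \<le> (\<Sum>k<n. L (f k)) + e" by simp
      then have "1 \<le> ennreal ((\<Sum>k<n. L (f k)) + e)" by simp
      also have "\<dots> = ennreal (\<Sum>k<n. L (f k)) + ennreal e"
        using e by (intro ennreal_plus sum_nonneg Cpos_L f) auto
      also have "ennreal (\<Sum>k<n. L (f k)) = (\<Sum>k<n. ennreal (L (f k)))"
        by (intro sum_ennreal[symmetric] Cpos_L f)
      also have "(\<Sum>k<n. ennreal (L (f k))) + ennreal e \<le> (\<Sum>k. ennreal (L (f k))) + ennreal e"
        by (intro add_mono sum_le_suminf) auto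
      finally show "1 \<le> (\<Sum>k. ennreal (L (f k))) + ennreal e" .
    qed
  qed
qed

section \<open>The Caratheodory outer measure of the functional\<close>

definition outer :: "'a set \<Rightarrow> ennreal" where "outer A = upper (indicator A)"

lemma outer_measure_space_outer: "outer_measure_space (Pow (topspace T)) outer"
  unfolding outer_measure_space_def
proof (intro conjI)
  show "positive (Pow (topspace T)) outer"
    using upper_zero by (simp add: positive_def outer_def indicator_def[abs_def])
  show "increasing (Pow (topspace T)) outer"
    unfolding increasing_def outer_def by (auto intro!: upper_mono simp: indicator_def)
  show "countably_subadditive (Pow (topspace T)) outer"
    unfolding countably_subadditive_def outer_def
  proof (intro allI impI)
    fix A :: "nat \<Rightarrow> 'a set" assume "disjoint_family A"
    then have "indicator (\<Union>i. A i) = (\<lambda>x. \<Sum>i. indicator (A i) x :: ennreal)"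
      by (intro ext suminf_indicator[symmetric])
    then show "upper (indicator (\<Union>i. A i)) \<le> (\<Sum>i. upper (indicator (A i)))"
      using upper_countably_subadditive[of "\<lambda>i. indicator (A i)"] by simp
  qed
qed

text \<open>The functions \<open>u n\<close> increase to the indicator of \<open>V\<close>, so their
  increments \<open>w n\<close> sum to it, and \<open>1 - u n\<close> is 1 off \<open>V\<close>.
  Countable subadditivity bounds the part of \<open>A\<close> in \<open>V\<close> by the weighted
  pieces, and \<open>upper_split\<close> bounds finitely many pieces plus the part outside
  \<open>V\<close> by \<open>outer A\<close>.\<close>

lemma openin_lambda_system:
  assumes V: "openin T V"
  shows "V \<in> lambda_system (topspace T) (Pow (topspace T)) outer"
proof -
  interpret sigma_algebra "topspace T" "Pow (topspace T)" by (rule sigma_algebra_Pow)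
  have oms: "countably_subadditive (Pow (topspace T)) outer" "positive (Pow (topspace T)) outer"
    using outer_measure_space_outer by (auto simp: outer_measure_space_def)
  have sub: "subadditive (Pow (topspace T)) outer"
    using countably_subadditive_subadditive[OF oms(2,1)] .
  obtain h where h: "continuous_map T euclideanreal h" "\<And>x. x \<in> topspace T \<Longrightarrow> 0 \<le> h x"
    "\<And>x. x \<in> topspace T \<Longrightarrow> h x = 0 \<longleftrightarrow> x \<in> topspace T - V"
    using closedin_zero_set[OF metrizable, of "topspace T - V"] V by (metis closedin_diff closedin_topspace)
  define u where "u n x = min 1 (real n * h x)" for n x
  define w where "w n x = u (Suc n) x - u n x" for n x
  have uc: "continuous_map T euclideanreal (u n)" for n
    unfolding u_def by (intro continuous_intros h)
  have w: "w n \<in> Cpos" for n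
    unfolding Cpos_def
  proof (intro CollectI conjI ballI)
    show "continuous_map T euclideanreal (w n)"
      unfolding w_def by (intro continuous_map_diff uc)
    fix x assume "x \<in> topspace T"
    then show "0 \<le> w n x" using h(2)[of x] by (auto simp: w_def u_def min_def algebra_simps)
  qed
  have sw: "(\<Sum>i<n. w i x) = u n x" if "x \<in> topspace T" for n x
    unfolding w_def using sum_lessThan_telescope[of "\<lambda>n. u n x" n] by (simp add: u_def)
  have inf: "(\<Sum>n. ennreal (w n x)) = indicator V x" if x: "x \<in> topspace T" for x
  proof -
    have nn: "0 \<le> w i x" for i using w x by (auto simp: Cpos_def)
    have "(\<lambda>n. u n x) \<longlonglongrightarrow> indicator V x"
    proof (cases "x \<in> V")
      case True
      then have "h x > 0" using h(2,3)[OF x] by (auto simp: less_le)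
      then obtain N where N: "1 \<le> real N * h x"
        by (metis less_eq_real_def reals_Archimedean3)
      have "u n x = 1" if "n \<ge> N" for n
      proof -
        have "real N * h x \<le> real n * h x" using that h(2)[OF x] by (intro mult_right_mono) auto
        then show ?thesis using N by (simp add: u_def)
      qed
      then have "eventually (\<lambda>n. u n x = indicator V x) sequentially"
        using True by (auto simp: eventually_sequentially)
      then show ?thesis by (rule tendsto_eventually)
    next
      case False
      then have "h x = 0" using h(3)[OF x] x by auto
      then show ?thesis using False by (simp add: u_def)
    qed
    then have "(\<lambda>n. w n x) sums indicator V x"
      unfolding sums_def by (simp add: sw[OF x])
    from suminf_ennreal_eq[OF nn this] show ?thesis by (simp add: ennreal_indicator)
  qed
  have "outer (V \<inter> A) + outer ((topspace T - V) \<inter> A) = outer A" if A: "A \<subseteq> topspace T" for A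
  proof (rule antisym)
    have "outer (V \<inter> A) \<le> (\<Sum>n. upper (\<lambda>x. indicator A x * ennreal (w n x)))"
    proof -
      have "outer (V \<inter> A) \<le> upper (\<lambda>x. \<Sum>n. indicator A x * ennreal (w n x))"
        unfolding outer_def by (rule upper_mono) (auto simp: inf indicator_def)
      also have "\<dots> \<le> (\<Sum>n. upper (\<lambda>x. indicator A x * ennreal (w n x)))"
        by (rule upper_countably_subadditive)
      finally show ?thesis .
    qed
    then have "outer (V \<inter> A) + outer ((topspace T - V) \<inter> A) \<le>
        (\<Sum>n. upper (\<lambda>x. indicator A x * ennreal (w n x))) + outer ((topspace T - V) \<inter> A)"
      by (rule add_right_mono)
    also have "\<dots> \<le> outer A"
    proof (rule ennreal_suminf_bound_add)
      fix n
      have "outer ((topspace T - V) \<inter> A) \<le> upper (\<lambda>x. indicator A x * ennreal (1 - (\<Sum>i<n. w i x)))"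
        unfolding outer_def
      proof (rule upper_mono)
        fix x assume x: "x \<in> topspace T"
        show "indicator ((topspace T - V) \<inter> A) x \<le> indicator A x * ennreal (1 - (\<Sum>i<n. w i x))"
          using h(3)[OF x] x by (auto simp: sw[OF x] u_def indicator_def)
      qed
      then have "(\<Sum>i<n. upper (\<lambda>x. indicator A x * ennreal (w i x))) + outer ((topspace T - V) \<inter> A) \<le>
          (\<Sum>i<n. upper (\<lambda>x. indicator A x * ennreal (w i x))) +
          upper (\<lambda>x. indicator A x * ennreal (1 - (\<Sum>i<n. w i x)))"
        by (rule add_left_mono)
      also have "\<dots> \<le> outer A"
        unfolding outer_def by (rule upper_split[OF w]) (simp add: sw u_def)
      finally show "(\<Sum>i<n. upper (\<lambda>x. indicator A x * ennreal (w i x))) + outer ((topspace T - V) \<inter> A) \<le> outer A" .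
    qed
    finally show "outer (V \<inter> A) + outer ((topspace T - V) \<inter> A) \<le> outer A" .
    have "A = (V \<inter> A) \<union> ((topspace T - V) \<inter> A)" using A by auto
    then show "outer A \<le> outer (V \<inter> A) + outer ((topspace T - V) \<inter> A)"
      using subadditiveD[OF sub, of "V \<inter> A" "(topspace T - V) \<inter> A"] A by auto
  qed
  then show ?thesis
    using openin_subset[OF V] unfolding lambda_system_def by auto
qed

section \<open>The representing measure and its integrals\<close>

definition riesz_measure :: "'a measure" where
  "riesz_measure = measure_of (topspace T) {U. openin T U} outer"

lemma sets_riesz_measure: "sets riesz_measure = sets (borel_of T)"
  unfolding riesz_measure_def sets_borel_of by (rule sets_measure_of) (auto dest: openin_subset)

lemma space_riesz_measure: "space riesz_measure = topspace T"
  using sets_eq_imp_space_eq[OF sets_riesz_measure] by simp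

lemma emeasure_riesz_measure:
  assumes "A \<in> sets (borel_of T)" shows "emeasure riesz_measure A = outer A"
proof -
  interpret sigma_algebra "topspace T" "Pow (topspace T)" by (rule sigma_algebra_Pow)
  let ?S = "lambda_system (topspace T) (Pow (topspace T)) outer"
  have ms: "measure_space (topspace T) ?S outer"
    by (rule caratheodory_lemma[OF outer_measure_space_outer])
  then have sa: "sigma_algebra (topspace T) ?S" by (simp add: measure_space_def)
  have "sigma_sets (topspace T) {U. openin T U} \<subseteq> ?S"
    by (rule sigma_algebra.sigma_sets_subset[OF sa]) (auto intro: openin_lambda_system)
  moreover have "sigma_algebra (topspace T) (sigma_sets (topspace T) {U. openin T U})"
    by (rule sigma_algebra_sigma_sets) (auto dest: openin_subset)
  ultimately have "measure_space (topspace T) (sigma_sets (topspace T) {U. openin T U}) outer"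
    by (intro measure_down[OF ms])
  then show ?thesis
    using assms sets_riesz_measure
    by (intro emeasure_measure_of[OF riesz_measure_def])
       (auto simp: measure_space_def sets_borel_of dest: openin_subset)
qed

lemma prob_space_riesz_measure: "prob_space riesz_measure"
proof
  have "outer (topspace T) = upper (\<lambda>_. 1)"
    unfolding outer_def by (intro antisym upper_mono) auto
  then show "emeasure riesz_measure (space riesz_measure) = 1"
    using emeasure_riesz_measure[of "topspace T"] upper_one sets.top[of "borel_of T"]
    by (simp add: space_riesz_measure)
qed

text \<open>The graph of \<open>n f\<close> is cut into horizontal slices of height 1. The slice
  \<open>g i\<close> is 1 on the level set \<open>S i\<close>, so \<open>L (g i)\<close> bounds the
  measure of \<open>S i\<close>; the slices sum to \<open>n f\<close>, whereas the indicators of the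
  \<open>S i\<close> sum to at least \<open>n f - 1\<close>. The error is \<open>1 / n\<close> after
  division.\<close>

lemma integral_riesz_measure_le:
  assumes f: "continuous_map T euclideanreal f" and bd: "\<And>x. x \<in> topspace T \<Longrightarrow> 0 \<le> f x \<and> f x \<le> 1"
  shows "(\<integral>x. f x \<partial>riesz_measure) \<le> L f"
proof (rule field_le_epsilon)
  interpret N: prob_space riesz_measure by (rule prob_space_riesz_measure)
  fix e :: real assume "0 < e"
  then obtain n :: nat where n: "n > 0" "1 / real n < e"
    by (metis nat_approx_posE of_nat_0_less_iff zero_less_Suc)
  define g where "g i x = min 1 (max 0 (real n * f x - real i))" for i x
  have gc: "continuous_map T euclideanreal (g i)" for i
    unfolding g_def by (intro continuous_intros f)
  then have gC: "g i \<in> Cpos" for i by (auto simp: Cpos_def g_def)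
  define S where "S i = {x \<in> topspace T. f x \<in> {real (Suc i) / real n ..}}" for i
  have S: "S i \<in> sets (borel_of T)" for i
    unfolding S_def by (intro borel_of_closedin closedin_continuous_map_preimage[OF f]) auto
  have le1: "measure riesz_measure (S i) \<le> L (g i)" for i
  proof -
    have "emeasure riesz_measure (S i) \<le> ennreal (L (g i))"
      unfolding emeasure_riesz_measure[OF S] outer_def using n
      by (intro upper_le gC) (auto simp: S_def g_def indicator_def field_simps)
    then show ?thesis using Cpos_L[OF gC, of i] by (simp add: N.emeasure_eq_measure)
  qed
  have sumg: "(\<Sum>i<m. min 1 (max 0 (t - real i))) = min t (real m)" if "0 \<le> t" for t :: real and m
    using that by (induction m) (auto simp: min_def max_def)
  \<comment> \<open>The sum counts the integers from 1 to \<open>m\<close> that are at most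
    \<open>t\<close>, hence it misses \<open>t\<close> by at most 1.\<close>
  have sumS: "t - 1 \<le> (\<Sum>i<m. if real (Suc i) \<le> t then 1 else 0)" if "0 \<le> t" "t \<le> real m" for t :: real and m
    using that
  proof (induction m arbitrary: t)
    case (Suc m)
    show ?case
    proof (cases "real (Suc m) \<le> t")
      case True
      have "(\<Sum>i<Suc m. if real (Suc i) \<le> t then 1 else 0 :: real) = (\<Sum>i<Suc m. 1)"
        using True by (intro sum.cong refl) auto
      then show ?thesis using Suc.prems by simp
    next
      case False
      show ?thesis
      proof (cases "t \<le> real m")
        case True then show ?thesis using Suc.IH[of t] Suc.prems False by auto
      next
        case F2: False
        have "(\<Sum>i<m. if real (Suc i) \<le> t then 1 else 0 :: real) = (\<Sum>i<m. 1)"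
          using F2 by (intro sum.cong refl) auto
        then show ?thesis using False by simp
      qed
    qed
  qed simp
  have intf: "integrable riesz_measure f"
    by (rule N.integrable_const_bound[where B=1])
       (use bd continuous_map_borel_measurable[OF f] in
         \<open>auto simp: space_riesz_measure cong: measurable_cong_sets[OF sets_riesz_measure refl]\<close>)
  have intS: "integrable riesz_measure (indicator (S i) :: 'a \<Rightarrow> real)" for i
    using S by (intro integrable_real_indicator) (simp_all add: sets_riesz_measure N.emeasure_eq_measure)
  have "real n * (\<integral>x. f x \<partial>riesz_measure) - 1 = (\<integral>x. real n * f x - 1 \<partial>riesz_measure)"
    using intf by (simp add: N.prob_space)
  also have "\<dots> \<le> (\<integral>x. (\<Sum>i<n. indicator (S i) x) \<partial>riesz_measure)"
  proof (rule integral_mono)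
    show "integrable riesz_measure (\<lambda>x. real n * f x - 1)" using intf by simp
    show "integrable riesz_measure (\<lambda>x. \<Sum>i<n. indicator (S i) x :: real)"
      by (rule Bochner_Integration.integrable_sum) (rule intS)
    fix x assume "x \<in> space riesz_measure"
    then have x: "x \<in> topspace T" by (simp add: space_riesz_measure)
    have "real n * f x - 1 \<le> (\<Sum>i<n. if real (Suc i) \<le> real n * f x then 1 else 0)"
      using bd[OF x] by (intro sumS) (auto simp: mult_left_le)
    also have "\<dots> = (\<Sum>i<n. indicator (S i) x)"
      using x n by (intro sum.cong) (auto simp: S_def indicator_def field_simps)
    finally show "real n * f x - 1 \<le> (\<Sum>i<n. indicator (S i) x)" .
  qed
  also have "\<dots> = (\<Sum>i<n. measure riesz_measure (S i))"
  proof -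
    have "S i \<inter> space riesz_measure = S i" for i
      by (auto simp: S_def space_riesz_measure)
    moreover have "(\<integral>x. (\<Sum>i<n. indicator (S i) x :: real) \<partial>riesz_measure) =
        (\<Sum>i<n. \<integral>x. indicator (S i) x \<partial>riesz_measure)"
      by (rule Bochner_Integration.integral_sum) (rule intS)
    ultimately show ?thesis by (simp add: integral_indicator)
  qed
  also have "\<dots> \<le> (\<Sum>i<n. L (g i))" by (intro sum_mono le1)
  also have "\<dots> = L (\<lambda>x. \<Sum>i<n. g i x)" by (intro L_sum[symmetric] gc)
  also have "\<dots> \<le> L (\<lambda>x. real n * f x)"
    using bd by (intro L_mono continuous_intros gc f) (auto simp: g_def sumg mult_left_le)
  also have "\<dots> = real n * L f" by (rule scale[OF f])
  finally have "real n * (\<integral>x. f x \<partial>riesz_measure) - 1 \<le> real n * L f" .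
  then have "(\<integral>x. f x \<partial>riesz_measure) \<le> L f + 1 / real n"
    using n by (simp add: field_simps)
  then show "(\<integral>x. f x \<partial>riesz_measure) \<le> L f + e" using n by simp
qed

text \<open>The one-sided bound is applied to \<open>1/2 + k * f x\<close> for both signs of
  \<open>k\<close>. The size \<open>1 / (2 * b)\<close> of \<open>k\<close> keeps the values in
  [0,1], and the two resulting inequalities are opposite.\<close>

theorem integral_riesz_measure:
  assumes f: "continuous_map T euclideanreal f"
  shows "(\<integral>x. f x \<partial>riesz_measure) = L f"
proof -
  interpret N: prob_space riesz_measure by (rule prob_space_riesz_measure)
  obtain c where c: "\<And>x. x \<in> topspace T \<Longrightarrow> \<bar>f x\<bar> \<le> c"
    using continuous_map_compact_bounded[OF compact f] by blast
  \<comment> \<open>Adding 1 makes \<open>b\<close> positive, so that it can stand in a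
    denominator.\<close>
  define b where "b = max c 0 + 1"
  have b: "b > 0" "\<And>x. x \<in> topspace T \<Longrightarrow> \<bar>f x\<bar> \<le> b"
    using c unfolding b_def by fastforce+
  have intf: "integrable riesz_measure f"
    by (rule N.integrable_const_bound[where B=b])
       (use b continuous_map_borel_measurable[OF f] in
         \<open>auto simp: space_riesz_measure cong: measurable_cong_sets[OF sets_riesz_measure refl]\<close>)
  have Lc: "L (\<lambda>x. 1/2 + k * f x) = 1/2 + k * L f" for k
    using add[of "\<lambda>_. 1/2" "\<lambda>x. k * f x"] scale[OF f, of k] scale[of "\<lambda>_. 1" "1/2"] one f
    by (simp add: continuous_map_real_mult_left)
  have le: "1/2 + k * (\<integral>x. f x \<partial>riesz_measure) \<le> 1/2 + k * L f" if k: "\<bar>k\<bar> = 1 / (2 * b)" for k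
  proof -
    have "1/2 + k * (\<integral>x. f x \<partial>riesz_measure) = (\<integral>x. 1/2 + k * f x \<partial>riesz_measure)"
      using intf by (simp add: N.prob_space)
    also have "\<dots> \<le> L (\<lambda>x. 1/2 + k * f x)"
    proof (rule integral_riesz_measure_le)
      show "continuous_map T euclideanreal (\<lambda>x. 1/2 + k * f x)" by (intro continuous_intros f)
      fix x assume "x \<in> topspace T"
      then have "\<bar>k * f x\<bar> \<le> 1 / (2 * b) * b"
        unfolding abs_mult k using b by (intro mult_left_mono) auto
      also have "\<dots> = 1/2" using b(1) by simp
      finally have "\<bar>k * f x\<bar> \<le> 1/2" .
      then show "0 \<le> 1/2 + k * f x \<and> 1/2 + k * f x \<le> 1" by (simp only: abs_le_iff) linarith
    qed
    finally show ?thesis by (simp add: Lc)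
  qed
  show ?thesis
    using le[of "1 / (2*b)"] le[of "- (1 / (2*b))"] b by (simp add: field_simps)
qed

end

section \<open>Standard Borel spaces\<close>

text \<open>The base consists of the balls of radius \<open>1 / (n + 1)\<close> around the points of
  a finite net for that radius.\<close>

lemma compact_metrizable_second_countable:
  assumes "compact_space T" "metrizable_space T"
  shows "second_countable T"
proof -
  obtain M d where M: "Metric_space M d" "T = Metric_space.mtopology M d"
    using assms(2) unfolding metrizable_space_def by blast
  interpret Metric_space M d by fact
  have "mtotally_bounded M"
    using assms(1) M(2) by (simp add: compact_space_def compactin_imp_mtotally_bounded)
  then have "\<exists>K. finite K \<and> K \<subseteq> M \<and> M \<subseteq> (\<Union>x\<in>K. mball x (inverse (real (Suc n))))" for n
    unfolding mtotally_bounded_def by simp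
  then obtain K where K: "\<And>n. finite (K n)" "\<And>n. K n \<subseteq> M"
      "\<And>n. M \<subseteq> (\<Union>x\<in>K n. mball x (inverse (real (Suc n))))"
    by metis
  define \<B> where "\<B> = (\<Union>n. (\<lambda>x. mball x (inverse (real (Suc n)))) ` K n)"
  have "countable \<B>" unfolding \<B>_def using K(1) by (auto intro: countable_finite)
  moreover have "\<forall>V\<in>\<B>. openin T V" unfolding \<B>_def M(2) by auto
  moreover have "\<exists>V\<in>\<B>. x \<in> V \<and> V \<subseteq> U" if U: "openin T U" "x \<in> U" for U x
  proof -
    have xM: "x \<in> M" using openin_subset[OF U(1)] U(2) M(2) by auto
    obtain r where r: "r > 0" "mball x r \<subseteq> U"
      using U unfolding M(2) openin_mtopology by blast
    obtain n where n: "inverse (real (Suc n)) < r / 2"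
      using reals_Archimedean[of "r/2"] r by auto
    obtain c where c: "c \<in> K n" "x \<in> mball c (inverse (real (Suc n)))"
      using K(3)[of n] xM by blast
    have "mball c (inverse (real (Suc n))) \<subseteq> mball x r"
    proof
      fix y assume y: "y \<in> mball c (inverse (real (Suc n)))"
      have "d x y \<le> d x c + d c y" using y xM c K(2)[of n] by (intro triangle) auto
      also have "\<dots> < r" using y c(2) n by (simp add: commute)
      finally show "y \<in> mball x r" using y xM by auto
    qed
    then show ?thesis using c r by (intro bexI[of _ "mball c (inverse (real (Suc n)))"]) (auto simp: \<B>_def)
  qed
  ultimately show ?thesis unfolding second_countable_def by blast
qed

lemma second_countable_euclidean: "second_countable (euclidean :: 'a::second_countable_topology topology)"
proof -
  obtain B :: "'a set set" where B: "countable B" "topological_basis B"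
    using ex_countable_basis by blast
  have "\<forall>V\<in>B. openin euclidean V"
    using topological_basis_open[OF B(2)] by (intro ballI open_openin[THEN iffD1])
  moreover have "\<exists>V\<in>B. x \<in> V \<and> V \<subseteq> U" if "openin euclidean U" "x \<in> U" for U x
    by (rule topological_basisE[OF B(2) open_openin[THEN iffD2, OF that(1)] that(2)]) blast
  ultimately show ?thesis unfolding second_countable_def using B(1) by blast
qed

text \<open>With countable bases every open set of the product is a countable union of open
  rectangles and so belongs to the product of the Borel algebras.\<close>

lemma continuous_map_prod_measurable:
  assumes f: "continuous_map (prod_topology T1 T2) T3 f"
    and T1: "second_countable T1" and T2: "second_countable T2"
  shows "f \<in> borel_of T1 \<Otimes>\<^sub>M borel_of T2 \<rightarrow>\<^sub>M borel_of T3"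
  unfolding borel_of_def[of T3]
proof (rule measurable_measure_of)
  have sp: "space (borel_of T1 \<Otimes>\<^sub>M borel_of T2) = topspace (prod_topology T1 T2)"
    by (simp add: space_pair_measure)
  show "f \<in> space (borel_of T1 \<Otimes>\<^sub>M borel_of T2) \<rightarrow> topspace T3"
    using f unfolding sp by (auto simp: continuous_map_def)
  fix U assume "U \<in> {U. openin T3 U}"
  then have op: "openin (prod_topology T1 T2) {x \<in> topspace (prod_topology T1 T2). f x \<in> U}" (is "openin _ ?V")
    using f by (auto simp: continuous_map_def)
  obtain B1 where B1: "countable B1" "\<And>V. V \<in> B1 \<Longrightarrow> openin T1 V"
      "\<And>U x. openin T1 U \<Longrightarrow> x \<in> U \<Longrightarrow> \<exists>V\<in>B1. x \<in> V \<and> V \<subseteq> U"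
    using T1 unfolding second_countable_def by metis
  obtain B2 where B2: "countable B2" "\<And>V. V \<in> B2 \<Longrightarrow> openin T2 V"
      "\<And>U x. openin T2 U \<Longrightarrow> x \<in> U \<Longrightarrow> \<exists>V\<in>B2. x \<in> V \<and> V \<subseteq> U"
    using T2 unfolding second_countable_def by metis
  define I where "I = {p \<in> B1 \<times> B2. fst p \<times> snd p \<subseteq> ?V}"
  have "countable I" unfolding I_def by (rule countable_subset[of _ "B1 \<times> B2"]) (use B1(1) B2(1) in auto)
  have "?V = (\<Union>p\<in>I. fst p \<times> snd p)"
  proof
    show "?V \<subseteq> (\<Union>p\<in>I. fst p \<times> snd p)"
    proof
      fix z assume "z \<in> ?V"
      moreover obtain x y where z: "z = (x, y)" by force
      ultimately have "(x, y) \<in> ?V" by simp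
      from op[unfolded openin_prod_topology_alt, rule_format, OF this]
      obtain W1 W2 where W: "openin T1 W1" "openin T2 W2" "x \<in> W1" "y \<in> W2" "W1 \<times> W2 \<subseteq> ?V"
        by (elim exE conjE) (rule that)
      obtain V1 where V1: "V1 \<in> B1" "x \<in> V1" "V1 \<subseteq> W1" using B1(3)[OF W(1,3)] by blast
      obtain V2 where V2: "V2 \<in> B2" "y \<in> V2" "V2 \<subseteq> W2" using B2(3)[OF W(2,4)] by blast
      have "(V1, V2) \<in> I" unfolding I_def using V1 V2 W(5) by auto
      then show "z \<in> (\<Union>p\<in>I. fst p \<times> snd p)" using V1 V2 z by force
    qed
  qed (auto simp: I_def)
  moreover have "fst p \<times> snd p \<in> sets (borel_of T1 \<Otimes>\<^sub>M borel_of T2)" if "p \<in> I" for p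
    using that B1(2) B2(2) unfolding I_def by (intro pair_measureI borel_of_openin) auto
  ultimately have "?V \<in> sets (borel_of T1 \<Otimes>\<^sub>M borel_of T2)"
    by (simp only:) (rule sets.countable_UN'[OF \<open>countable I\<close>], blast)
  then show "f -` U \<inter> space (borel_of T1 \<Otimes>\<^sub>M borel_of T2) \<in> sets (borel_of T1 \<Otimes>\<^sub>M borel_of T2)"
    unfolding sp by (simp add: vimage_def Int_def conj_commute)
qed (auto dest: openin_subset)

section \<open>Probability measures are determined by continuous functions\<close>

lemma closedin_indicator_limit:
  assumes "metrizable_space T" "closedin T C"
  obtains f :: "nat \<Rightarrow> 'a \<Rightarrow> real" where "\<And>n. continuous_map T euclideanreal (f n)"
    "\<And>n x. 0 \<le> f n x \<and> f n x \<le> 1" "\<And>x. x \<in> topspace T \<Longrightarrow> (\<lambda>n. f n x) \<longlonglongrightarrow> indicator C x"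
proof -
  obtain h where h: "continuous_map T euclideanreal h" "\<And>x. x \<in> topspace T \<Longrightarrow> 0 \<le> h x"
    "\<And>x. x \<in> topspace T \<Longrightarrow> h x = 0 \<longleftrightarrow> x \<in> C"
    using closedin_zero_set[OF assms] by metis
  \<comment> \<open>The clamps give the bounds at every point of the type, also off
    \<open>topspace T\<close>, where nothing is known about \<open>h\<close>.\<close>
  define f where "f n x = max 0 (min 1 (1 - real n * h x))" for n x
  show ?thesis
  proof (rule that[of f])
    show "continuous_map T euclideanreal (f n)" for n
      unfolding f_def by (intro continuous_intros h)
    show "0 \<le> f n x \<and> f n x \<le> 1" for n x by (simp add: f_def)
    fix x assume x: "x \<in> topspace T"
    show "(\<lambda>n. f n x) \<longlonglongrightarrow> indicator C x"
    proof (cases "x \<in> C")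
      case True
      then show ?thesis using h(3)[OF x] by (simp add: f_def)
    next
      case False
      then have "h x > 0" using h(2,3)[OF x] by (auto simp: less_le)
      then obtain N where N: "1 \<le> real N * h x"
        by (metis less_eq_real_def reals_Archimedean3)
      have "f n x = 0" if "n \<ge> N" for n
      proof -
        have "real N * h x \<le> real n * h x" using that h(2)[OF x] by (intro mult_right_mono) auto
        then show ?thesis using N by (simp add: f_def)
      qed
      then have "eventually (\<lambda>n. f n x = indicator C x) sequentially"
        using False by (auto simp: eventually_sequentially)
      then show ?thesis by (rule tendsto_eventually)
    qed
  qed
qed

lemma measure_closedin_limit:
  assumes f: "\<And>n. continuous_map T euclideanreal (f n)"
    "\<And>n x. 0 \<le> f n x \<and> f n x \<le> 1" "\<And>x. x \<in> topspace T \<Longrightarrow> (\<lambda>n. f n x) \<longlonglongrightarrow> indicator C x"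
    and C: "closedin T C"
    and N: "prob_space N" "sets N = sets (borel_of T)"
  shows "(\<lambda>n. \<integral>x. f n x \<partial>N) \<longlonglongrightarrow> measure N C"
proof -
  interpret prob_space N by fact
  have sp: "space N = topspace T" using sets_eq_imp_space_eq[OF N(2)] by simp
  have [measurable]: "C \<in> sets N" using borel_of_closedin[OF C] N(2) by simp
  have [measurable]: "f n \<in> borel_measurable N" for n
    using continuous_map_borel_measurable[OF f(1)] by (simp cong: measurable_cong_sets add: N(2))
  have "(\<lambda>n. \<integral>x. f n x \<partial>N) \<longlonglongrightarrow> (\<integral>x. indicator C x \<partial>N)"
  proof (rule integral_dominated_convergence[where w="\<lambda>_. 1"])
    show "AE x in N. (\<lambda>n. f n x) \<longlonglongrightarrow> indicat_real C x"
      by (rule AE_I2) (simp add: f(3) sp)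
    show "AE x in N. norm (f n x) \<le> 1" for n
      using f(2) by simp
  qed auto
  moreover have "(\<integral>x. indicator C x \<partial>N) = measure N C"
    using sets.sets_into_space[of C N] by (simp add: Int_absorb2)
  ultimately show ?thesis by simp
qed

lemma sets_borel_of_closedin: "sets (borel_of T) = sigma_sets (topspace T) {C. closedin T C}"
proof (rule antisym)
  show "sets (borel_of T) \<subseteq> sigma_sets (topspace T) {C. closedin T C}"
    unfolding sets_borel_of
  proof (rule sigma_sets_mono, safe)
    fix U assume U: "openin T U"
    have "topspace T - (topspace T - U) \<in> sigma_sets (topspace T) {C. closedin T C}"
      using U by (intro sigma_sets.Compl sigma_sets.Basic) auto
    then show "U \<in> sigma_sets (topspace T) {C. closedin T C}"
      using openin_subset[OF U] by (simp add: double_diff)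
  qed
  show "sigma_sets (topspace T) {C. closedin T C} \<subseteq> sets (borel_of T)"
    using sets.sigma_sets_subset[of "{C. closedin T C}" "borel_of T"] by (auto intro: borel_of_closedin)
qed

text \<open>Closed sets form a generating family that is stable under intersection, and their
  indicators are limits of continuous functions with values in [0,1].\<close>

lemma prob_measure_eqI_continuous:
  assumes "metrizable_space T"
    and N: "prob_space N" "sets N = sets (borel_of T)"
    and N': "prob_space N'" "sets N' = sets (borel_of T)"
    and eq: "\<And>f. continuous_map T euclideanreal f \<Longrightarrow> (\<And>x. 0 \<le> f x \<and> f x \<le> 1) \<Longrightarrow>
       (\<integral>x. f x \<partial>N) = (\<integral>x. f x \<partial>N')"
  shows "N = N'"
proof (rule measure_eqI_generator_eq[where E="{C. closedin T C}" and A="\<lambda>_. topspace T" and \<Omega>="topspace T"])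
  interpret N: prob_space N by fact
  interpret N': prob_space N' by fact
  fix C assume "C \<in> {C. closedin T C}"
  then have C: "closedin T C" by simp
  obtain f :: "nat \<Rightarrow> 'a \<Rightarrow> real" where f: "\<And>n. continuous_map T euclideanreal (f n)"
    "\<And>n x. 0 \<le> f n x \<and> f n x \<le> 1" "\<And>x. x \<in> topspace T \<Longrightarrow> (\<lambda>n. f n x) \<longlonglongrightarrow> indicator C x"
    using closedin_indicator_limit[OF assms(1) C] by metis
  have "measure N C = measure N' C"
    using measure_closedin_limit[OF f C N] measure_closedin_limit[OF f C N']
    by (simp add: eq[OF f(1,2)] LIMSEQ_unique)
  then show "emeasure N C = emeasure N' C"
    by (simp add: N.emeasure_eq_measure N'.emeasure_eq_measure)
qed (use N N' in \<open>auto simp: Int_stable_def sets_borel_of_closedin finite_measure.emeasure_finite[OF prob_space.finite_measure] dest: closedin_subset\<close>)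

section \<open>Countable generators and maps into standard Borel spaces\<close>

text \<open>A countable generator stable under intersection reduces the equality of two finite
  measures to countably many equations. Exceptional sets then remain null, and the set of parameters
  where two measures agree remains Borel. The finite intersections of a countable base
  serve.\<close>

lemma standard_borel_generator:
  assumes "standard_borel M"
  obtains \<A> where "countable \<A>" "\<A> \<subseteq> Pow (space M)" "Int_stable \<A>" "space M \<in> \<A>"
    "sets M = sigma_sets (space M) \<A>"
proof -
  obtain T where T: "second_countable T" "sets M = sets (borel_of T)"
    using assms unfolding standard_borel_def by blast
  have sp: "space M = topspace T" using sets_eq_imp_space_eq[OF T(2)] by simp
  obtain B where B: "countable B" "\<And>V. V \<in> B \<Longrightarrow> openin T V"
      "\<And>U x. openin T U \<Longrightarrow> x \<in> U \<Longrightarrow> \<exists>V\<in>B. x \<in> V \<and> V \<subseteq> U"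
    using T(1) unfolding second_countable_def by metis
  define \<F> where "\<F> = {F. finite F \<and> F \<noteq> {} \<and> F \<subseteq> insert (topspace T) B}"
  define \<A> where "\<A> = Inter ` \<F>"
  have op: "openin T A" if "A \<in> \<A>" for A
    using that B(2) unfolding \<A>_def \<F>_def by (auto intro!: openin_Inter)
  show ?thesis
  proof (rule that[of \<A>])
    have "countable {F. finite F \<and> F \<subseteq> insert (topspace T) B}"
      using B(1) by (intro countable_Collect_finite_subset) auto
    then have "countable \<F>" by (rule countable_subset[rotated]) (auto simp: \<F>_def)
    then show "countable \<A>" unfolding \<A>_def by simp
    show "\<A> \<subseteq> Pow (space M)" using op openin_subset sp by fastforce
    show "Int_stable \<A>"
    proof (rule Int_stableI)
      fix a b assume "a \<in> \<A>" "b \<in> \<A>"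
      then obtain F G where "F \<in> \<F>" "G \<in> \<F>" "a = \<Inter>F" "b = \<Inter>G" by (auto simp: \<A>_def)
      then have "F \<union> G \<in> \<F>" "a \<inter> b = \<Inter>(F \<union> G)" by (auto simp: \<F>_def)
      then show "a \<inter> b \<in> \<A>" unfolding \<A>_def by blast
    qed
    show "space M \<in> \<A>" unfolding \<A>_def sp by (rule image_eqI[of _ _ "{topspace T}"]) (auto simp: \<F>_def)
    have BA: "B \<subseteq> \<A>" unfolding \<A>_def
    proof
      fix V assume "V \<in> B"
      then show "V \<in> Inter ` \<F>" by (intro image_eqI[of _ _ "{V}"]) (auto simp: \<F>_def)
    qed
    show "sets M = sigma_sets (space M) \<A>"
    proof (rule antisym)
      show "sets M \<subseteq> sigma_sets (space M) \<A>"
        unfolding T(2) sets_borel_of sp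
      proof (rule sigma_sets_mono, safe)
        fix U assume U: "openin T U"
        have "U = \<Union>{V \<in> B. V \<subseteq> U}" using B(3)[OF U] by blast
        moreover have "\<Union>{V \<in> B. V \<subseteq> U} \<in> sigma_sets (topspace T) \<A>"
          using BA B(1) by (intro sigma_sets_UNION) (auto intro: countable_subset[of _ B])
        ultimately show "U \<in> sigma_sets (topspace T) \<A>" by simp
      qed
      show "sigma_sets (space M) \<A> \<subseteq> sets M"
        using op by (intro sets.sigma_sets_subset) (auto simp: T(2) borel_of_openin)
    qed
  qed
qed

text \<open>The point \<open>\<pi> z\<close> is the limit of the centres of small balls containing it, and \<open>\<rho> z\<close> determines
  which balls these are.\<close>
lemma point_realization:
  assumes X: "standard_borel X" and ne: "space X \<noteq> {}"
    and \<pi>: "\<pi> \<in> Z \<rightarrow>\<^sub>M X" and \<rho>: "\<rho> \<in> Z \<rightarrow>\<^sub>M Y"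
    and det: "\<And>A. A \<in> sets X \<Longrightarrow> \<exists>B\<in>sets Y. AE z in Z. \<pi> z \<in> A \<longleftrightarrow> \<rho> z \<in> B"
  obtains p where "p \<in> Y \<rightarrow>\<^sub>M X" "AE z in Z. \<pi> z = p (\<rho> z)"
proof -
  obtain T where T: "completely_metrizable_space T" "second_countable T" "sets X = sets (borel_of T)"
    using X unfolding standard_borel_def by blast
  have spX: "space X = topspace T" using sets_eq_imp_space_eq[OF T(3)] by simp
  obtain M d where M: "Metric_space M d" "Metric_space.mcomplete M d" "T = Metric_space.mtopology M d"
    using T(1) unfolding completely_metrizable_space_def by blast
  interpret Metric_space M d by fact
  have spM: "space X = M" using spX M(3) by simp
  have mt: "metrizable_space T" using T(1) by (rule completely_metrizable_imp_metrizable_space)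
  obtain C where C: "countable C" "C \<subseteq> M" "mtopology closure_of C = M"
    using second_countable_imp_separable_space[OF T(2)] unfolding separable_space_def M(3) by auto
  have Cne: "C \<noteq> {}" using C(3) ne spM by auto
  define q where "q = from_nat_into C"
  have q: "range q = C" unfolding q_def by (rule range_from_nat_into[OF Cne C(1)])
  have qM: "q i \<in> M" for i using q C(2) by auto
  have dense: "\<exists>i. d x (q i) < e" if xe: "x \<in> M" "e > 0" for x e
  proof -
    have "x \<in> mtopology closure_of C" using xe C(3) by simp
    then obtain y where "y \<in> C" "y \<in> mball x e"
      using xe unfolding metric_closure_of by blast
    then show ?thesis using q by auto
  qed
  define A where "A n i = mball (q i) (inverse (real (Suc n)))" for n i
  have "A n i \<in> sets X" for n i
    unfolding T(3) A_def M(3) by (rule borel_of_openin) simp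
  then have "\<exists>B\<in>sets Y. AE z in Z. \<pi> z \<in> A n i \<longleftrightarrow> \<rho> z \<in> B" for n i by (rule det)
  then obtain B where B: "\<And>n i. B n i \<in> sets Y" "\<And>n i. AE z in Z. \<pi> z \<in> A n i \<longleftrightarrow> \<rho> z \<in> B n i"
    by metis
  define idx where "idx n y = (LEAST i. y \<in> B n i)" for n y
  have [measurable]: "B n i \<in> sets Y" for n i by (rule B(1))
  have [measurable]: "idx n \<in> Y \<rightarrow>\<^sub>M count_space UNIV" for n
    unfolding idx_def by measurable
  define P where "P y n = q (idx n y)" for y n
  \<comment> \<open>This is the Cauchy property of \<open>P y\<close>, written with quantifiers over
    natural numbers so that the set is measurable.\<close>
  define G where "G = {y \<in> space Y. \<forall>k. \<exists>N. \<forall>n. \<forall>n'. N \<le> n \<longrightarrow> N \<le> n' \<longrightarrow>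
      d (P y n) (P y n') < inverse (real (Suc k))}"
  have [measurable]: "G \<in> sets Y"
    unfolding G_def P_def by measurable
  have G: "MCauchy (P y)" if "y \<in> G" for y
    unfolding MCauchy_def
  proof (intro conjI allI impI)
    show "range (P y) \<subseteq> M" unfolding P_def using qM by auto
    fix e :: real assume "e > 0"
    then obtain k where "inverse (real (Suc k)) < e" using reals_Archimedean by blast
    then show "\<exists>N. \<forall>n n'. N \<le> n \<longrightarrow> N \<le> n' \<longrightarrow> d (P y n) (P y n') < e"
      using that unfolding G_def by (blast intro: less_trans)
  qed
  have "\<exists>l. limitin mtopology (P y) l sequentially" if "y \<in> G" for y
    using G[OF that] M(2) unfolding mcomplete_def by blast
  then obtain l where l: "\<And>y. y \<in> G \<Longrightarrow> limitin mtopology (P y) (l y) sequentially"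
    by metis
  define p where "p y = (if y \<in> G then l y else q 0)" for y
  have pM: "p y \<in> M" for y
    using l[of y] qM limitin_topspace unfolding p_def by fastforce
  show ?thesis
  proof (rule that[of p])
    have "p -` E \<inter> space Y \<in> sets Y" if E: "closedin T E" for E
    proof -
      obtain h where h: "continuous_map T euclideanreal h" "\<And>x. x \<in> topspace T \<Longrightarrow> 0 \<le> h x"
        "\<And>x. x \<in> topspace T \<Longrightarrow> h x = 0 \<longleftrightarrow> x \<in> E"
        using closedin_zero_set[OF mt E] by metis
      have "(\<lambda>y. h (p y)) \<in> borel_measurable Y"
      proof (rule borel_measurable_LIMSEQ_metric)
        \<comment> \<open>Here \<open>y\<close> enters only through \<open>G\<close> and the
          integer-valued \<open>idx n\<close>, so measurability is immediate. The limit map inherits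
          it after composition with \<open>h\<close>, which suffices for preimages of closed
          sets.\<close>
        show "(\<lambda>y. if y \<in> G then h (q (idx n y)) else h (q 0)) \<in> borel_measurable Y" for n
          by measurable
        fix y assume "y \<in> space Y"
        show "(\<lambda>n. if y \<in> G then h (q (idx n y)) else h (q 0)) \<longlonglongrightarrow> h (p y)"
        proof (cases "y \<in> G")
          case True
          have "limitin euclideanreal (h \<circ> P y) (h (l y)) sequentially"
            using h(1) l[OF True] unfolding M(3) by (rule continuous_map_limit)
          then show ?thesis using True by (simp add: p_def P_def o_def)
        qed (simp add: p_def)
      qed
      then have "(\<lambda>y. h (p y)) -` {0} \<inter> space Y \<in> sets Y" by (rule measurable_sets) simp
      also have "(\<lambda>y. h (p y)) -` {0} \<inter> space Y = p -` E \<inter> space Y"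
        using h(3) pM by (auto simp: M(3))
      finally show ?thesis .
    qed
    moreover have "p \<in> space Y \<rightarrow> topspace T" using pM by (auto simp: M(3))
    ultimately have "p \<in> Y \<rightarrow>\<^sub>M sigma (topspace T) {E. closedin T E}"
      by (intro measurable_measure_of) (auto dest: closedin_subset)
    moreover have "sets (sigma (topspace T) {E. closedin T E}) = sets X"
      unfolding T(3) sets_borel_of_closedin by (rule sets_measure_of) (auto dest: closedin_subset)
    ultimately show "p \<in> Y \<rightarrow>\<^sub>M X" by (simp cong: measurable_cong_sets)
    have "AE z in Z. \<forall>n i. \<pi> z \<in> A n i \<longleftrightarrow> \<rho> z \<in> B n i"
      using B(2) by (simp add: AE_all_countable)
    then show "AE z in Z. \<pi> z = p (\<rho> z)"
    proof (rule AE_mp, intro AE_I2 impI)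
      fix z assume z: "z \<in> space Z" and eq: "\<forall>n i. \<pi> z \<in> A n i \<longleftrightarrow> \<rho> z \<in> B n i"
      have \<pi>M: "\<pi> z \<in> M" using measurable_space[OF \<pi> z] spM by simp
      have close: "d (P (\<rho> z) n) (\<pi> z) < inverse (real (Suc n))" for n
      proof -
        obtain i where "d (\<pi> z) (q i) < inverse (real (Suc n))" using dense[OF \<pi>M, of "inverse (real (Suc n))"] by auto
        then have "\<pi> z \<in> A n i" unfolding A_def using \<pi>M qM by (simp add: commute)
        then have "\<rho> z \<in> B n i" using eq by blast
        then have "\<rho> z \<in> B n (idx n (\<rho> z))" unfolding idx_def by (rule LeastI)
        then have "\<pi> z \<in> A n (idx n (\<rho> z))" using eq by blast
        then show ?thesis by (simp add: A_def P_def)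
      qed
      have lim: "limitin mtopology (P (\<rho> z)) (\<pi> z) sequentially"
        unfolding limit_metric_sequentially
      proof (intro conjI allI impI)
        fix e :: real assume "e > 0"
        then obtain k where k: "inverse (real (Suc k)) < e" using reals_Archimedean by blast
        have "P (\<rho> z) n \<in> M \<and> d (P (\<rho> z) n) (\<pi> z) < e" if "n \<ge> k" for n
        proof -
          have "inverse (real (Suc n)) \<le> inverse (real (Suc k))" using that by (simp add: field_simps)
          then have "d (P (\<rho> z) n) (\<pi> z) < e" using close[of n] k by (meson less_le_trans less_trans)
          then show ?thesis using qM by (simp add: P_def)
        qed
        then show "\<exists>N. \<forall>n\<ge>N. P (\<rho> z) n \<in> M \<and> d (P (\<rho> z) n) (\<pi> z) < e" by blast
      qed (rule \<pi>M)
      have "MCauchy (P (\<rho> z))"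
        by (rule convergent_imp_MCauchy[OF _ lim]) (use qM in \<open>auto simp: P_def\<close>)
      then have "\<rho> z \<in> G"
        using measurable_space[OF \<rho> z] unfolding MCauchy_def G_def by simp
      then show "\<pi> z = p (\<rho> z)"
        using l[of "\<rho> z"] lim unfolding p_def by (simp add: limitin_metric_unique)
    qed
  qed
qed

section \<open>The Furstenberg entropy as an integral of relative entropies\<close>

definition rn :: "'x measure \<Rightarrow> ('g \<Rightarrow> 'x \<Rightarrow> 'x) \<Rightarrow> 'g \<Rightarrow> 'x \<Rightarrow> ennreal" where
  "rn M act g = RN_deriv M (distr M M (act g))"

definition kl_fun :: "real \<Rightarrow> real" where "kl_fun r = r - 1 - ln r"

text \<open>
  The integrand differs from \<open>- ln r\<close> by \<open>r - 1\<close>, which integrates to \<open>0\<close>; unlike \<open>- ln r\<close> it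
  is nonnegative.
\<close>
definition kl_div :: "'x measure \<Rightarrow> ('g::group_add \<Rightarrow> 'x \<Rightarrow> 'x) \<Rightarrow> 'g \<Rightarrow> ennreal" where
  "kl_div M act g = (\<integral>\<^sup>+x. ennreal (kl_fun (enn2real (rn M act (- g) x))) \<partial>M)"

lemma kl_fun_nonneg: "r > 0 \<Longrightarrow> 0 \<le> kl_fun r"
  using ln_le_minus_one[of r] by (simp add: kl_fun_def)

lemma kl_fun_eq_0_iff: "r > 0 \<Longrightarrow> kl_fun r = 0 \<longleftrightarrow> r = 1"
  using ln_eq_minus_one[of r] by (auto simp: kl_fun_def)

text \<open>Since \<open>ennreal\<close> sends negative reals to 0, \<open>ennreal (ln r)\<close>
  and \<open>ennreal (- ln r)\<close> are the positive and negative parts of \<open>ln r\<close>.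
  The identity is the definition of \<open>kl_fun\<close> rearranged so that no subtraction
  occurs.\<close>

lemma kl_fun_ennreal:
  assumes "r > 0"
  shows "ennreal (kl_fun r) + ennreal (ln r) + 1 = ennreal r + ennreal (- ln r)"
proof (cases "0 \<le> ln r")
  case True
  then have "ennreal (kl_fun r) + ennreal (ln r) + ennreal 1 = ennreal r"
    using kl_fun_nonneg[OF assms] by (simp add: kl_fun_def del: ennreal_1 flip: ennreal_plus)
  then show ?thesis using True by (simp add: ennreal_neg)
next
  case False
  then have "ennreal (kl_fun r) + ennreal 1 = ennreal r + ennreal (- ln r)"
    using kl_fun_nonneg[OF assms] assms by (simp add: kl_fun_def del: ennreal_1 flip: ennreal_plus)
  then show ?thesis using False by (simp add: ennreal_neg)
qed

lemma borel_measurable_kl_fun[measurable]: "kl_fun \<in> borel_measurable borel"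
  unfolding kl_fun_def[abs_def] by measurable

section \<open>Nonsingular actions and their densities\<close>

locale nonsingular_action =
  fixes M :: "'x measure" and act :: "'g::{topological_group_add, second_countable_topology} \<Rightarrow> 'x \<Rightarrow> 'x"
  assumes ns: "nonsingular_space M act"
begin

sublocale prob_space M using ns by (simp add: nonsingular_space_def)

lemma std: "standard_borel M" using ns by (simp add: nonsingular_space_def)

lemma act_space: "x \<in> space M \<Longrightarrow> act g x \<in> space M"
  and act_0: "x \<in> space M \<Longrightarrow> act 0 x = x"
  and act_add: "x \<in> space M \<Longrightarrow> act (g + h) x = act g (act h x)"
  using ns by (auto simp: nonsingular_space_def group_action_on_def)

lemma act_uminus: "x \<in> space M \<Longrightarrow> act (- g) (act g x) = x" "x \<in> space M \<Longrightarrow> act g (act (- g) x) = x"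
  using act_add[of x "- g" g] act_add[of x g "- g"] by (simp_all add: act_0)

lemma act_joint: "(\<lambda>(g, x). act g x) \<in> borel \<Otimes>\<^sub>M M \<rightarrow>\<^sub>M M"
  using ns by (simp add: nonsingular_space_def)

lemma act_measurable[measurable]: "act g \<in> M \<rightarrow>\<^sub>M M"
  using measurable_compose[OF measurable_Pair1' act_joint, of g] by simp

lemma act_joint_compose:
  "f \<in> N \<rightarrow>\<^sub>M borel \<Longrightarrow> k \<in> N \<rightarrow>\<^sub>M M \<Longrightarrow> (\<lambda>z. act (f z) (k z)) \<in> N \<rightarrow>\<^sub>M M"
  using measurable_compose[OF measurable_Pair act_joint, of f N k] by simp

lemma ac: "absolutely_continuous M (distr M M (act g))"
  and ac': "absolutely_continuous (distr M M (act g)) M"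
  using ns by (auto simp: nonsingular_space_def)

lemma rn_measurable[measurable]: "rn M act g \<in> borel_measurable M"
  unfolding rn_def by measurable

lemma density_rn: "density M (rn M act g) = distr M M (act g)"
  unfolding rn_def by (rule density_RN_deriv[OF ac]) simp

lemma rn_unique:
  "f \<in> borel_measurable M \<Longrightarrow> density M f = distr M M (act g) \<Longrightarrow> AE x in M. f x = rn M act g x"
  unfolding rn_def by (rule RN_deriv_unique)

lemma nn_integral_act:
  assumes [measurable]: "f \<in> borel_measurable M"
  shows "(\<integral>\<^sup>+x. f (act g x) \<partial>M) = (\<integral>\<^sup>+x. rn M act g x * f x \<partial>M)"
proof -
  have "(\<integral>\<^sup>+x. f (act g x) \<partial>M) = (\<integral>\<^sup>+x. f x \<partial>distr M M (act g))"
    by (simp add: nn_integral_distr)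
  also have "\<dots> = (\<integral>\<^sup>+x. rn M act g x * f x \<partial>M)"
    unfolding density_rn[symmetric] by (rule nn_integral_density) auto
  finally show ?thesis .
qed

lemma AE_act: assumes "AE x in M. P x" shows "AE x in M. P (act g x)"
proof -
  have "AE x in distr M M (act g). P x"
    by (rule absolutely_continuous_AE[OF _ ac assms]) simp
  then show ?thesis by (rule AE_distrD[OF act_measurable])
qed

lemma nn_integral_rn: "(\<integral>\<^sup>+x. rn M act g x \<partial>M) = 1"
  using nn_integral_act[of "\<lambda>_. 1" g] by (simp add: emeasure_space_1)

lemma rn_finite: "AE x in M. rn M act g x < \<infinity>"
  using nn_integral_PInf_AE[of "rn M act g" M] nn_integral_rn[of g] by (simp add: less_top)

lemma rn_pos: "AE x in M. 0 < rn M act g x"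
proof -
  let ?N = "{x \<in> space M. rn M act g x = 0}"
  have "emeasure (distr M M (act g)) ?N = (\<integral>\<^sup>+x. rn M act g x * indicator ?N x \<partial>M)"
    unfolding density_rn[symmetric] by (rule emeasure_density) auto
  also have "\<dots> = (\<integral>\<^sup>+x. 0 \<partial>M)" by (rule nn_integral_cong) (auto simp: indicator_def)
  finally have "?N \<in> null_sets (distr M M (act g))" by (intro null_setsI) auto
  then have "?N \<in> null_sets M" using ac'[of g] by (auto simp: absolutely_continuous_def)
  then have "AE x in M. x \<notin> ?N" by (rule AE_not_in)
  then show ?thesis using AE_space by eventually_elim (auto simp: zero_less_iff_neq_zero)
qed

lemma rn_real: "AE x in M. \<exists>r>0. rn M act g x = ennreal r"
  using rn_finite[of g] rn_pos[of g]
proof eventually_elim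
  case (elim x)
  then show ?case by (cases "rn M act g x") auto
qed

text \<open>From \<open>ln r \<le> r\<close> and the integral 1 of \<open>r\<close>, the positive
  part of \<open>ln r\<close> has finite integral, so the difference of the two parts is meaningful.
  Integrating \<open>kl_fun_ennreal\<close> then identifies it.\<close>

lemma ext_integral_ln_rn:
  "ext_integral M (\<lambda>x. ereal (ln (enn2real (rn M act (- g) x)))) = - enn2ereal (kl_div M act g)"
proof -
  define r where "r x = enn2real (rn M act (- g) x)" for x
  have [measurable]: "r \<in> borel_measurable M" unfolding r_def by measurable
  have r: "AE x in M. 0 < r x" "AE x in M. rn M act (- g) x = ennreal (r x)"
    using rn_real[of "- g"] by (auto simp: r_def)
  let ?p = "\<integral>\<^sup>+x. ennreal (ln (r x)) \<partial>M" and ?n = "\<integral>\<^sup>+x. ennreal (- ln (r x)) \<partial>M"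
  have one: "(\<integral>\<^sup>+x. ennreal (r x) \<partial>M) = 1"
    using nn_integral_rn[of "- g"] nn_integral_cong_AE[OF r(2)] by simp
  have "(\<integral>\<^sup>+x. ennreal (kl_fun (r x)) + ennreal (ln (r x)) + 1 \<partial>M) =
      (\<integral>\<^sup>+x. ennreal (r x) + ennreal (- ln (r x)) \<partial>M)"
  proof (rule nn_integral_cong_AE, use r(1) in eventually_elim)
    case (elim x)
    then show ?case by (rule kl_fun_ennreal)
  qed
  then have "kl_div M act g + ?p + 1 = 1 + ?n"
    by (simp add: nn_integral_add kl_div_def r_def[symmetric] one emeasure_space_1)
  moreover have "?p \<le> (\<integral>\<^sup>+x. ennreal (r x) \<partial>M)"
    by (rule nn_integral_mono_AE, use r(1) in eventually_elim)
       (use ln_le_minus_one in \<open>auto intro!: ennreal_leI order_trans[OF ln_le_minus_one]\<close>)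
  ultimately have *: "?n = kl_div M act g + ?p" "?p < \<infinity>"
    using one by (auto simp: add.commute[of _ 1] dest: le_less_trans[OF _ ennreal_one_less_top])
  obtain p where p: "?p = ennreal p" "p \<ge> 0" using *(2) by (cases ?p) auto
  have "ext_integral M (\<lambda>x. ereal (ln (r x))) = enn2ereal ?p - enn2ereal ?n"
    unfolding ext_integral_def by (simp add: e2ennreal_ereal)
  also have "\<dots> = - enn2ereal (kl_div M act g)"
    unfolding *(1) p(1) using p(2)
    by (cases "kl_div M act g") (auto simp: enn2ereal_ennreal simp flip: ennreal_plus)
  finally show ?thesis by (simp add: r_def)
qed

lemma furstenberg_entropy_eq:
  "furstenberg_entropy \<mu> M act = enn2ereal (\<integral>\<^sup>+g. kl_div M act g \<partial>\<mu>)"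
  unfolding furstenberg_entropy_def rn_def[symmetric] ext_integral_ln_rn
  unfolding ext_integral_def by (simp add: e2ennreal_neg zero_ennreal.rep_eq)

text \<open>For separately chosen densities measurability of \<open>kl_div\<close> in
  \<open>g\<close> is unclear. The law \<open>K\<close> of \<open>(g, act (- g) x)\<close> has a
  jointly measurable density \<open>R\<close> with respect to the product; for almost every
  \<open>g\<close> its section is a density of the translated measure and may replace
  \<open>rn\<close>.\<close>

lemma kl_div_measurable:
  assumes "prob_space \<mu>" and [measurable_cong]: "sets \<mu> = sets (borel :: 'g measure)"
  obtains k where "k \<in> borel_measurable \<mu>" "AE g in \<mu>. kl_div M act g = k g"
proof -
  interpret \<mu>: prob_space \<mu> by fact
  interpret P: pair_prob_space \<mu> M ..
  define K where "K = distr (\<mu> \<Otimes>\<^sub>M M) (\<mu> \<Otimes>\<^sub>M M) (\<lambda>(g, x). (g, act (- g) x))"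
  have [measurable]: "(\<lambda>g. - g) \<in> borel_measurable (borel :: 'g measure)"
    by (intro borel_measurable_continuous_onI continuous_intros)
  have act_neg: "(\<lambda>z. act (- fst z) (snd z)) \<in> \<mu> \<Otimes>\<^sub>M M \<rightarrow>\<^sub>M M"
    by (rule act_joint_compose) measurable
  have sh: "(\<lambda>(g, x). (g, act (- g) x)) \<in> \<mu> \<Otimes>\<^sub>M M \<rightarrow>\<^sub>M \<mu> \<Otimes>\<^sub>M M"
    unfolding split_beta by (rule measurable_Pair[OF measurable_fst act_neg])
  have acK: "absolutely_continuous (\<mu> \<Otimes>\<^sub>M M) K"
    unfolding absolutely_continuous_def
  proof
    fix A assume A: "A \<in> null_sets (\<mu> \<Otimes>\<^sub>M M)"
    then have [measurable]: "A \<in> sets (\<mu> \<Otimes>\<^sub>M M)" by auto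
    have "AE z in \<mu> \<Otimes>\<^sub>M M. z \<notin> A" using A by (rule AE_not_in)
    then have "AE g in \<mu>. AE x in M. (g, x) \<notin> A" by (rule P.AE_pair)
    then have "AE g in \<mu>. AE x in M. (g, act (- g) x) \<notin> A"
      by eventually_elim (rule AE_act)
    moreover have "{z \<in> space (\<mu> \<Otimes>\<^sub>M M). (case z of (g, x) \<Rightarrow> (g, act (- g) x)) \<notin> A} \<in> sets (\<mu> \<Otimes>\<^sub>M M)"
    proof -
      have "{z \<in> space (\<mu> \<Otimes>\<^sub>M M). (case z of (g, x) \<Rightarrow> (g, act (- g) x)) \<notin> A} =
          space (\<mu> \<Otimes>\<^sub>M M) - ((\<lambda>(g, x). (g, act (- g) x)) -` A \<inter> space (\<mu> \<Otimes>\<^sub>M M))"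
        by blast
      then show ?thesis using measurable_sets[OF sh \<open>A \<in> sets (\<mu> \<Otimes>\<^sub>M M)\<close>] by (simp only: sets.compl_sets)
    qed
    ultimately have "AE z in \<mu> \<Otimes>\<^sub>M M. (case z of (g, x) \<Rightarrow> (g, act (- g) x)) \<notin> A"
      by (intro P.AE_pair_measure) simp_all
    then have "AE z in K. z \<notin> A"
      unfolding K_def by (subst AE_distr_iff[OF sh]) auto
    then show "A \<in> null_sets K"
      by (subst (asm) AE_iff_null_sets[symmetric]) (auto simp: K_def)
  qed
  define R where "R = RN_deriv (\<mu> \<Otimes>\<^sub>M M) K"
  have R[measurable]: "R \<in> borel_measurable (\<mu> \<Otimes>\<^sub>M M)" unfolding R_def by measurable
  have dR: "density (\<mu> \<Otimes>\<^sub>M M) R = K"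
    unfolding R_def by (rule P.density_RN_deriv[OF acK]) (simp add: K_def)
  obtain \<A> where \<A>: "countable \<A>" "\<A> \<subseteq> Pow (space M)" "Int_stable \<A>" "space M \<in> \<A>"
    "sets M = sigma_sets (space M) \<A>"
    using standard_borel_generator[OF std] by metis
  have \<A>M: "A \<in> sets M" if "A \<in> \<A>" for A using that \<A>(5) by auto
  have "AE g in \<mu>. (\<integral>\<^sup>+x. R (g, x) * indicator A x \<partial>M) = emeasure (distr M M (act (- g))) A"
    if "A \<in> \<A>" for A
  proof -
    note [measurable] = \<A>M[OF that]
    have em: "emeasure (distr M M (act (- g))) A = (\<integral>\<^sup>+x. indicator A (act (- g) x) \<partial>M)" for g
    proof -
      have "emeasure (distr M M (act (- g))) A = (\<integral>\<^sup>+x. indicator A x \<partial>distr M M (act (- g)))"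
        using \<A>M[OF that] by simp
      also have "\<dots> = (\<integral>\<^sup>+x. indicator A (act (- g) x) \<partial>M)" by (rule nn_integral_distr) measurable
      finally show ?thesis .
    qed
    have mA[measurable]: "(\<lambda>g. emeasure (distr M M (act (- g))) A) \<in> borel_measurable \<mu>"
      unfolding em
      by (rule borel_measurable_nn_integral)
         (unfold split_beta, rule measurable_compose[OF act_neg], measurable)
    \<comment> \<open>Two functions of \<open>g\<close> are equal almost everywhere once they define
      the same density; on \<open>B\<close> both give the measure under \<open>K\<close> of the
      rectangle \<open>B \<times> A\<close>.\<close>
    have "density \<mu> (\<lambda>g. \<integral>\<^sup>+x. R (g, x) * indicator A x \<partial>M) = density \<mu> (\<lambda>g. emeasure (distr M M (act (- g))) A)"
    proof (rule measure_eqI)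
      fix B assume "B \<in> sets (density \<mu> (\<lambda>g. \<integral>\<^sup>+x. R (g, x) * indicator A x \<partial>M))"
      then have [measurable]: "B \<in> sets \<mu>" by simp
      have mB: "(\<lambda>z. indicator (B \<times> A) (case z of (g, x) \<Rightarrow> (g, act (- g) x)) :: ennreal)
          \<in> borel_measurable (\<mu> \<Otimes>\<^sub>M M)"
        by (rule measurable_compose[OF sh]) measurable
      have "emeasure (density \<mu> (\<lambda>g. \<integral>\<^sup>+x. R (g, x) * indicator A x \<partial>M)) B =
          (\<integral>\<^sup>+g. (\<integral>\<^sup>+x. R (g, x) * indicator A x \<partial>M) * indicator B g \<partial>\<mu>)"
        by (rule emeasure_density) measurable
      also have "\<dots> = (\<integral>\<^sup>+g. \<integral>\<^sup>+x. R (g, x) * indicator (B \<times> A) (g, x) \<partial>M \<partial>\<mu>)"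
      proof (rule nn_integral_cong)
        fix g assume [measurable]: "g \<in> space \<mu>"
        show "(\<integral>\<^sup>+x. R (g, x) * indicator A x \<partial>M) * indicator B g =
            (\<integral>\<^sup>+x. R (g, x) * indicator (B \<times> A) (g, x) \<partial>M)"
          by (subst nn_integral_multc[symmetric]) (auto simp: indicator_times mult_ac)
      qed
      also have "\<dots> = (\<integral>\<^sup>+z. R z * indicator (B \<times> A) z \<partial>(\<mu> \<Otimes>\<^sub>M M))"
        by (rule nn_integral_fst) measurable
      also have "\<dots> = emeasure K (B \<times> A)"
        unfolding dR[symmetric] by (rule emeasure_density[symmetric]) measurable
      also have "\<dots> = (\<integral>\<^sup>+z. indicator (B \<times> A) z \<partial>K)"
        by (rule nn_integral_indicator[symmetric]) (simp add: K_def)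
      also have "\<dots> = (\<integral>\<^sup>+z. indicator (B \<times> A) (case z of (g, x) \<Rightarrow> (g, act (- g) x)) \<partial>(\<mu> \<Otimes>\<^sub>M M))"
        unfolding K_def by (rule nn_integral_distr[OF sh]) simp
      also have "\<dots> = (\<integral>\<^sup>+g. \<integral>\<^sup>+x. indicator B g * indicator A (act (- g) x) \<partial>M \<partial>\<mu>)"
        unfolding nn_integral_fst[OF mB, symmetric] by (simp add: indicator_times)
      also have "\<dots> = emeasure (density \<mu> (\<lambda>g. emeasure (distr M M (act (- g))) A)) B"
      proof -
        have "(\<integral>\<^sup>+x. indicator B g * indicator A (act (- g) x) \<partial>M) =
            emeasure (distr M M (act (- g))) A * indicator B g" for g
          unfolding em mult.commute[of _ "indicator B g"] by (rule nn_integral_cmult) measurable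
        then show ?thesis using emeasure_density[OF mA \<open>B \<in> sets \<mu>\<close>] by simp
      qed
      finally show "emeasure (density \<mu> (\<lambda>g. \<integral>\<^sup>+x. R (g, x) * indicator A x \<partial>M)) B =
         emeasure (density \<mu> (\<lambda>g. emeasure (distr M M (act (- g))) A)) B" .
    qed simp
    then show ?thesis by (subst (asm) \<mu>.density_unique_iff) auto
  qed
  \<comment> \<open>Countability of \<open>\<A>\<close> allows one null set of \<open>g\<close> for
    all test sets.\<close>
  then have "AE g in \<mu>. \<forall>A\<in>\<A>. (\<integral>\<^sup>+x. R (g, x) * indicator A x \<partial>M) = emeasure (distr M M (act (- g))) A"
    by (simp add: AE_ball_countable[OF \<A>(1)])
  then have "AE g in \<mu>. kl_div M act g = (\<integral>\<^sup>+x. ennreal (kl_fun (enn2real (R (g, x)))) \<partial>M)"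
  proof (rule AE_mp, intro AE_I2 impI)
    fix g assume g: "g \<in> space \<mu>"
      and eq: "\<forall>A\<in>\<A>. (\<integral>\<^sup>+x. R (g, x) * indicator A x \<partial>M) = emeasure (distr M M (act (- g))) A"
    have Rg: "(\<lambda>x. R (g, x)) \<in> borel_measurable M"
      by (rule measurable_compose[OF measurable_Pair1'[OF g] R])
    have "density M (\<lambda>x. R (g, x)) = distr M M (act (- g))"
    proof (rule measure_eqI_generator_eq[OF \<A>(3,2), where A="\<lambda>_. space M"])
      show "emeasure (density M (\<lambda>x. R (g, x))) A = emeasure (distr M M (act (- g))) A" if "A \<in> \<A>" for A
        by (rule trans[OF emeasure_density[OF Rg \<A>M[OF that]] bspec[OF eq that]])
      have "emeasure (density M (\<lambda>x. R (g, x))) (space M) = emeasure (distr M M (act (- g))) (space M)"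
        by (rule trans[OF emeasure_density[OF Rg sets.top] bspec[OF eq \<A>(4)]])
      also have "\<dots> = 1"
        using prob_space.emeasure_space_1[OF prob_space_distr[OF act_measurable, of "- g"]]
        by (simp only: space_distr)
      finally show "emeasure (density M (\<lambda>x. R (g, x))) (space M) \<noteq> \<infinity>" for i :: nat by simp
    qed (simp_all add: \<A>(4) \<A>(5))
    then have ae: "AE x in M. R (g, x) = rn M act (- g) x" by (rule rn_unique[OF Rg])
    then show "kl_div M act g = (\<integral>\<^sup>+x. ennreal (kl_fun (enn2real (R (g, x)))) \<partial>M)"
      unfolding kl_div_def by (intro nn_integral_cong_AE, use ae in eventually_elim) simp
  qed
  then show ?thesis by (rule that[rotated]) measurable
qed

end

section \<open>Couplings\<close>

text \<open>The last assumption says that \<open>Z\<close> is relatively measure preserving over \<open>Y\<close>.\<close>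
locale coupling =
  X: nonsingular_action X actX + Y: nonsingular_action Y actY + Z: prob_space Z
  for X :: "'x measure" and actX :: "'g::{topological_group_add, second_countable_topology} \<Rightarrow> 'x \<Rightarrow> 'x"
    and Y :: "'y measure" and actY :: "'g \<Rightarrow> 'y \<Rightarrow> 'y"
    and Z :: "('y \<times> 'x) measure" +
  assumes sets_Z: "sets Z = sets (Y \<Otimes>\<^sub>M X)"
    and distr_fst: "distr Z Y fst = Y" and distr_snd: "distr Z X snd = X"
    and shift: "F \<in> borel_measurable Z \<Longrightarrow>
      (\<integral>\<^sup>+z. F (actY g (fst z), actX g (snd z)) \<partial>Z) = (\<integral>\<^sup>+z. rn Y actY g (fst z) * F z \<partial>Z)"
begin

lemma space_Z: "space Z = space Y \<times> space X"
  using sets_eq_imp_space_eq[OF sets_Z] by (simp add: space_pair_measure)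

lemma fst_measurable[measurable]: "fst \<in> Z \<rightarrow>\<^sub>M Y"
  unfolding measurable_cong_sets[OF sets_Z refl] by (rule measurable_fst)

lemma snd_measurable[measurable]: "snd \<in> Z \<rightarrow>\<^sub>M X"
  unfolding measurable_cong_sets[OF sets_Z refl] by (rule measurable_snd)

lemma pair_measurable: "f \<in> N \<rightarrow>\<^sub>M Y \<Longrightarrow> k \<in> N \<rightarrow>\<^sub>M X \<Longrightarrow> (\<lambda>z. (f z, k z)) \<in> N \<rightarrow>\<^sub>M Z"
  unfolding measurable_cong_sets[OF refl sets_Z] by (rule measurable_Pair)

definition sh :: "'g \<Rightarrow> 'y \<times> 'x \<Rightarrow> 'y \<times> 'x" where "sh g z = (actY g (fst z), actX g (snd z))"

lemma sh_measurable: "sh g \<in> Z \<rightarrow>\<^sub>M Z"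
  unfolding sh_def[abs_def]
  by (rule pair_measurable[OF measurable_compose[OF fst_measurable Y.act_measurable]
        measurable_compose[OF snd_measurable X.act_measurable]])

lemma sh_uminus: "z \<in> space Z \<Longrightarrow> sh (- g) (sh g z) = z"
  unfolding sh_def space_Z by (auto simp: X.act_uminus Y.act_uminus)

lemma sh_add: "z \<in> space Z \<Longrightarrow> sh (g + h) z = sh g (sh h z)"
  unfolding sh_def space_Z by (auto simp: X.act_add Y.act_add)

lemma nn_integral_fst_Z: assumes "f \<in> borel_measurable Y"
  shows "(\<integral>\<^sup>+z. f (fst z) \<partial>Z) = (\<integral>\<^sup>+y. f y \<partial>Y)"
  using nn_integral_distr[OF fst_measurable, of f] assms by (simp add: distr_fst)

lemma nn_integral_snd_Z: assumes "f \<in> borel_measurable X"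
  shows "(\<integral>\<^sup>+z. f (snd z) \<partial>Z) = (\<integral>\<^sup>+x. f x \<partial>X)"
  using nn_integral_distr[OF snd_measurable, of f] assms by (simp add: distr_snd)

lemma AE_fst: "AE y in Y. P y \<Longrightarrow> AE z in Z. P (fst z)"
  using AE_distrD[OF fst_measurable, of P] by (simp only: distr_fst)

lemma AE_snd: "AE x in X. P x \<Longrightarrow> AE z in Z. P (snd z)"
  using AE_distrD[OF snd_measurable, of P] by (simp only: distr_snd)

lemma nn_integral_sh: "F \<in> borel_measurable Z \<Longrightarrow>
    (\<integral>\<^sup>+z. F (sh g z) \<partial>Z) = (\<integral>\<^sup>+z. rn Y actY g (fst z) * F z \<partial>Z)"
  unfolding sh_def by (rule shift)

section \<open>The entropy defect of a coupling\<close>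

text \<open>The densities are taken at \<open>g\<close> itself, whereas \<open>kl_div\<close> at
  \<open>g\<close> uses the density at \<open>- g\<close>; this explains the sign in
  \<open>kl_div_defect\<close>.\<close>

definition defect :: "'g \<Rightarrow> ennreal" where
  "defect g = (\<integral>\<^sup>+z. ennreal (kl_fun (enn2real (rn Y actY g (fst z)) / enn2real (rn X actX g (snd z)))) \<partial>Z)"

text \<open>By \<open>shift\<close> the factor from \<open>Y\<close> becomes a translation of the
  other factor. That factor depends on \<open>X\<close> alone, where undoing the translation costs
  \<open>rn X actX g\<close> and cancels the inverse.\<close>

lemma ratio_integral: "(\<integral>\<^sup>+z. rn Y actY g (fst z) * inverse (rn X actX g (snd z)) \<partial>Z) = 1"
proof -
  have inv: "(\<lambda>x. inverse (rn X actX g x)) \<in> borel_measurable X" by measurable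
  have "(\<integral>\<^sup>+z. rn Y actY g (fst z) * inverse (rn X actX g (snd z)) \<partial>Z) =
      (\<integral>\<^sup>+z. inverse (rn X actX g (snd (sh g z))) \<partial>Z)"
    by (rule nn_integral_sh[symmetric]) (rule measurable_compose[OF snd_measurable inv])
  also have "\<dots> = (\<integral>\<^sup>+z. inverse (rn X actX g (actX g (snd z))) \<partial>Z)" by (simp add: sh_def)
  also have "\<dots> = (\<integral>\<^sup>+x. inverse (rn X actX g (actX g x)) \<partial>X)"
    by (rule nn_integral_snd_Z) (rule measurable_compose[OF X.act_measurable inv])
  also have "\<dots> = (\<integral>\<^sup>+x. rn X actX g x * inverse (rn X actX g x) \<partial>X)"
    by (rule X.nn_integral_act[OF inv])
  also have "\<dots> = (\<integral>\<^sup>+x. 1 \<partial>X)"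
    by (rule nn_integral_cong_AE, use X.rn_real[of g] in eventually_elim)
       (auto simp: inverse_ennreal simp flip: ennreal_mult ennreal_1)
  finally show ?thesis by (simp add: X.emeasure_space_1)
qed

text \<open>For the densities \<open>a\<close> of \<open>Y\<close> and \<open>b\<close> of
  \<open>X\<close> the logarithms give
  \<open>kl_fun b + kl_fun (a/b) + 1 + a = kl_fun a + a/b + b\<close>. Each of \<open>a\<close>,
  \<open>b\<close> and \<open>a/b\<close> has integral 1, so only finite terms are cancelled, also
  when the entropies are infinite.\<close>

lemma kl_div_defect: "kl_div X actX g + defect (- g) = kl_div Y actY g"
proof -
  define a where "a z = enn2real (rn Y actY (- g) (fst z))" for z :: "'y \<times> 'x"
  define b where "b z = enn2real (rn X actX (- g) (snd z))" for z :: "'y \<times> 'x"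
  have am[measurable]: "a \<in> borel_measurable Z" unfolding a_def
    by (rule measurable_compose[OF measurable_compose[OF fst_measurable Y.rn_measurable]]) measurable
  have bm[measurable]: "b \<in> borel_measurable Z" unfolding b_def
    by (rule measurable_compose[OF measurable_compose[OF snd_measurable X.rn_measurable]]) measurable
  have A: "AE z in Z. a z > 0 \<and> rn Y actY (- g) (fst z) = ennreal (a z)"
    using AE_fst[OF Y.rn_real[of "- g"]] by eventually_elim (auto simp: a_def)
  have B: "AE z in Z. b z > 0 \<and> rn X actX (- g) (snd z) = ennreal (b z)"
    using AE_snd[OF X.rn_real[of "- g"]] by eventually_elim (auto simp: b_def)
  have ia: "(\<integral>\<^sup>+z. ennreal (a z) \<partial>Z) = 1"
  proof -
    have "(\<integral>\<^sup>+z. ennreal (a z) \<partial>Z) = (\<integral>\<^sup>+z. rn Y actY (- g) (fst z) \<partial>Z)"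
      by (rule nn_integral_cong_AE, use A in eventually_elim) simp
    then show ?thesis using nn_integral_fst_Z[OF Y.rn_measurable] Y.nn_integral_rn by simp
  qed
  have ib: "(\<integral>\<^sup>+z. ennreal (b z) \<partial>Z) = 1"
  proof -
    have "(\<integral>\<^sup>+z. ennreal (b z) \<partial>Z) = (\<integral>\<^sup>+z. rn X actX (- g) (snd z) \<partial>Z)"
      by (rule nn_integral_cong_AE, use B in eventually_elim) simp
    then show ?thesis using nn_integral_snd_Z[OF X.rn_measurable] X.nn_integral_rn by simp
  qed
  have iab: "(\<integral>\<^sup>+z. ennreal (a z / b z) \<partial>Z) = 1"
  proof -
    have "(\<integral>\<^sup>+z. ennreal (a z / b z) \<partial>Z) =
        (\<integral>\<^sup>+z. rn Y actY (- g) (fst z) * inverse (rn X actX (- g) (snd z)) \<partial>Z)"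
    proof (rule nn_integral_cong_AE, use A B in eventually_elim)
      case (elim z)
      then show ?case by (simp add: inverse_ennreal divide_inverse ennreal_mult)
    qed
    then show ?thesis by (simp add: ratio_integral)
  qed
  have kX: "(\<integral>\<^sup>+z. ennreal (kl_fun (b z)) \<partial>Z) = kl_div X actX g"
    unfolding kl_div_def b_def by (rule nn_integral_snd_Z) measurable
  have kY: "(\<integral>\<^sup>+z. ennreal (kl_fun (a z)) \<partial>Z) = kl_div Y actY g"
    unfolding kl_div_def a_def by (rule nn_integral_fst_Z) measurable
  have "(\<integral>\<^sup>+z. ennreal (kl_fun (b z)) + ennreal (kl_fun (a z / b z)) + 1 + ennreal (a z) \<partial>Z) =
      (\<integral>\<^sup>+z. ennreal (kl_fun (a z)) + ennreal (a z / b z) + ennreal (b z) \<partial>Z)"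
  proof (rule nn_integral_cong_AE, use A B in eventually_elim)
    case (elim z)
    then have ab: "a z > 0" "b z > 0" by auto
    then have q: "a z / b z > 0" by simp
    have "ennreal (kl_fun (b z)) + ennreal (kl_fun (a z / b z)) + ennreal 1 + ennreal (a z) =
        ennreal (kl_fun (b z) + kl_fun (a z / b z) + 1 + a z)"
      using ab kl_fun_nonneg[OF ab(2)] kl_fun_nonneg[OF q] by (simp del: ennreal_1 flip: ennreal_plus)
    also have "kl_fun (b z) + kl_fun (a z / b z) + 1 + a z = kl_fun (a z) + a z / b z + b z"
      unfolding kl_fun_def using ab by (simp add: ln_div)
    also have "ennreal (kl_fun (a z) + a z / b z + b z) =
        ennreal (kl_fun (a z)) + ennreal (a z / b z) + ennreal (b z)"
      using ab kl_fun_nonneg[OF ab(1)] q by (simp flip: ennreal_plus)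
    finally show ?case by simp
  qed
  then have "kl_div X actX g + defect (- g) + 1 + 1 = kl_div Y actY g + 1 + 1"
    by (simp add: nn_integral_add kX kY ia ib iab Z.emeasure_space_1 defect_def a_def[symmetric] b_def[symmetric])
  then show ?thesis by (simp add: add.assoc)
qed

lemma kl_div_le: "kl_div X actX g \<le> kl_div Y actY g"
  using kl_div_defect[of g] by (metis le_iff_add)

lemma defect_eq_0:
  assumes "defect g = 0" shows "AE z in Z. rn X actX g (snd z) = rn Y actY g (fst z)"
proof -
  have m: "(\<lambda>z. ennreal (kl_fun (enn2real (rn Y actY g (fst z)) / enn2real (rn X actX g (snd z))))) \<in> borel_measurable Z"
    by measurable
  have "AE z in Z. ennreal (kl_fun (enn2real (rn Y actY g (fst z)) / enn2real (rn X actX g (snd z)))) = 0"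
    using assms unfolding defect_def nn_integral_0_iff_AE[OF m] .
  with AE_fst[OF Y.rn_real[of g]] AE_snd[OF X.rn_real[of g]] show ?thesis
  proof eventually_elim
    case (elim z)
    obtain a b where ab: "a > 0" "rn Y actY g (fst z) = ennreal a" "b > 0" "rn X actX g (snd z) = ennreal b"
      using elim(1,2) by blast
    have "kl_fun (a / b) \<le> 0" using elim(3) ab by (simp add: ennreal_eq_0_iff)
    then have "kl_fun (a / b) = 0" using kl_fun_nonneg[of "a / b"] ab by simp
    then have "a / b = 1" using kl_fun_eq_0_iff[of "a / b"] ab by simp
    then show ?case using ab by simp
  qed
qed

section \<open>The subgroup of elements whose densities agree\<close>

text \<open>The elements whose translate of \<open>Z\<close> has a density that depends on \<open>X\<close> alone; in this form
  the set is visibly a subgroup.\<close>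
definition agree :: "'g set" where
  "agree = {g. \<exists>\<rho>\<in>borel_measurable X. \<forall>F\<in>borel_measurable Z.
     (\<integral>\<^sup>+z. F (sh g z) \<partial>Z) = (\<integral>\<^sup>+z. \<rho> (snd z) * F z \<partial>Z)}"

lemma agreeI:
  assumes "AE z in Z. rn X actX g (snd z) = rn Y actY g (fst z)" shows "g \<in> agree"
  unfolding agree_def
proof (intro CollectI bexI ballI)
  fix F :: "'y \<times> 'x \<Rightarrow> ennreal" assume F: "F \<in> borel_measurable Z"
  show "(\<integral>\<^sup>+z. F (sh g z) \<partial>Z) = (\<integral>\<^sup>+z. rn X actX g (snd z) * F z \<partial>Z)"
    unfolding nn_integral_sh[OF F]
    by (rule nn_integral_cong_AE, use assms in eventually_elim) simp
qed (rule X.rn_measurable)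

text \<open>Testing with functions of the second coordinate identifies the witness with
  \<open>rn X actX g\<close>. The translate of \<open>Z\<close> then has a density coming from
  \<open>X\<close> and one coming from \<open>Y\<close>, and densities are unique.\<close>

lemma agreeE:
  assumes "g \<in> agree"
  shows "F \<in> borel_measurable Z \<Longrightarrow> (\<integral>\<^sup>+z. F (sh g z) \<partial>Z) = (\<integral>\<^sup>+z. rn X actX g (snd z) * F z \<partial>Z)"
    and "AE z in Z. rn X actX g (snd z) = rn Y actY g (fst z)"
proof -
  obtain \<rho> where \<rho>[measurable]: "\<rho> \<in> borel_measurable X"
    and F: "\<And>F. F \<in> borel_measurable Z \<Longrightarrow> (\<integral>\<^sup>+z. F (sh g z) \<partial>Z) = (\<integral>\<^sup>+z. \<rho> (snd z) * F z \<partial>Z)"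
    using assms unfolding agree_def by blast
  have "density X \<rho> = distr X X (actX g)"
  proof (rule measure_eqI)
    fix A assume "A \<in> sets (density X \<rho>)"
    then have A: "A \<in> sets X" by simp
    then have iA: "(indicator A :: 'x \<Rightarrow> ennreal) \<in> borel_measurable X" by measurable
    have "emeasure (density X \<rho>) A = (\<integral>\<^sup>+x. \<rho> x * indicator A x \<partial>X)"
      by (rule emeasure_density[OF \<rho> A])
    also have "\<dots> = (\<integral>\<^sup>+z. \<rho> (snd z) * indicator A (snd z) \<partial>Z)"
      by (rule nn_integral_snd_Z[symmetric]) (intro borel_measurable_times_ennreal \<rho> iA)
    also have "\<dots> = (\<integral>\<^sup>+z. indicator A (snd (sh g z)) \<partial>Z)"
      by (rule F[symmetric]) (rule measurable_compose[OF snd_measurable iA])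
    also have "\<dots> = (\<integral>\<^sup>+z. indicator A (actX g (snd z)) \<partial>Z)" by (simp add: sh_def)
    also have "\<dots> = (\<integral>\<^sup>+x. indicator A (actX g x) \<partial>X)"
      by (rule nn_integral_snd_Z) (rule measurable_compose[OF X.act_measurable iA])
    also have "\<dots> = (\<integral>\<^sup>+x. indicator A x \<partial>distr X X (actX g))"
      by (rule nn_integral_distr[symmetric]) (rule X.act_measurable, use iA in simp)
    also have "\<dots> = emeasure (distr X X (actX g)) A" using A by simp
    finally show "emeasure (density X \<rho>) A = emeasure (distr X X (actX g)) A" .
  qed simp
  then have ae: "AE z in Z. \<rho> (snd z) = rn X actX g (snd z)"
    by (intro AE_snd X.rn_unique \<rho>)
  show 1: "(\<integral>\<^sup>+z. F (sh g z) \<partial>Z) = (\<integral>\<^sup>+z. rn X actX g (snd z) * F z \<partial>Z)"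
    if "F \<in> borel_measurable Z" for F
    unfolding F[OF that] by (rule nn_integral_cong_AE, use ae in eventually_elim) simp
  have mX: "(\<lambda>z. rn X actX g (snd z)) \<in> borel_measurable Z" by measurable
  have mY: "(\<lambda>z. rn Y actY g (fst z)) \<in> borel_measurable Z" by measurable
  have "density Z (\<lambda>z. rn X actX g (snd z)) = density Z (\<lambda>z. rn Y actY g (fst z))"
  proof (rule measure_eqI)
    fix A assume "A \<in> sets (density Z (\<lambda>z. rn X actX g (snd z)))"
    then have A: "A \<in> sets Z" by simp
    then have "(indicator A :: _ \<Rightarrow> ennreal) \<in> borel_measurable Z" by measurable
    from 1[OF this] nn_integral_sh[OF this, of g]
    show "emeasure (density Z (\<lambda>z. rn X actX g (snd z))) A = emeasure (density Z (\<lambda>z. rn Y actY g (fst z))) A"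
      unfolding emeasure_density[OF mX A] emeasure_density[OF mY A] by simp
  qed simp
  then show "AE z in Z. rn X actX g (snd z) = rn Y actY g (fst z)"
    using Z.density_unique_iff[OF mX mY] by blast
qed

text \<open>The chain rule for densities expresses that of \<open>g + h\<close> through those of
  \<open>g\<close> and \<open>h\<close> and the action of \<open>- g\<close>, all of which live on
  \<open>X\<close>.\<close>

lemma agree_add: assumes g: "g \<in> agree" and h: "h \<in> agree" shows "g + h \<in> agree"
  unfolding agree_def
proof (intro CollectI bexI ballI)
  define \<rho> where "\<rho> x = rn X actX g x * rn X actX h (actX (- g) x)" for x
  show "\<rho> \<in> borel_measurable X"
    unfolding \<rho>_def by (intro borel_measurable_times_ennreal X.rn_measurable measurable_compose[OF X.act_measurable X.rn_measurable])
  fix F :: "'y \<times> 'x \<Rightarrow> ennreal" assume F: "F \<in> borel_measurable Z"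
  have "(\<integral>\<^sup>+z. F (sh (g + h) z) \<partial>Z) = (\<integral>\<^sup>+z. F (sh g (sh h z)) \<partial>Z)"
    by (rule nn_integral_cong) (simp add: sh_add)
  also have "\<dots> = (\<integral>\<^sup>+z. rn X actX h (snd z) * F (sh g z) \<partial>Z)"
    by (rule agreeE(1)[OF h]) (rule measurable_compose[OF sh_measurable F])
  also have "\<dots> = (\<integral>\<^sup>+z. rn X actX h (actX (- g) (snd (sh g z))) * F (sh g z) \<partial>Z)"
    by (rule nn_integral_cong) (auto simp: sh_def space_Z X.act_uminus)
  also have "\<dots> = (\<integral>\<^sup>+z. rn X actX g (snd z) * (rn X actX h (actX (- g) (snd z)) * F z) \<partial>Z)"
    by (rule agreeE(1)[OF g, of "\<lambda>z. rn X actX h (actX (- g) (snd z)) * F z"])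
       (intro borel_measurable_times_ennreal F measurable_compose[OF snd_measurable]
          measurable_compose[OF X.act_measurable X.rn_measurable])
  finally show "(\<integral>\<^sup>+z. F (sh (g + h) z) \<partial>Z) = (\<integral>\<^sup>+z. \<rho> (snd z) * F z \<partial>Z)"
    by (simp add: \<rho>_def mult.assoc)
qed

text \<open>The density of the inverse translate is the reciprocal of the density of
  \<open>g\<close>, evaluated at the translated point of \<open>X\<close>.\<close>

lemma agree_uminus: assumes g: "g \<in> agree" shows "- g \<in> agree"
  unfolding agree_def
proof (intro CollectI bexI ballI)
  define \<rho> where "\<rho> x = inverse (rn X actX g (actX g x))" for x
  have inv: "(\<lambda>x. inverse (rn X actX g x)) \<in> borel_measurable X" by measurable
  show "\<rho> \<in> borel_measurable X"
    unfolding \<rho>_def by (rule measurable_compose[OF X.act_measurable inv])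
  fix F :: "'y \<times> 'x \<Rightarrow> ennreal" assume F: "F \<in> borel_measurable Z"
  have "(\<integral>\<^sup>+z. \<rho> (snd z) * F z \<partial>Z) =
      (\<integral>\<^sup>+z. inverse (rn X actX g (snd (sh g z))) * F (sh (- g) (sh g z)) \<partial>Z)"
    by (rule nn_integral_cong) (simp add: \<rho>_def sh_uminus, simp add: sh_def)
  also have "\<dots> = (\<integral>\<^sup>+z. rn X actX g (snd z) * (inverse (rn X actX g (snd z)) * F (sh (- g) z)) \<partial>Z)"
    by (rule agreeE(1)[OF g, of "\<lambda>z. inverse (rn X actX g (snd z)) * F (sh (- g) z)"])
       (intro borel_measurable_times_ennreal measurable_compose[OF sh_measurable F]
          measurable_compose[OF snd_measurable inv])
  also have "\<dots> = (\<integral>\<^sup>+z. F (sh (- g) z) \<partial>Z)"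
  proof (rule nn_integral_cong_AE, use AE_snd[OF X.rn_real[of g]] in eventually_elim)
    case (elim z)
    then obtain r where "r > 0" "rn X actX g (snd z) = ennreal r" by blast
    then have "rn X actX g (snd z) * inverse (rn X actX g (snd z)) = 1"
      by (simp add: inverse_ennreal flip: ennreal_mult ennreal_1)
    then show ?case by (simp add: mult.assoc[symmetric])
  qed
  finally show "(\<integral>\<^sup>+z. F (sh (- g) z) \<partial>Z) = (\<integral>\<^sup>+z. \<rho> (snd z) * F z \<partial>Z)" by simp
qed

text \<open>\<open>s\<close> is the conditional expectation of \<open>w\<close> given the second
  coordinate, realised as the Radon-Nikodym derivative of the image of \<open>w Z\<close> on
  \<open>X\<close>.\<close>

lemma cond_density_snd:
  assumes w: "w \<in> borel_measurable Z"
  obtains s where "s \<in> borel_measurable X"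
    "\<And>f. f \<in> borel_measurable X \<Longrightarrow> (\<integral>\<^sup>+z. w z * f (snd z) \<partial>Z) = (\<integral>\<^sup>+x. s x * f x \<partial>X)"
proof -
  define N where "N = distr (density Z w) X snd"
  have sm: "snd \<in> density Z w \<rightarrow>\<^sub>M X" using snd_measurable by simp
  have "absolutely_continuous X N"
    unfolding absolutely_continuous_def
  proof
    fix A assume A: "A \<in> null_sets X"
    then have "AE z in Z. snd z \<notin> A" by (intro AE_snd AE_not_in)
    then have "AE z in density Z w. snd z \<notin> A"
      unfolding AE_density[OF w] by eventually_elim simp
    moreover have "{x \<in> space X. x \<notin> A} \<in> sets X" using A by auto
    ultimately have "AE x in N. x \<notin> A"
      unfolding N_def by (subst AE_distr_iff[OF sm]) auto
    then show "A \<in> null_sets N"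
      using A by (subst (asm) AE_iff_null_sets[symmetric]) (auto simp: N_def)
  qed
  then have d: "density X (RN_deriv X N) = N"
    by (rule X.density_RN_deriv) (simp add: N_def)
  show ?thesis
  proof (rule that[of "RN_deriv X N"])
    show "RN_deriv X N \<in> borel_measurable X" by measurable
    fix f :: "'x \<Rightarrow> ennreal" assume f: "f \<in> borel_measurable X"
    have "(\<integral>\<^sup>+x. RN_deriv X N x * f x \<partial>X) = (\<integral>\<^sup>+x. f x \<partial>density X (RN_deriv X N))"
      by (rule nn_integral_density[symmetric]) (use f in measurable)
    also have "\<dots> = (\<integral>\<^sup>+z. f (snd z) \<partial>density Z w)"
      unfolding d unfolding N_def by (rule nn_integral_distr[OF sm]) (use f in simp)
    also have "\<dots> = (\<integral>\<^sup>+z. w z * f (snd z) \<partial>Z)"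
      by (rule nn_integral_density[OF w]) (rule measurable_compose[OF snd_measurable f])
    finally show "(\<integral>\<^sup>+z. w z * f (snd z) \<partial>Z) = (\<integral>\<^sup>+x. RN_deriv X N x * f x \<partial>X)" by simp
  qed
qed

text \<open>Membership says that the translate of \<open>Z\<close> has density
  \<open>rn X actX g\<close>, which is tested on the rectangles of two countable generators. There
  \<open>\<alpha>\<close> is the translated measure. The other side contains
  \<open>rn X actX g\<close>, of unknown measurability in \<open>g\<close>; conditioning the
  indicator of \<open>B\<close> on \<open>X\<close> and undoing the change of variables gives
  \<open>\<beta>\<close>, where \<open>g\<close> occurs only in the action, so Fubini makes it
  Borel.\<close>

lemma sets_agree: "agree \<in> sets borel"
proof -
  obtain \<A> where \<A>: "countable \<A>" "\<A> \<subseteq> Pow (space X)" "Int_stable \<A>" "space X \<in> \<A>"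
    "sets X = sigma_sets (space X) \<A>"
    using standard_borel_generator[OF X.std] by metis
  obtain \<B> where \<B>: "countable \<B>" "\<B> \<subseteq> Pow (space Y)" "Int_stable \<B>" "space Y \<in> \<B>"
    "sets Y = sigma_sets (space Y) \<B>"
    using standard_borel_generator[OF Y.std] by metis
  have AX: "A \<in> sets X" if "A \<in> \<A>" for A using that \<A>(5) by auto
  have BY: "B \<in> sets Y" if "B \<in> \<B>" for B using that \<B>(5) by auto
  have iA: "(indicator A :: 'x \<Rightarrow> ennreal) \<in> borel_measurable X" if "A \<in> \<A>" for A using AX[OF that] by measurable
  have iB: "(indicator B :: 'y \<Rightarrow> ennreal) \<in> borel_measurable Y" if "B \<in> \<B>" for B using BY[OF that] by measurable
  have "\<exists>s. s \<in> borel_measurable X \<and> (\<forall>f\<in>borel_measurable X.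
      (\<integral>\<^sup>+z. indicator B (fst z) * f (snd z) \<partial>Z) = (\<integral>\<^sup>+x. s x * f x \<partial>X))" if "B \<in> \<B>" for B
    using cond_density_snd[OF measurable_compose[OF fst_measurable iB[OF that]]] by metis
  then obtain s where s: "\<And>B. B \<in> \<B> \<Longrightarrow> s B \<in> borel_measurable X"
    "\<And>B f. B \<in> \<B> \<Longrightarrow> f \<in> borel_measurable X \<Longrightarrow>
      (\<integral>\<^sup>+z. indicator B (fst z) * f (snd z) \<partial>Z) = (\<integral>\<^sup>+x. s B x * f x \<partial>X)"
    by metis
  define \<alpha> where "\<alpha> A B g = (\<integral>\<^sup>+z. indicator B (fst (sh g z)) * indicator A (snd (sh g z)) \<partial>Z)" for A B g
  define \<beta> where "\<beta> A B g = (\<integral>\<^sup>+x. s B (actX g x) * indicator A (actX g x) \<partial>X)" for A B g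
  have sA: "(\<lambda>x. s B x * indicator A x) \<in> borel_measurable X" if "A \<in> \<A>" "B \<in> \<B>" for A B
    by (intro borel_measurable_times_ennreal s(1) iA that)
  have \<beta>_eq: "\<beta> A B g = (\<integral>\<^sup>+z. indicator B (fst z) * (rn X actX g (snd z) * indicator A (snd z)) \<partial>Z)"
    if AB: "A \<in> \<A>" "B \<in> \<B>" for A B g
  proof -
    have "\<beta> A B g = (\<integral>\<^sup>+x. rn X actX g x * (s B x * indicator A x) \<partial>X)"
      unfolding \<beta>_def by (rule X.nn_integral_act[OF sA[OF AB]])
    also have "\<dots> = (\<integral>\<^sup>+x. s B x * (rn X actX g x * indicator A x) \<partial>X)"
      by (simp only: mult.left_commute)
    also have "\<dots> = (\<integral>\<^sup>+z. indicator B (fst z) * (rn X actX g (snd z) * indicator A (snd z)) \<partial>Z)"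
      by (rule s(2)[OF AB(2), symmetric]) (intro borel_measurable_times_ennreal X.rn_measurable iA AB)
    finally show ?thesis .
  qed
  have mAB: "(\<lambda>z. indicator B (fst z) * indicator A (snd z) :: ennreal) \<in> borel_measurable Z"
    if AB: "A \<in> \<A>" "B \<in> \<B>" for A B
    by (intro borel_measurable_times_ennreal measurable_compose[OF fst_measurable iB]
        measurable_compose[OF snd_measurable iA] AB)
  have "agree = (\<Inter>A\<in>\<A>. \<Inter>B\<in>\<B>. {g. \<alpha> A B g = \<beta> A B g})"
  proof (intro set_eqI iffI)
    fix g assume g: "g \<in> agree"
    have "\<alpha> A B g = \<beta> A B g" if AB: "A \<in> \<A>" "B \<in> \<B>" for A B
    proof -
      have "\<alpha> A B g = (\<integral>\<^sup>+z. rn X actX g (snd z) * (indicator B (fst z) * indicator A (snd z)) \<partial>Z)"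
        unfolding \<alpha>_def by (rule agreeE(1)[OF g mAB[OF AB]])
      then show ?thesis unfolding \<beta>_eq[OF AB] by (simp only: mult.left_commute)
    qed
    then show "g \<in> (\<Inter>A\<in>\<A>. \<Inter>B\<in>\<B>. {g. \<alpha> A B g = \<beta> A B g})" by blast
  next
    fix g assume "g \<in> (\<Inter>A\<in>\<A>. \<Inter>B\<in>\<B>. {g. \<alpha> A B g = \<beta> A B g})"
    then have eq: "\<alpha> A B g = \<beta> A B g" if "A \<in> \<A>" "B \<in> \<B>" for A B using that by blast
    have mX: "(\<lambda>z. rn X actX g (snd z)) \<in> borel_measurable Z"
      by (rule measurable_compose[OF snd_measurable X.rn_measurable])
    define E where "E = {B \<times> A |B A. B \<in> \<B> \<and> A \<in> \<A>}"
    have E: "e \<in> sets Z" if "e \<in> E" for e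
      using that AX BY unfolding E_def sets_Z by (auto intro: pair_measureI)
    have "distr Z Z (sh g) = density Z (\<lambda>z. rn X actX g (snd z))"
    proof (rule measure_eqI_generator_eq[where E=E and A="\<lambda>_. space Z" and \<Omega>="space Z"])
      show "Int_stable E"
      proof (rule Int_stableI)
        fix a b assume "a \<in> E" "b \<in> E"
        then obtain B A B' A' where "a = B \<times> A" "b = B' \<times> A'" "B \<in> \<B>" "A \<in> \<A>" "B' \<in> \<B>" "A' \<in> \<A>"
          unfolding E_def by blast
        moreover from this have "B \<inter> B' \<in> \<B>" "A \<inter> A' \<in> \<A>"
          using \<A>(3) \<B>(3) by (auto simp: Int_stable_def)
        ultimately show "a \<inter> b \<in> E"
          unfolding E_def by (auto simp: Times_Int_Times)
      qed
      show "E \<subseteq> Pow (space Z)" using E sets.sets_into_space by blast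
      have "sets (Y \<Otimes>\<^sub>M X) = sets (sigma (space Y \<times> space X) E)"
        unfolding E_def
        by (rule sets_pair_eq[where Ca="{space Y}" and Cb="{space X}"]) (use \<A> \<B> in simp_all)
      also have "\<dots> = sigma_sets (space Z) E"
        using \<open>E \<subseteq> Pow (space Z)\<close> by (simp add: space_Z sets_measure_of)
      finally show "sets (distr Z Z (sh g)) = sigma_sets (space Z) E"
        "sets (density Z (\<lambda>z. rn X actX g (snd z))) = sigma_sets (space Z) E"
        by (simp_all add: sets_Z)
      show "range (\<lambda>_::nat. space Z) \<subseteq> E" unfolding E_def space_Z using \<A>(4) \<B>(4) by blast
      show "emeasure (distr Z Z (sh g)) (space Z) \<noteq> \<infinity>" for i :: nat
        using prob_space.emeasure_space_1[OF Z.prob_space_distr[OF sh_measurable, of g]] by simp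
      fix e assume e: "e \<in> E"
      then obtain B A where AB: "e = B \<times> A" "A \<in> \<A>" "B \<in> \<B>" unfolding E_def by blast
      have ind: "indicator e z = (indicator B (fst z) * indicator A (snd z) :: ennreal)" for z
        unfolding AB(1) by (simp add: indicator_def mem_Times_iff)
      have "emeasure (distr Z Z (sh g)) e = (\<integral>\<^sup>+z. indicator e z \<partial>distr Z Z (sh g))"
        using E[OF e] by simp
      also have "\<dots> = (\<integral>\<^sup>+z. indicator e (sh g z) \<partial>Z)"
        by (rule nn_integral_distr[OF sh_measurable]) (use E[OF e] in simp)
      also have "\<dots> = \<beta> A B g" unfolding ind using eq[OF AB(2,3)] by (simp add: \<alpha>_def)
      also have "\<dots> = (\<integral>\<^sup>+z. rn X actX g (snd z) * indicator e z \<partial>Z)"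
        unfolding \<beta>_eq[OF AB(2,3)] ind by (simp only: mult.left_commute)
      also have "\<dots> = emeasure (density Z (\<lambda>z. rn X actX g (snd z))) e"
        by (rule emeasure_density[OF mX E[OF e], symmetric])
      finally show "emeasure (distr Z Z (sh g)) e = emeasure (density Z (\<lambda>z. rn X actX g (snd z))) e" .
    qed simp
    note d = this
    show "g \<in> agree" unfolding agree_def
    proof (intro CollectI bexI ballI)
      fix F :: "'y \<times> 'x \<Rightarrow> ennreal" assume F: "F \<in> borel_measurable Z"
      have "(\<integral>\<^sup>+z. F (sh g z) \<partial>Z) = (\<integral>\<^sup>+z. F z \<partial>distr Z Z (sh g))"
        by (rule nn_integral_distr[OF sh_measurable, symmetric]) (use F in simp)
      also have "\<dots> = (\<integral>\<^sup>+z. rn X actX g (snd z) * F z \<partial>Z)"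
        unfolding d by (rule nn_integral_density[OF mX F])
      finally show "(\<integral>\<^sup>+z. F (sh g z) \<partial>Z) = (\<integral>\<^sup>+z. rn X actX g (snd z) * F z \<partial>Z)" .
    qed (rule X.rn_measurable)
  qed
  moreover have "{g. \<alpha> A B g = \<beta> A B g} \<in> sets borel" if AB: "A \<in> \<A>" "B \<in> \<B>" for A B
  proof -
    have Xm: "(\<lambda>p. actX (fst p) (snd p)) \<in> borel \<Otimes>\<^sub>M X \<rightarrow>\<^sub>M X"
      by (intro X.act_joint_compose measurable_fst measurable_snd)
    have Zm: "(\<lambda>p. sh (fst p) (snd p)) \<in> borel \<Otimes>\<^sub>M Z \<rightarrow>\<^sub>M Z"
      unfolding sh_def
      by (intro pair_measurable X.act_joint_compose Y.act_joint_compose measurable_fst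
          measurable_compose[OF measurable_snd snd_measurable] measurable_compose[OF measurable_snd fst_measurable])
    have "\<alpha> A B \<in> borel_measurable borel"
      unfolding \<alpha>_def
      by (rule Z.borel_measurable_nn_integral) (unfold split_beta, rule measurable_compose[OF Zm mAB[OF AB]])
    moreover have "\<beta> A B \<in> borel_measurable borel"
      unfolding \<beta>_def
      by (rule X.borel_measurable_nn_integral) (unfold split_beta, rule measurable_compose[OF Xm sA[OF AB]])
    ultimately have "{g \<in> space borel. \<alpha> A B g = \<beta> A B g} \<in> sets borel" by measurable
    then show ?thesis by simp
  qed
  ultimately show ?thesis
    using \<A>(1) \<B>(1) by (auto intro!: sets.countable_INT'')
qed

text \<open>Since \<open>kl_div X\<close> lies below \<open>kl_div Y\<close>, equal finite integrals
  force equality almost everywhere. The subtraction of integrals requires measurable integrands,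
  hence the versions \<open>k\<close> and \<open>l\<close>.\<close>

lemma AE_agree:
  assumes \<mu>: "prob_space \<mu>" "sets \<mu> = sets (borel :: 'g measure)"
    and eq: "(\<integral>\<^sup>+g. kl_div X actX g \<partial>\<mu>) = (\<integral>\<^sup>+g. kl_div Y actY g \<partial>\<mu>)"
    and fin: "(\<integral>\<^sup>+g. kl_div Y actY g \<partial>\<mu>) < \<infinity>"
  shows "AE g in \<mu>. g \<in> agree"
proof -
  obtain k where k: "k \<in> borel_measurable \<mu>" "AE g in \<mu>. kl_div X actX g = k g"
    using X.kl_div_measurable[OF \<mu>] by metis
  obtain l where l: "l \<in> borel_measurable \<mu>" "AE g in \<mu>. kl_div Y actY g = l g"
    using Y.kl_div_measurable[OF \<mu>] by metis
  have ik: "(\<integral>\<^sup>+g. kl_div X actX g \<partial>\<mu>) = integral\<^sup>N \<mu> k"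
    by (rule nn_integral_cong_AE[OF k(2)])
  have il: "(\<integral>\<^sup>+g. kl_div Y actY g \<partial>\<mu>) = integral\<^sup>N \<mu> l"
    by (rule nn_integral_cong_AE[OF l(2)])
  have le: "AE g in \<mu>. k g \<le> l g"
    using k(2) l(2) by eventually_elim (metis kl_div_le)
  have "(\<integral>\<^sup>+g. l g - k g \<partial>\<mu>) = 0"
    using fin eq by (subst nn_integral_diff[OF l(1) k(1) _ le]) (auto simp: ik il)
  then have "AE g in \<mu>. l g - k g = 0"
    using k(1) l(1) by (subst (asm) nn_integral_0_iff_AE) auto
  moreover have "AE g in \<mu>. l g \<noteq> \<infinity>"
    using fin unfolding il by (intro nn_integral_PInf_AE[OF l(1)]) auto
  ultimately show ?thesis using le k(2) l(2)
  proof eventually_elim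
    case (elim g)
    have "kl_div Y actY g \<noteq> \<infinity>" "kl_div X actX g = kl_div Y actY g"
      using elim by (auto simp: diff_eq_0_iff_ennreal)
    \<comment> \<open>Cancellation in \<open>kl_div_defect\<close> is legitimate because
      \<open>kl_div Y actY g\<close> is finite.\<close>
    then have "defect (- g) = 0"
      using kl_div_defect[of g] by (metis add.right_neutral ennreal_add_left_cancel infinity_ennreal_def)
    then have "- g \<in> agree" by (intro agreeI defect_eq_0)
    then show ?case using agree_uminus[of "- g"] by simp
  qed
qed

end

section \<open>The Poisson boundary\<close>

lemma (in nonsingular_action) integral_act:
  fixes f :: "'x \<Rightarrow> real"
  assumes f: "f \<in> borel_measurable M"
  shows "(\<integral>x. f (act g x) \<partial>M) = (\<integral>x. enn2real (rn M act g x) * f x \<partial>M)"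
proof -
  have "density M (rn M act g) = density M (\<lambda>x. ennreal (enn2real (rn M act g x)))"
    by (rule density_cong) (measurable, use rn_real[of g] in eventually_elim, auto)
  then have d: "distr M M (act g) = density M (\<lambda>x. ennreal (enn2real (rn M act g x)))"
    by (simp add: density_rn)
  have "(\<integral>x. f (act g x) \<partial>M) = (\<integral>x. f x \<partial>distr M M (act g))"
    by (rule integral_distr[OF act_measurable f, symmetric])
  also have "\<dots> = (\<integral>x. enn2real (rn M act g x) *\<^sub>R f x \<partial>M)"
    unfolding d by (rule integral_density) (use f in simp_all)
  finally show ?thesis by simp
qed

lemma (in nonsingular_action) integrable_rn: "integrable M (\<lambda>x. enn2real (rn M act g x))"
  and integral_rn: "(\<integral>x. enn2real (rn M act g x) \<partial>M) = 1"
proof -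
  show "integrable M (\<lambda>x. enn2real (rn M act g x))"
  proof (rule integrableI_nn_integral_finite[where x=1])
    have "(\<integral>\<^sup>+x. ennreal (enn2real (rn M act g x)) \<partial>M) = (\<integral>\<^sup>+x. rn M act g x \<partial>M)"
      by (rule nn_integral_cong_AE, use rn_real[of g] in eventually_elim) auto
    then show "(\<integral>\<^sup>+x. ennreal (enn2real (rn M act g x)) \<partial>M) = ennreal 1" by (simp add: nn_integral_rn)
  qed simp_all
  show "(\<integral>x. enn2real (rn M act g x) \<partial>M) = 1"
    using integral_act[of "\<lambda>_. 1" g] by (simp add: prob_space)
qed

lemma (in prob_space) ennreal_integral_le_nn_integral:
  fixes h k :: "'a \<Rightarrow> real"
  assumes h: "integrable M h" and le: "AE x in M. h x \<le> k x"
  shows "ennreal (\<integral>x. h x \<partial>M) \<le> (\<integral>\<^sup>+x. ennreal (k x) \<partial>M)"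
proof -
  have "(\<integral>x. h x \<partial>M) \<le> (\<integral>x. max 0 (h x) \<partial>M)" by (intro integral_mono h integrable_max) auto
  then have "ennreal (\<integral>x. h x \<partial>M) \<le> ennreal (\<integral>x. max 0 (h x) \<partial>M)" by (rule ennreal_leI)
  also have "\<dots> = (\<integral>\<^sup>+x. ennreal (max 0 (h x)) \<partial>M)"
    by (rule nn_integral_eq_integral[symmetric]) (use h in \<open>auto intro: integrable_max\<close>)
  also have "\<dots> \<le> (\<integral>\<^sup>+x. ennreal (k x) \<partial>M)"
    by (rule nn_integral_mono_AE, use le in eventually_elim) (simp add: max_def ennreal_leI ennreal_neg)
  finally show ?thesis .
qed

section \<open>Truncations of the relative entropy integrand\<close>

text \<open>The value \<open>- ln b\<close> maximizes \<open>f + b - exp f * b\<close> over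
  \<open>f\<close>, with maximum \<open>kl_fun b\<close>. The truncation makes the test function and
  its exponential bounded, as lifting to the boundary requires.\<close>

definition truncated_minus_ln :: "nat \<Rightarrow> real \<Rightarrow> real" where
  "truncated_minus_ln n b = max (- real n) (min (real n) (- ln b))"

text \<open>Nonnegativity is what Fatou's lemma needs in \<open>kl_div_le_poisson\<close>. The bound
  \<open>n \<ge> 1\<close> is for small \<open>b\<close>, where the estimate is
  \<open>exp (real n) * b \<le> 1\<close>.\<close>

lemma truncated_minus_ln_nonneg:
  assumes b: "b > 0" and n: "n \<ge> 1"
  shows "0 \<le> truncated_minus_ln n b + b - exp (truncated_minus_ln n b) * b"
proof -
  consider "\<bar>ln b\<bar> \<le> real n" | "ln b < - real n" | "ln b > real n" by linarith
  then show ?thesis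
  proof cases
    case 1
    then have t: "truncated_minus_ln n b = - ln b" by (auto simp: truncated_minus_ln_def)
    have "exp (- ln b) * b = 1" using b by (simp add: exp_minus)
    then show ?thesis unfolding t using ln_le_minus_one[OF b] by simp
  next
    case 2
    then have t: "truncated_minus_ln n b = real n" by (auto simp: truncated_minus_ln_def)
    have "exp (real n) * b = exp (real n + ln b)" using b by (simp add: exp_add)
    also have "\<dots> \<le> 1" using 2 by simp
    finally show ?thesis unfolding t using b n by simp
  next
    case 3
    then have t: "truncated_minus_ln n b = - real n" by (auto simp: truncated_minus_ln_def)
    have "exp (- real n) * b \<le> b - real n"
    proof -
      have e: "exp (real n) \<le> b" using 3 b by (metis exp_le_cancel_iff exp_ln less_imp_le)
      have "real n + 1 \<le> exp (real n)" using exp_ge_add_one_self[of "real n"] by (simp add: add.commute)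
      then have "real n \<le> exp (real n) * (1 - exp (- real n))"
        by (simp add: algebra_simps flip: exp_add)
      also have "\<dots> \<le> b * (1 - exp (- real n))" using e by (intro mult_right_mono) auto
      finally show ?thesis by (simp add: algebra_simps)
    qed
    then show ?thesis unfolding t by simp
  qed
qed

lemma truncated_minus_ln_eventually:
  assumes "b > 0"
  shows "eventually (\<lambda>n. truncated_minus_ln (Suc n) b + b - exp (truncated_minus_ln (Suc n) b) * b = kl_fun b) sequentially"
proof -
  obtain N :: nat where N: "\<bar>ln b\<bar> \<le> real N" using real_arch_simple by blast
  have "truncated_minus_ln (Suc n) b + b - exp (truncated_minus_ln (Suc n) b) * b = kl_fun b" if "n \<ge> N" for n
  proof -
    have "truncated_minus_ln (Suc n) b = - ln b" using that N by (auto simp: truncated_minus_ln_def)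
    moreover have "exp (- ln b) * b = 1" using assms by (simp add: exp_minus)
    ultimately show ?thesis by (simp add: kl_fun_def)
  qed
  then show ?thesis by (auto simp: eventually_sequentially)
qed

text \<open>The tangents of \<open>exp\<close> at rational points already have supremum
  \<open>exp\<close>. Rationality keeps the number of exceptional null sets in
  \<open>lift_exp\<close> countable.\<close>

lemma exp_le_if_tangents:
  fixes v w :: real
  assumes "\<And>q. q \<in> \<rat> \<Longrightarrow> exp q + exp q * (v - q) \<le> w"
  shows "exp v \<le> w"
proof (rule ccontr)
  assume "\<not> exp v \<le> w"
  define S where "S = {t. w < exp t + exp t * (v - t)}"
  have "open S" unfolding S_def by (intro open_Collect_less continuous_intros)
  moreover have "v \<in> S" using \<open>\<not> exp v \<le> w\<close> by (simp add: S_def)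
  ultimately obtain e where e: "e > 0" "\<And>t. dist t v < e \<Longrightarrow> t \<in> S"
    unfolding open_dist by blast
  obtain q where q: "q \<in> \<rat>" "v < q" "q < v + e" using Rats_dense_in_real[of v "v + e"] e by auto
  then have "q \<in> S" by (intro e(2)) (simp add: dist_real_def)
  then show False using assms[OF q(1)] by (simp add: S_def)
qed

section \<open>Subgroups of full measure\<close>

locale poisson_boundary_space =
  B: nonsingular_action B actB + \<mu>: prob_space \<mu>
  for \<mu> :: "'g::{topological_group_add, second_countable_topology} measure"
    and B :: "'b measure" and actB :: "'g \<Rightarrow> 'b \<Rightarrow> 'b" +
  assumes sets_\<mu>: "sets \<mu> = sets borel" and pb: "poisson_boundary \<mu> B actB"
begin

lemma translation_measurable: "(\<lambda>h. g + h) \<in> \<mu> \<rightarrow>\<^sub>M borel"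
  unfolding measurable_cong_sets[OF sets_\<mu> refl]
  by (intro borel_measurable_continuous_onI continuous_intros)

lemma esssup_le:
  assumes f: "f \<in> Linf B" and le: "\<And>g. cmod (poisson_transform B actB f g) \<le> c"
  shows "AE b in B. cmod (f b) \<le> c"
proof -
  have "esssup B (\<lambda>x. ereal (cmod (f x))) = (SUP g. ereal (cmod (poisson_transform B actB f g)))"
    using pb f unfolding poisson_boundary_def by simp
  also have "\<dots> \<le> ereal c" by (rule SUP_least) (simp add: le)
  finally have "esssup B (\<lambda>x. ereal (cmod (f x))) \<le> ereal c" .
  moreover have "AE b in B. ereal (cmod (f b)) \<le> esssup B (\<lambda>x. ereal (cmod (f x)))" by (rule esssup_AE)
  ultimately show ?thesis by (auto elim!: eventually_mono dest: order_trans)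
qed

lemma harmonic_ex: "F \<in> bounded_harmonic \<mu> \<Longrightarrow> \<exists>f\<in>Linf B. poisson_transform B actB f = F"
  using pb unfolding poisson_boundary_def by (metis imageE)

lemma Linf_integrable_act: assumes "f \<in> Linf B" shows "integrable B (\<lambda>b. f (actB g b))"
proof -
  obtain c where c: "f \<in> borel_measurable B" "AE b in B. cmod (f b) \<le> c" using assms by (auto simp: Linf_def)
  show ?thesis
    by (rule B.integrable_const_bound[OF B.AE_act[OF c(2)] measurable_compose[OF B.act_measurable c(1)]])
qed

theorem full_measure_subgroup_eq_UNIV:
  assumes H: "H \<in> sets borel" and add: "\<And>g h. g \<in> H \<Longrightarrow> h \<in> H \<Longrightarrow> g + h \<in> H"
    and um: "\<And>g. g \<in> H \<Longrightarrow> - g \<in> H" and full: "AE g in \<mu>. g \<in> H"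
  shows "H = UNIV"
proof -
  define F :: "'g \<Rightarrow> complex" where "F = indicator H"
  have "F \<in> bounded_harmonic \<mu>"
    unfolding bounded_harmonic_def
  proof (intro CollectI conjI allI)
    show Fm: "F \<in> borel_measurable borel" unfolding F_def using H by measurable
    show "bounded (range F)"
      unfolding bounded_iff F_def by (intro exI[of _ 1]) (auto simp: indicator_def)
    fix g
    have "(\<integral>h. F (g + h) \<partial>\<mu>) = (\<integral>h. F g \<partial>\<mu>)"
    proof (rule integral_cong_AE)
      show "(\<lambda>h. F (g + h)) \<in> borel_measurable \<mu>"
        by (rule measurable_compose[OF translation_measurable Fm])
      \<comment> \<open>Being the indicator of a subgroup, \<open>F\<close> is invariant under right
        translation by \<open>H\<close>, so its average is taken over a constant.\<close>
      show "AE h in \<mu>. F (g + h) = F g"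
        using full
      proof eventually_elim
        case (elim h)
        have "g \<in> H" if "g + h \<in> H" using add[OF that um[OF elim]] by (simp add: add.assoc)
        then show ?case using add[OF _ elim, of g] by (auto simp: F_def indicator_def)
      qed
    qed simp
    then show "F g = (\<integral>h. F (g + h) \<partial>\<mu>)" by (simp add: \<mu>.prob_space)
  qed
  then obtain f where f: "f \<in> Linf B" "poisson_transform B actB f = F"
    using harmonic_ex by blast
  then have fm: "f \<in> borel_measurable B" by (simp add: Linf_def)
  have le1: "AE b in B. cmod (f b) \<le> 1"
    by (rule esssup_le[OF f(1)]) (simp add: f(2) F_def indicator_def)
  have "0 \<in> H"
  proof -
    have "\<exists>h. h \<in> H"
    proof (rule ccontr)
      assume "\<nexists>h. h \<in> H"
      then have "AE g in \<mu>. False" using full by auto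
      then show False by simp
    qed
    then obtain h where "h \<in> H" by blast
    then show ?thesis using add[OF _ um, of h h] by simp
  qed
  then have "poisson_transform B actB f 0 = 1" by (simp add: f(2) F_def)
  moreover have "poisson_transform B actB f 0 = (\<integral>b. f b \<partial>B)"
    unfolding poisson_transform_def by (rule Bochner_Integration.integral_cong) (simp_all add: B.act_0)
  ultimately have int1: "(\<integral>b. f b \<partial>B) = 1" by simp
  have intf: "integrable B f" by (rule B.integrable_const_bound[OF le1 fm])
  have "(\<integral>b. Re (f b) \<partial>B) = 1" using integral_Re[OF intf] int1 by simp
  then have "(\<integral>b. 1 - Re (f b) \<partial>B) = 0" using intf by (simp add: B.prob_space)
  moreover have "AE b in B. 0 \<le> 1 - Re (f b)"
    using le1 by eventually_elim (use complex_Re_le_cmod in \<open>auto intro: order_trans\<close>)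
  moreover have "integrable B (\<lambda>b. 1 - Re (f b))" using intf by simp
  ultimately have "AE b in B. 1 - Re (f b) = 0"
    using integral_nonneg_eq_0_iff_AE by blast
  then have f1: "AE b in B. f b = 1"
    using le1
  proof eventually_elim
    case (elim b)
    then have "Re (f b) = 1" by simp
    moreover have "(Re (f b))\<^sup>2 + (Im (f b))\<^sup>2 \<le> 1"
      using elim(2) by (simp add: cmod_power2[symmetric] power_le_one)
    ultimately have "Im (f b) = 0" by simp
    with \<open>Re (f b) = 1\<close> show ?case by (simp add: complex_eq_iff)
  qed
  have "g \<in> H" for g
  proof -
    have "(\<integral>b. f (actB g b) \<partial>B) = (\<integral>b. 1 \<partial>B)"
      by (rule integral_cong_AE) (use B.AE_act[OF f1] measurable_compose[OF B.act_measurable fm] in auto)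
    then have "F g = 1" unfolding f(2)[symmetric] poisson_transform_def by (simp add: B.prob_space)
    then show ?thesis by (simp add: F_def indicator_def split: if_splits)
  qed
  then show ?thesis by blast
qed

end

section \<open>Lifting functions from a stationary space to the boundary\<close>

locale stationary_over_poisson =
  poisson_boundary_space \<mu> B actB + X: nonsingular_action X actX
  for \<mu> :: "'g::{topological_group_add, second_countable_topology} measure"
    and B :: "'b measure" and actB :: "'g \<Rightarrow> 'b \<Rightarrow> 'b"
    and X :: "'x measure" and actX :: "'g \<Rightarrow> 'x \<Rightarrow> 'x" +
  assumes stat: "stationary \<mu> X actX"
begin

text \<open>The Markov operator from \<open>X\<close> to the boundary: \<open>v\<close> and
  \<open>f\<close> have the same integrals over all translates, that is, the same Poisson transform.
  It is a relation because \<open>v\<close> is determined only up to null sets.\<close>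

definition lift :: "('x \<Rightarrow> real) \<Rightarrow> ('b \<Rightarrow> real) \<Rightarrow> bool" where
  "lift f v \<longleftrightarrow> v \<in> borel_measurable B \<and> (\<exists>c. AE b in B. \<bar>v b\<bar> \<le> c) \<and>
     (\<forall>g. (\<integral>b. v (actB g b) \<partial>B) = (\<integral>x. f (actX g x) \<partial>X))"

lemma integrable_bounded_act:
  fixes f :: "'x \<Rightarrow> real"
  assumes "f \<in> borel_measurable X" "\<And>x. \<bar>f x\<bar> \<le> c" shows "integrable X (\<lambda>x. f (actX g x))"
  by (rule X.integrable_const_bound[where B=c])
     (use assms measurable_compose[OF X.act_measurable assms(1)] in auto)

text \<open>Stationarity of \<open>X\<close> makes the integral of \<open>f\<close> over translates
  a bounded harmonic function of \<open>g\<close>, hence a Poisson transform. The boundary function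
  so obtained is complex, and its real part is taken.\<close>

lemma lift_ex:
  fixes f :: "'x \<Rightarrow> real"
  assumes f: "f \<in> borel_measurable X" and c: "\<And>x. \<bar>f x\<bar> \<le> c"
  obtains v where "lift f v"
proof -
  define F where "F g = (\<integral>x. f (actX g x) \<partial>X)" for g
  have Xm: "(\<lambda>p. actX (fst p) (snd p)) \<in> borel \<Otimes>\<^sub>M X \<rightarrow>\<^sub>M X"
    by (intro X.act_joint_compose measurable_fst measurable_snd)
  have Fm: "F \<in> borel_measurable borel"
    unfolding F_def by (rule X.borel_measurable_lebesgue_integral) (unfold split_beta, rule measurable_compose[OF Xm f])
  have Fb: "\<bar>F g\<bar> \<le> c" for g
  proof -
    have "\<bar>F g\<bar> \<le> (\<integral>x. \<bar>f (actX g x)\<bar> \<partial>X)" unfolding F_def by (rule integral_abs_bound)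
    also have "\<dots> \<le> (\<integral>x. c \<partial>X)"
      using integrable_bounded_act[OF f c] c by (intro integral_mono) auto
    finally show ?thesis by (simp add: X.prob_space)
  qed
  interpret P: pair_prob_space \<mu> X ..
  have Xm': "(\<lambda>p. actX (fst p) (snd p)) \<in> \<mu> \<Otimes>\<^sub>M X \<rightarrow>\<^sub>M X"
    using Xm unfolding measurable_cong_sets[OF sets_pair_measure_cong[OF sets_\<mu> refl] refl] .
  have d: "distr (\<mu> \<Otimes>\<^sub>M X) X (\<lambda>p. actX (fst p) (snd p)) = X"
    using stat unfolding stationary_def split_beta .
  have harm: "F g = (\<integral>h. F (g + h) \<partial>\<mu>)" for g
  proof -
    define k where "k x = f (actX g x)" for x
    have k: "k \<in> borel_measurable X" unfolding k_def by (rule measurable_compose[OF X.act_measurable f])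
    have km: "(\<lambda>p. k (actX (fst p) (snd p))) \<in> borel_measurable (\<mu> \<Otimes>\<^sub>M X)"
      by (rule measurable_compose[OF Xm' k])
    have "integrable (\<mu> \<Otimes>\<^sub>M X) (\<lambda>p. k (actX (fst p) (snd p)))"
      by (rule P.integrable_const_bound[where B=c]) (use km c in \<open>auto simp: k_def\<close>)
    then have int: "integrable (\<mu> \<Otimes>\<^sub>M X) (\<lambda>(h, x). k (actX h x))" by (simp add: case_prod_unfold)
    have "F g = (\<integral>x. k x \<partial>distr (\<mu> \<Otimes>\<^sub>M X) X (\<lambda>p. actX (fst p) (snd p)))" by (simp add: d F_def k_def)
    also have "\<dots> = (\<integral>p. k (actX (fst p) (snd p)) \<partial>(\<mu> \<Otimes>\<^sub>M X))" by (rule integral_distr[OF Xm' k])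
    also have "\<dots> = (\<integral>h. (\<integral>x. k (actX h x) \<partial>X) \<partial>\<mu>)"
      using P.integral_fst'[OF int] by (simp add: case_prod_unfold)
    also have "\<dots> = (\<integral>h. F (g + h) \<partial>\<mu>)"
      unfolding F_def k_def
      by (intro Bochner_Integration.integral_cong refl) (simp add: X.act_add)
    finally show ?thesis .
  qed
  have "(\<lambda>g. complex_of_real (F g)) \<in> bounded_harmonic \<mu>"
    unfolding bounded_harmonic_def
  proof (intro CollectI conjI allI)
    show "(\<lambda>g. complex_of_real (F g)) \<in> borel_measurable borel" using Fm by measurable
    show "bounded (range (\<lambda>g. complex_of_real (F g)))"
      unfolding bounded_iff using Fb by (intro exI[of _ c]) auto
    show "complex_of_real (F g) = (\<integral>h. complex_of_real (F (g + h)) \<partial>\<mu>)" for g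
      using harm[of g] by (simp only: integral_complex_of_real)
  qed
  then obtain u where u: "u \<in> Linf B" "poisson_transform B actB u = (\<lambda>g. complex_of_real (F g))"
    using harmonic_ex by blast
  obtain d where d: "u \<in> borel_measurable B" "AE b in B. cmod (u b) \<le> d" using u by (auto simp: Linf_def)
  show ?thesis
  proof (rule that[of "\<lambda>b. Re (u b)"], unfold lift_def, intro conjI allI)
    show "(\<lambda>b. Re (u b)) \<in> borel_measurable B" using d(1) by measurable
    show "\<exists>c. AE b in B. \<bar>Re (u b)\<bar> \<le> c"
      using d(2) by (intro exI[of _ d]) (auto elim!: eventually_mono intro: order_trans[OF abs_Re_le_cmod])
    fix g
    have "(\<integral>b. Re (u (actB g b)) \<partial>B) = Re (\<integral>b. u (actB g b) \<partial>B)"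
      by (rule integral_Re[OF Linf_integrable_act[OF u(1)]])
    also have "\<dots> = Re (poisson_transform B actB u g)" by (simp add: poisson_transform_def)
    also have "\<dots> = F g" by (simp add: u(2))
    finally show "(\<integral>b. Re (u (actB g b)) \<partial>B) = (\<integral>x. f (actX g x) \<partial>X)" by (simp add: F_def)
  qed
qed

lemma lift_integrable:
  assumes "lift f v" shows "integrable B (\<lambda>b. v (actB g b))"
proof -
  obtain c where c: "v \<in> borel_measurable B" "AE b in B. \<bar>v b\<bar> \<le> c" using assms by (auto simp: lift_def)
  have "AE b in B. norm (v (actB g b)) \<le> c" using B.AE_act[OF c(2), of g] by simp
  then show ?thesis by (rule B.integrable_const_bound[OF _ measurable_compose[OF B.act_measurable c(1)]])
qed

lemma lift_affine:
  assumes v: "lift f v" and w: "lift k w"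
    and f: "f \<in> borel_measurable X" "\<And>x. \<bar>f x\<bar> \<le> c" and k: "k \<in> borel_measurable X" "\<And>x. \<bar>k x\<bar> \<le> d"
  shows "lift (\<lambda>x. s + p * f x + q * k x) (\<lambda>b. s + p * v b + q * w b)"
  unfolding lift_def
proof (intro conjI allI)
  obtain c' where c': "v \<in> borel_measurable B" "AE b in B. \<bar>v b\<bar> \<le> c'" using v by (auto simp: lift_def)
  obtain d' where d': "w \<in> borel_measurable B" "AE b in B. \<bar>w b\<bar> \<le> d'" using w by (auto simp: lift_def)
  show "(\<lambda>b. s + p * v b + q * w b) \<in> borel_measurable B" using c'(1) d'(1) by measurable
  have "AE b in B. \<bar>s + p * v b + q * w b\<bar> \<le> \<bar>s\<bar> + \<bar>p\<bar> * c' + \<bar>q\<bar> * d'"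
    using c'(2) d'(2)
  proof eventually_elim
    case (elim b)
    have "\<bar>p * v b\<bar> \<le> \<bar>p\<bar> * c'" "\<bar>q * w b\<bar> \<le> \<bar>q\<bar> * d'"
      unfolding abs_mult using elim by (auto intro: mult_left_mono)
    then show ?case by linarith
  qed
  then show "\<exists>c. AE b in B. \<bar>s + p * v b + q * w b\<bar> \<le> c" by blast
  fix g
  have "(\<integral>b. v (actB g b) \<partial>B) = (\<integral>x. f (actX g x) \<partial>X)" "(\<integral>b. w (actB g b) \<partial>B) = (\<integral>x. k (actX g x) \<partial>X)"
    using v w by (auto simp: lift_def)
  then show "(\<integral>b. s + p * v (actB g b) + q * w (actB g b) \<partial>B) = (\<integral>x. s + p * f (actX g x) + q * k (actX g x) \<partial>X)"
    using lift_integrable[OF v, of g] lift_integrable[OF w, of g]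
      integrable_bounded_act[OF f, of g] integrable_bounded_act[OF k, of g]
    by (simp add: B.prob_space X.prob_space)
qed

text \<open>The bound \<open>\<bar>f - c/2\<bar> \<le> c/2\<close> passes to the lift because the Poisson transform is isometric.\<close>
lemma lift_nonneg:
  assumes v: "lift f v" and f: "f \<in> borel_measurable X" "\<And>x. 0 \<le> f x" "\<And>x. f x \<le> c"
  shows "AE b in B. 0 \<le> v b"
proof -
  obtain c' where c': "v \<in> borel_measurable B" "AE b in B. \<bar>v b\<bar> \<le> c'" using v by (auto simp: lift_def)
  define u where "u b = complex_of_real (v b - c / 2)" for b
  have "u \<in> Linf B"
    unfolding Linf_def
  proof (intro CollectI conjI exI)
    show "u \<in> borel_measurable B" unfolding u_def using c'(1) by measurable
    show "AE b in B. cmod (u b) \<le> c' + \<bar>c / 2\<bar>"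
      using c'(2) by eventually_elim (simp add: u_def del: of_real_diff)
  qed
  moreover have "cmod (poisson_transform B actB u g) \<le> c / 2" for g
  proof -
    have intf: "integrable X (\<lambda>x. f (actX g x))"
      by (rule integrable_bounded_act[where c=c, OF f(1)]) (use f in auto)
    have "poisson_transform B actB u g = complex_of_real (\<integral>b. v (actB g b) - c / 2 \<partial>B)"
      unfolding poisson_transform_def u_def by (rule integral_complex_of_real)
    also have "(\<integral>b. v (actB g b) - c / 2 \<partial>B) = (\<integral>x. f (actX g x) \<partial>X) - c / 2"
      using lift_integrable[OF v, of g] v by (simp add: lift_def B.prob_space)
    finally have "cmod (poisson_transform B actB u g) = \<bar>(\<integral>x. f (actX g x) \<partial>X) - c / 2\<bar>"
      by (simp del: of_real_diff)
    moreover have "0 \<le> (\<integral>x. f (actX g x) \<partial>X)" using f(2) by simp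
    moreover have "(\<integral>x. f (actX g x) \<partial>X) \<le> (\<integral>x. c \<partial>X)" using intf f(3) by (intro integral_mono) auto
    ultimately have "\<bar>(\<integral>x. f (actX g x) \<partial>X) - c / 2\<bar> \<le> c / 2"
      by (intro abs_leI) (simp_all add: X.prob_space)
    then show ?thesis using \<open>cmod _ = _\<close> by simp
  qed
  ultimately have "AE b in B. cmod (u b) \<le> c / 2" by (rule esssup_le)
  then show ?thesis
  proof eventually_elim
    case (elim b)
    then have "\<bar>v b - c / 2\<bar> \<le> c / 2" by (simp only: u_def norm_of_real)
    then have "- (v b - c / 2) \<le> c / 2" by (rule order_trans[OF abs_ge_minus_self])
    then show ?case by simp
  qed
qed

text \<open>Jensen's inequality for a positive operator: \<open>exp f\<close> minus its tangent at a
  rational \<open>q\<close> is nonnegative, so its lift is, and the tangents at all rationals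
  recover \<open>exp\<close>.\<close>

lemma lift_exp:
  assumes v: "lift f v" and w: "lift (\<lambda>x. exp (f x)) w"
    and f: "f \<in> borel_measurable X" "\<And>x. \<bar>f x\<bar> \<le> c"
  shows "AE b in B. exp (v b) \<le> w b"
proof -
  have ef: "(\<lambda>x. exp (f x)) \<in> borel_measurable X" using f(1) by measurable
  have ec: "\<bar>exp (f x)\<bar> \<le> exp c" for x using f(2)[of x] by simp
  have "AE b in B. exp q + exp q * (v b - q) \<le> w b" for q :: real
  proof -
    \<comment> \<open>\<open>s - exp q * f\<close> is the negative of the tangent
      \<open>exp q + exp q * (f - q)\<close>.\<close>
    define s where "s = exp q * q - exp q"
    have l: "lift (\<lambda>x. s + (- exp q) * f x + 1 * exp (f x)) (\<lambda>b. s + (- exp q) * v b + 1 * w b)"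
      by (rule lift_affine[OF v w f ef ec])
    have "AE b in B. 0 \<le> s + (- exp q) * v b + 1 * w b"
    proof (rule lift_nonneg[OF l])
      show "(\<lambda>x. s + (- exp q) * f x + 1 * exp (f x)) \<in> borel_measurable X" using f(1) by measurable
      fix x
      have "exp q * (1 + (f x - q)) \<le> exp q * exp (f x - q)"
        by (intro mult_left_mono exp_ge_add_one_self) auto
      then show "0 \<le> s + (- exp q) * f x + 1 * exp (f x)"
        by (simp add: s_def algebra_simps flip: exp_add)
      have "\<bar>exp q * f x\<bar> \<le> exp q * c" using f(2)[of x] by (simp add: abs_mult)
      then have "- (exp q * f x) \<le> exp q * c" by linarith
      moreover have "exp (f x) \<le> exp c" using ec[of x] by simp
      ultimately show "s + (- exp q) * f x + 1 * exp (f x) \<le> s + exp q * c + exp c" by linarith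
    qed
    then show ?thesis by eventually_elim (simp add: s_def algebra_simps)
  qed
  then have "AE b in B. \<forall>q\<in>\<rat>. exp q + exp q * (v b - q) \<le> w b"
    by (simp add: AE_ball_countable[OF countable_rat])
  then show ?thesis by eventually_elim (rule exp_le_if_tangents, blast)
qed

text \<open>Lifting preserves the integral of \<open>f\<close> (at the unit) and turns the integral
  of \<open>exp f * b\<close> (at \<open>- g\<close>) into that of \<open>a * w\<close>, and
  \<open>a\<close>, \<open>b\<close> both have integral 1. Hence the integral over \<open>X\<close>
  equals that of \<open>v + a - a * w\<close> over the boundary. There \<open>exp v \<le> w\<close>
  and \<open>1 + (v + ln a) \<le> a * exp v\<close> bound the integrand by
  \<open>kl_fun a\<close>.\<close>

lemma truncated_integral_le:
  fixes g :: 'g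
  assumes n: "n \<ge> 1"
  defines "b \<equiv> \<lambda>x. enn2real (rn X actX (- g) x)"
  shows "(\<integral>\<^sup>+x. ennreal (truncated_minus_ln n (b x) + b x - exp (truncated_minus_ln n (b x)) * b x) \<partial>X) \<le> kl_div B actB g"
proof -
  define a where "a = (\<lambda>x. enn2real (rn B actB (- g) x))"
  define f where "f = (\<lambda>x. truncated_minus_ln n (b x))"
  have bm: "b \<in> borel_measurable X" unfolding b_def by measurable
  have am: "a \<in> borel_measurable B" unfolding a_def by measurable
  have bi: "integrable X b" "(\<integral>x. b x \<partial>X) = 1" unfolding b_def by (rule X.integrable_rn X.integral_rn)+
  have ai: "integrable B a" "(\<integral>x. a x \<partial>B) = 1" unfolding a_def by (rule B.integrable_rn B.integral_rn)+
  have fm: "f \<in> borel_measurable X" unfolding f_def truncated_minus_ln_def using bm by measurable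
  have fb: "\<bar>f x\<bar> \<le> real n" for x by (auto simp: f_def truncated_minus_ln_def)
  have em: "(\<lambda>x. exp (f x)) \<in> borel_measurable X" using fm by measurable
  have eb: "\<bar>exp (f x)\<bar> \<le> exp (real n)" for x using fb[of x] by simp
  obtain v where v: "lift f v" by (rule lift_ex[OF fm fb])
  obtain w where w: "lift (\<lambda>x. exp (f x)) w" by (rule lift_ex[OF em eb])
  obtain cv where cv: "v \<in> borel_measurable B" "AE b in B. \<bar>v b\<bar> \<le> cv" using v by (auto simp: lift_def)
  obtain cw where cw: "w \<in> borel_measurable B" "AE b in B. \<bar>w b\<bar> \<le> cw" using w by (auto simp: lift_def)
  have fi: "integrable X f" by (rule X.integrable_const_bound[where B="real n"]) (use fb fm in auto)
  have ebi: "integrable X (\<lambda>x. exp (f x) * b x)"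
  proof (rule Bochner_Integration.integrable_bound)
    show "integrable X (\<lambda>x. exp (real n) * b x)" using bi by simp
    show "(\<lambda>x. exp (f x) * b x) \<in> borel_measurable X" using em bm by measurable
    show "AE x in X. norm (exp (f x) * b x) \<le> norm (exp (real n) * b x)"
      using eb by (intro AE_I2) (simp add: abs_mult mult_right_mono)
  qed
  have wai: "integrable B (\<lambda>y. a y * w y)"
  proof (rule Bochner_Integration.integrable_bound)
    show "integrable B (\<lambda>y. cw * a y)" using ai by simp
    show "(\<lambda>y. a y * w y) \<in> borel_measurable B" using am cw(1) by measurable
    show "AE y in B. norm (a y * w y) \<le> norm (cw * a y)"
      using cw(2)
    proof eventually_elim
      case (elim y)
      have "\<bar>a y\<bar> * \<bar>w y\<bar> \<le> \<bar>a y\<bar> * cw" using elim by (intro mult_left_mono) auto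
      also have "\<dots> \<le> \<bar>cw * a y\<bar>" by (simp add: abs_mult mult.commute mult_right_mono)
      finally show ?case by (simp add: abs_mult)
    qed
  qed
  have vi: "integrable B v" by (rule B.integrable_const_bound[OF _ cv(1)]) (use cv(2) in simp)
  have vint: "(\<integral>y. v y \<partial>B) = (\<integral>x. f x \<partial>X)"
  proof -
    have "(\<integral>y. v (actB 0 y) \<partial>B) = (\<integral>x. f (actX 0 x) \<partial>X)" using v by (simp add: lift_def)
    moreover have "(\<integral>y. v (actB 0 y) \<partial>B) = (\<integral>y. v y \<partial>B)"
      by (rule Bochner_Integration.integral_cong) (simp_all add: B.act_0)
    moreover have "(\<integral>x. f (actX 0 x) \<partial>X) = (\<integral>x. f x \<partial>X)"
      by (rule Bochner_Integration.integral_cong) (simp_all add: X.act_0)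
    ultimately show ?thesis by simp
  qed
  have wint: "(\<integral>y. a y * w y \<partial>B) = (\<integral>x. exp (f x) * b x \<partial>X)"
  proof -
    have "(\<integral>y. a y * w y \<partial>B) = (\<integral>y. w (actB (- g) y) \<partial>B)"
      unfolding a_def by (rule B.integral_act[OF cw(1), symmetric])
    also have "\<dots> = (\<integral>x. exp (f (actX (- g) x)) \<partial>X)" using w by (simp add: lift_def)
    also have "\<dots> = (\<integral>x. b x * exp (f x) \<partial>X)"
      unfolding b_def by (rule X.integral_act[OF em])
    finally show ?thesis by (simp add: mult.commute)
  qed
  have "(\<integral>\<^sup>+x. ennreal (f x + b x - exp (f x) * b x) \<partial>X) = ennreal (\<integral>x. f x + b x - exp (f x) * b x \<partial>X)"
  proof (rule nn_integral_eq_integral)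
    show "integrable X (\<lambda>x. f x + b x - exp (f x) * b x)" using fi bi ebi by simp
    show "AE x in X. 0 \<le> f x + b x - exp (f x) * b x"
      using X.rn_real[of "- g"]
    proof eventually_elim
      case (elim x)
      then have "b x > 0" by (auto simp: b_def)
      then show ?case unfolding f_def by (rule truncated_minus_ln_nonneg[OF _ n])
    qed
  qed
  also have "(\<integral>x. f x + b x - exp (f x) * b x \<partial>X) = (\<integral>y. v y + a y - a y * w y \<partial>B)"
    using fi bi ebi vi ai wai vint wint by simp
  also have "ennreal \<dots> \<le> (\<integral>\<^sup>+y. ennreal (kl_fun (a y)) \<partial>B)"
  proof (rule B.ennreal_integral_le_nn_integral)
    show "integrable B (\<lambda>y. v y + a y - a y * w y)" using vi ai wai by simp
    show "AE y in B. v y + a y - a y * w y \<le> kl_fun (a y)"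
      using B.rn_real[of "- g"] lift_exp[OF v w fm fb]
    proof eventually_elim
      case (elim y)
      then have a: "a y > 0" by (auto simp: a_def)
      have "1 + (v y + ln (a y)) \<le> exp (v y + ln (a y))" by (rule exp_ge_add_one_self)
      also have "\<dots> = a y * exp (v y)" using a by (simp add: exp_add mult.commute)
      also have "\<dots> \<le> a y * w y" using elim(2) a by (intro mult_left_mono) auto
      finally show ?case by (simp add: kl_fun_def)
    qed
  qed
  also have "\<dots> = kl_div B actB g" by (simp add: kl_div_def a_def)
  finally show ?thesis by (simp add: f_def)
qed

theorem kl_div_le_poisson: "kl_div X actX g \<le> kl_div B actB g"
proof -
  define b where "b x = enn2real (rn X actX (- g) x)" for x
  \<comment> \<open>The index \<open>Suc n\<close> satisfies the requirement that the truncation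
    level be at least 1; at each point the truncations are eventually equal to the full
    integrand.\<close>
  define \<psi> where "\<psi> n x = ennreal (truncated_minus_ln (Suc n) (b x) + b x - exp (truncated_minus_ln (Suc n) (b x)) * b x)" for n x
  have bm: "b \<in> borel_measurable X" unfolding b_def by measurable
  have \<psi>m: "\<psi> n \<in> borel_measurable X" for n
    unfolding \<psi>_def truncated_minus_ln_def using bm by measurable
  have "kl_div X actX g = (\<integral>\<^sup>+x. liminf (\<lambda>n. \<psi> n x) \<partial>X)"
    unfolding kl_div_def
  proof (rule nn_integral_cong_AE, use X.rn_real[of "- g"] in eventually_elim)
    case (elim x)
    then have "b x > 0" by (auto simp: b_def)
    from truncated_minus_ln_eventually[OF this]
    have "eventually (\<lambda>n. \<psi> n x = ennreal (kl_fun (b x))) sequentially"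
      by eventually_elim (simp add: \<psi>_def)
    then have "(\<lambda>n. \<psi> n x) \<longlonglongrightarrow> ennreal (kl_fun (b x))" by (rule tendsto_eventually)
    then have "liminf (\<lambda>n. \<psi> n x) = ennreal (kl_fun (b x))" by (intro lim_imp_Liminf) auto
    then show ?case by (simp add: b_def)
  qed
  also have "\<dots> \<le> liminf (\<lambda>n. integral\<^sup>N X (\<psi> n))"
    by (rule nn_integral_liminf[OF \<psi>m])
  also have "\<dots> \<le> liminf (\<lambda>n. kl_div B actB g)"
    unfolding \<psi>_def b_def by (intro Liminf_mono always_eventually allI truncated_integral_le) simp
  also have "\<dots> = kl_div B actB g" by (intro Liminf_const) simp
  finally show ?thesis .
qed

end

section \<open>Continuous functions on a compact flow\<close>

locale compact_flow =
  fixes T :: "'a topology" and act :: "'g::{topological_group_add, second_countable_topology} \<Rightarrow> 'a \<Rightarrow> 'a"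
  assumes compact: "compact_space T" and metrizable: "metrizable_space T" and nonempty: "topspace T \<noteq> {}"
    and ga: "group_action_on (topspace T) act"
    and cont: "continuous_map (prod_topology euclidean T) T (\<lambda>(g, x). act g x)"
begin

abbreviation CT :: "('a \<Rightarrow> real) set" where "CT \<equiv> {f. continuous_map T euclideanreal f}"

lemma act_space: "x \<in> topspace T \<Longrightarrow> act g x \<in> topspace T"
  and act_0: "x \<in> topspace T \<Longrightarrow> act 0 x = x"
  and act_add: "x \<in> topspace T \<Longrightarrow> act (g + h) x = act g (act h x)"
  using ga by (auto simp: group_action_on_def)

lemma act_continuous: "continuous_map T T (act g)"
proof -
  have "continuous_map T (prod_topology euclidean T) (\<lambda>x. (g, x))"
    by (intro continuous_map_pairedI) auto
  from continuous_map_compose[OF this cont] show ?thesis by (simp add: o_def)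
qed

lemma CT_act: "f \<in> CT \<Longrightarrow> (\<lambda>x. f (act g x)) \<in> CT"
  using continuous_map_compose[OF act_continuous, of euclideanreal f g] by (simp add: o_def)

lemma second_countable: "second_countable T"
  by (rule compact_metrizable_second_countable[OF compact metrizable])

section \<open>Embedding continuous functions isometrically into bounded sequences\<close>

definition dense_seq :: "nat \<Rightarrow> 'a" where
  "dense_seq = (SOME e. range e \<subseteq> topspace T \<and> T closure_of (range e) = topspace T)"

lemma dense_seq: "dense_seq n \<in> topspace T" "T closure_of (range dense_seq) = topspace T"
proof -
  obtain C where C: "countable C" "C \<subseteq> topspace T" "T closure_of C = topspace T"
    using second_countable_imp_separable_space[OF second_countable] unfolding separable_space_def by blast
  have "C \<noteq> {}" using C(3) nonempty by (metis closure_of_empty)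
  then have "range (from_nat_into C) = C" using C(1) by (rule range_from_nat_into)
  then have "\<exists>e :: nat \<Rightarrow> 'a. range e \<subseteq> topspace T \<and> T closure_of (range e) = topspace T"
    using C by (intro exI[of _ "from_nat_into C"]) simp
  from someI_ex[OF this] show "dense_seq n \<in> topspace T" "T closure_of (range dense_seq) = topspace T"
    unfolding dense_seq_def by blast+
qed

lemma le_of_dense:
  assumes f: "f \<in> CT" and le: "\<And>n. f (dense_seq n) \<le> c" and x: "x \<in> topspace T"
  shows "f x \<le> c"
proof -
  have "closedin T {x \<in> topspace T. f x \<in> {..c}}"
    by (rule closedin_continuous_map_preimage) (use f in auto)
  then have "T closure_of (range dense_seq) \<subseteq> {x \<in> topspace T. f x \<in> {..c}}"
    by (intro closure_of_minimal) (use le dense_seq(1) in auto)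
  then show ?thesis using x dense_seq(2) by auto
qed

definition J :: "('a \<Rightarrow> real) \<Rightarrow> linf" where "J f = Bcontfun (\<lambda>n. f (dense_seq n))"

lemma J_apply: assumes "f \<in> CT" shows "apply_bcontfun (J f) n = f (dense_seq n)"
proof -
  obtain c where "\<And>x. x \<in> topspace T \<Longrightarrow> \<bar>f x\<bar> \<le> c"
    using continuous_map_compact_bounded[OF compact] assms by blast
  then have "(\<lambda>n. f (dense_seq n)) \<in> bcontfun"
    unfolding bcontfun_def bounded_iff by (auto intro!: exI[of _ c] simp: dense_seq(1))
  then show ?thesis unfolding J_def by (simp add: Bcontfun_inverse)
qed

lemma CT_add: "f \<in> CT \<Longrightarrow> k \<in> CT \<Longrightarrow> (\<lambda>x. f x + k x) \<in> CT"
  and CT_diff: "f \<in> CT \<Longrightarrow> k \<in> CT \<Longrightarrow> (\<lambda>x. f x - k x) \<in> CT"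
  and CT_scale: "f \<in> CT \<Longrightarrow> (\<lambda>x. c * f x) \<in> CT"
  and CT_const: "(\<lambda>x. c) \<in> CT"
  by (auto intro: continuous_map_add continuous_map_diff continuous_map_real_mult_left)

lemma J_add: "f \<in> CT \<Longrightarrow> k \<in> CT \<Longrightarrow> J (\<lambda>x. f x + k x) = J f + J k"
  by (rule bcontfun_eqI) (simp only: J_apply CT_add plus_bcontfun.rep_eq)

lemma J_diff: "f \<in> CT \<Longrightarrow> k \<in> CT \<Longrightarrow> J (\<lambda>x. f x - k x) = J f - J k"
  by (rule bcontfun_eqI) (simp only: J_apply CT_diff minus_bcontfun.rep_eq)

lemma J_scale: "f \<in> CT \<Longrightarrow> J (\<lambda>x. c * f x) = c *\<^sub>R J f"
  by (rule bcontfun_eqI) (simp only: J_apply CT_scale scaleR_bcontfun.rep_eq real_scaleR_def)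

lemma norm_J_le: assumes "f \<in> CT" "\<And>x. x \<in> topspace T \<Longrightarrow> \<bar>f x\<bar> \<le> c" shows "norm (J f) \<le> c"
  by (rule norm_bound) (simp add: J_apply[OF assms(1)] assms(2) dense_seq(1))

lemma abs_le_norm_J: assumes f: "f \<in> CT" and x: "x \<in> topspace T" shows "\<bar>f x\<bar> \<le> norm (J f)"
proof (rule abs_leI)
  have b: "\<bar>f (dense_seq n)\<bar> \<le> norm (J f)" for n
    using norm_bounded[of "J f" n] by (simp add: J_apply[OF f])
  show "f x \<le> norm (J f)" by (rule le_of_dense[OF f _ x]) (use b abs_le_D1 in blast)
  have "- 1 * f x \<le> norm (J f)"
    by (rule le_of_dense[OF CT_scale[OF f] _ x]) (use b abs_le_D2 in fastforce)
  then show "- f x \<le> norm (J f)" by simp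
qed

lemma J_eq_iff: assumes "f \<in> CT" "k \<in> CT" shows "J f = J k \<longleftrightarrow> (\<forall>x\<in>topspace T. f x = k x)"
proof
  assume "J f = J k"
  then have "J (\<lambda>x. f x - k x) = 0" using J_diff[OF assms] by simp
  then show "\<forall>x\<in>topspace T. f x = k x"
    using abs_le_norm_J[OF CT_diff[OF assms]] by fastforce
next
  assume "\<forall>x\<in>topspace T. f x = k x"
  then show "J f = J k" by (intro bcontfun_eqI) (simp add: J_apply[OF assms(1)] J_apply[OF assms(2)] dense_seq(1))
qed

definition E :: "linf set" where "E = J ` CT"

lemma J_in_E: "f \<in> CT \<Longrightarrow> J f \<in> E" by (auto simp: E_def)

lemma E_cases: assumes "v \<in> E" obtains f where "f \<in> CT" "v = J f"
  using assms unfolding E_def by blast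

lemma subspace_E: "subspace E"
proof (rule subspaceI)
  have "J (\<lambda>x. 0 * 1) = 0 *\<^sub>R J (\<lambda>x. 1)" by (rule J_scale[OF CT_const])
  then show "0 \<in> E" using J_in_E[OF CT_const[of "0 * 1"]] by simp
  show "u + v \<in> E" if uv: "u \<in> E" "v \<in> E" for u v
  proof -
    obtain f where "f \<in> CT" "u = J f" using uv(1) by (rule E_cases)
    moreover obtain k where "k \<in> CT" "v = J k" using uv(2) by (rule E_cases)
    ultimately show ?thesis using J_add[of f k] J_in_E[OF CT_add[of f k]] by simp
  qed
  show "c *\<^sub>R v \<in> E" if v: "v \<in> E" for c v
  proof -
    obtain f where "f \<in> CT" "v = J f" using v by (rule E_cases)
    then show ?thesis using J_scale[of f c] J_in_E[OF CT_scale[of f c]] by simp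
  qed
qed

text \<open>By \<open>abs_le_norm_J\<close> a norm-convergent sequence of images comes from
  uniformly Cauchy functions, whose uniform limit is continuous.\<close>

lemma closed_E: "closed E"
  unfolding closed_sequential_limits
proof (intro allI impI, elim conjE)
  fix V v assume V: "\<forall>n. V n \<in> E" and lim: "V \<longlonglongrightarrow> v"
  have "\<forall>n. \<exists>f. f \<in> CT \<and> V n = J f" using V E_cases by metis
  then obtain f where f: "\<And>n. f n \<in> CT" "\<And>n. V n = J (f n)" by metis
  have diff: "\<bar>f m x - f n x\<bar> \<le> norm (V m - V n)" if "x \<in> topspace T" for m n x
    using abs_le_norm_J[OF CT_diff[OF f(1) f(1)] that, of m n] by (simp only: J_diff f)
  have "Cauchy V" using lim by (intro convergent_Cauchy convergentI)
  have "Cauchy (\<lambda>n. f n x)" if x: "x \<in> topspace T" for x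
  proof (rule metric_CauchyI)
    fix e :: real assume "e > 0"
    then obtain N where "\<And>m n. m \<ge> N \<Longrightarrow> n \<ge> N \<Longrightarrow> dist (V m) (V n) < e"
      using \<open>Cauchy V\<close> unfolding Cauchy_def by blast
    then show "\<exists>M. \<forall>m\<ge>M. \<forall>n\<ge>M. dist (f m x) (f n x) < e"
      using diff[OF x] unfolding dist_norm real_norm_def by (meson le_less_trans)
  qed
  then have "\<forall>x. \<exists>l. x \<in> topspace T \<longrightarrow> (\<lambda>n. f n x) \<longlonglongrightarrow> l"
    unfolding Cauchy_convergent_iff convergent_def by blast
  then obtain F where F: "\<And>x. x \<in> topspace T \<Longrightarrow> (\<lambda>n. f n x) \<longlonglongrightarrow> F x" by metis
  have close: "\<bar>f m x - F x\<bar> \<le> norm (V m - v)" if x: "x \<in> topspace T" for m x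
  proof (rule LIMSEQ_le)
    show "(\<lambda>n. \<bar>f m x - f n x\<bar>) \<longlonglongrightarrow> \<bar>f m x - F x\<bar>" by (intro tendsto_intros F x)
    show "(\<lambda>n. norm (V m - V n)) \<longlonglongrightarrow> norm (V m - v)" by (intro tendsto_intros lim)
    show "\<exists>N. \<forall>n\<ge>N. \<bar>f m x - f n x\<bar> \<le> norm (V m - V n)" using diff[OF x] by blast
  qed
  have "continuous_map T Met_TC.mtopology F"
  proof (rule Met_TC.continuous_map_uniform_limit[where f=f and F=sequentially])
    show "\<forall>\<^sub>F n in sequentially. continuous_map T Met_TC.mtopology (f n)"
      using f(1) by simp
    fix e :: real assume "e > 0"
    then have "\<forall>\<^sub>F n in sequentially. dist (V n) v < e" using lim by (simp add: tendsto_iff)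
    then show "\<forall>\<^sub>F n in sequentially. \<forall>x\<in>topspace T. F x \<in> UNIV \<and> dist (f n x) (F x) < e"
    proof eventually_elim
      case (elim n)
      then show ?case using close[of _ n] unfolding dist_norm real_norm_def by (meson UNIV_I le_less_trans)
    qed
  qed simp
  then have FC: "F \<in> CT" by simp
  have "v = J F"
  proof (rule bcontfun_eqI)
    fix n
    have "(\<lambda>k. apply_bcontfun (V k) n) \<longlonglongrightarrow> apply_bcontfun v n"
    proof (rule metric_LIMSEQ_I)
      fix e :: real assume "e > 0"
      then obtain N where "\<And>k. k \<ge> N \<Longrightarrow> dist (V k) v < e" using lim metric_LIMSEQ_D by blast
      then show "\<exists>N. \<forall>k\<ge>N. dist (apply_bcontfun (V k) n) (apply_bcontfun v n) < e"
        using dist_bounded le_less_trans by blast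
    qed
    moreover have "(\<lambda>k. apply_bcontfun (V k) n) \<longlonglongrightarrow> F (dense_seq n)"
      using F[OF dense_seq(1)] by (simp only: f(2) J_apply[OF f(1)])
    ultimately show "apply_bcontfun v n = apply_bcontfun (J F) n"
      unfolding J_apply[OF FC] by (rule LIMSEQ_unique)
  qed
  then show "v \<in> E" using J_in_E[OF FC] by simp
qed

text \<open>Rational combinations of partitions of unity subordinate to finite subcovers from a
  countable base are dense.\<close>
lemma separable_E: "separable_space (top_of_set E)"
proof -
  obtain \<B> where \<B>: "countable \<B>" "\<And>V. V \<in> \<B> \<Longrightarrow> openin T V"
      "\<And>U x. openin T U \<Longrightarrow> x \<in> U \<Longrightarrow> \<exists>V\<in>\<B>. x \<in> V \<and> V \<subseteq> U"
    using second_countable unfolding second_countable_def by metis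
  have "\<exists>h. h \<in> CT \<and> (\<forall>x\<in>topspace T. 0 \<le> h x \<and> (0 < h x \<longleftrightarrow> x \<in> V))" if V: "V \<in> \<B>" for V
  proof -
    have "closedin T (topspace T - V)" using \<B>(2)[OF V] by blast
    then obtain h :: "'a \<Rightarrow> real" where h: "continuous_map T euclideanreal h"
      "\<And>x. x \<in> topspace T \<Longrightarrow> 0 \<le> h x" "\<And>x. x \<in> topspace T \<Longrightarrow> h x = 0 \<longleftrightarrow> x \<in> topspace T - V"
      using closedin_zero_set[OF metrizable] by metis
    then show ?thesis by (intro exI[of _ h]) (auto simp: less_le)
  qed
  then obtain h where h: "\<And>V. V \<in> \<B> \<Longrightarrow> h V \<in> CT"
    "\<And>V x. V \<in> \<B> \<Longrightarrow> x \<in> topspace T \<Longrightarrow> 0 \<le> h V x \<and> (0 < h V x \<longleftrightarrow> x \<in> V)"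
    by metis
  define Fin where "Fin = {F. finite F \<and> F \<subseteq> \<B> \<and> topspace T \<subseteq> \<Union>F}"
  define S where "S F x = (\<Sum>V\<in>F. h V x)" for F x
  define comb where "comb F q x = (\<Sum>V\<in>F. q V * (h V x / S F x))" for F and q :: "'a set \<Rightarrow> real" and x
  have Spos: "0 < S F x" if F: "F \<in> Fin" and x: "x \<in> topspace T" for F x
  proof -
    obtain V where V: "V \<in> F" "x \<in> V" using F x by (auto simp: Fin_def)
    have "finite F" "F \<subseteq> \<B>" using F by (auto simp: Fin_def)
    then show ?thesis unfolding S_def using V h(2)[OF _ x]
      by (intro sum_pos2[of F V]) auto
  qed
  have comb_CT: "comb F q \<in> CT" if F: "F \<in> Fin" for F q
  proof -
    have "finite F" "F \<subseteq> \<B>" using F by (auto simp: Fin_def)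
    then have hc: "continuous_map T euclideanreal (h V)" if "V \<in> F" for V using h(1) that by blast
    have "continuous_map T euclideanreal (S F)"
      unfolding S_def using \<open>finite F\<close> hc by (intro continuous_map_sum) auto
    then have "continuous_map T euclideanreal (\<lambda>x. h V x / S F x)" if "V \<in> F" for V
      using hc[OF that] Spos[OF F] by (intro continuous_map_real_divide) force+
    then have "continuous_map T euclideanreal (comb F q)" unfolding comb_def using \<open>finite F\<close>
      by (intro continuous_map_sum continuous_map_real_mult_left) auto
    then show ?thesis by simp
  qed
  \<comment> \<open>\<open>PiE\<close> makes the coefficient functions extensional, so that each
    finite cover contributes only countably many rational ones.\<close>
  define D where "D = (\<Union>F\<in>Fin. (\<lambda>q. J (comb F q)) ` PiE F (\<lambda>_. \<rat>))"
  have "countable {F. finite F \<and> F \<subseteq> \<B>}" by (rule countable_Collect_finite_subset[OF \<B>(1)])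
  then have "countable Fin" by (rule countable_subset[rotated]) (auto simp: Fin_def)
  then have D: "countable D"
    unfolding D_def by (intro countable_UN countable_image countable_PiE) (auto simp: Fin_def countable_rat)
  have DE: "D \<subseteq> E" unfolding D_def using J_in_E[OF comb_CT] by auto
  have approx: "\<exists>d\<in>D. dist d v < e" if v: "v \<in> E" and e: "e > 0" for v e
  proof -
    obtain f where f: "f \<in> CT" "v = J f" using v by (rule E_cases)
    \<comment> \<open>On each of these base sets \<open>f\<close> stays close to one rational
      number, which becomes the coefficient of that set.\<close>
    define \<U> where "\<U> = {V \<in> \<B>. \<exists>q\<in>\<rat>. \<forall>y\<in>V. \<bar>f y - q\<bar> < e / 2}"
    have "topspace T \<subseteq> \<Union>\<U>"
    proof
      fix x assume x: "x \<in> topspace T"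
      obtain q where q: "q \<in> \<rat>" "f x < q" "q < f x + e / 2" using Rats_dense_in_real[of "f x" "f x + e / 2"] e by auto
      have "openin T {y \<in> topspace T. f y \<in> {q - e / 2 <..< q + e / 2}}"
        by (rule openin_continuous_map_preimage) (use f(1) in \<open>auto intro: open_openin[THEN iffD1]\<close>)
      moreover have "x \<in> {y \<in> topspace T. f y \<in> {q - e / 2 <..< q + e / 2}}" using x q e by auto
      ultimately obtain V where V: "V \<in> \<B>" "x \<in> V" "V \<subseteq> {y \<in> topspace T. f y \<in> {q - e / 2 <..< q + e / 2}}"
        using \<B>(3) by meson
      have "\<bar>f y - q\<bar> < e / 2" if "y \<in> V" for y
      proof -
        have "q - e / 2 < f y" "f y < q + e / 2" using subsetD[OF V(3) that] by auto
        then show ?thesis by linarith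
      qed
      then have "V \<in> \<U>" unfolding \<U>_def using V(1) q(1) by blast
      then show "x \<in> \<Union>\<U>" using V(2) by blast
    qed
    then have "\<exists>F. finite F \<and> F \<subseteq> \<U> \<and> topspace T \<subseteq> \<Union>F"
      using \<B>(2) by (intro compactinD[OF compact[unfolded compact_space_def]]) (auto simp: \<U>_def)
    then obtain F where F: "finite F" "F \<subseteq> \<U>" "topspace T \<subseteq> \<Union>F" by (elim exE conjE) (rule that)
    then have Fin: "F \<in> Fin" by (auto simp: Fin_def \<U>_def)
    have "\<forall>V\<in>F. \<exists>q\<in>\<rat>. \<forall>y\<in>V. \<bar>f y - q\<bar> < e / 2" using F(2) by (auto simp: \<U>_def)
    then obtain q where q: "\<And>V. V \<in> F \<Longrightarrow> q V \<in> \<rat>" "\<And>V y. V \<in> F \<Longrightarrow> y \<in> V \<Longrightarrow> \<bar>f y - q V\<bar> < e / 2"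
      by metis
    define q' where "q' = restrict q F"
    have cq: "comb F q' x = comb F q x" for x unfolding comb_def q'_def by (intro sum.cong) auto
    have "\<bar>comb F q' x - f x\<bar> \<le> e / 2" if x: "x \<in> topspace T" for x
    proof -
      have FB: "F \<subseteq> \<B>" using Fin by (auto simp: Fin_def)
      define \<phi> where "\<phi> V = h V x / S F x" for V
      have \<phi>: "0 \<le> \<phi> V" if "V \<in> F" for V
        unfolding \<phi>_def using h(2)[OF _ x, of V] that FB Spos[OF Fin x] by auto
      have sum\<phi>: "(\<Sum>V\<in>F. \<phi> V) = 1"
        unfolding \<phi>_def sum_divide_distrib[symmetric] S_def[symmetric] using Spos[OF Fin x] by simp
      have "comb F q' x - f x = (\<Sum>V\<in>F. q V * \<phi> V) - f x * (\<Sum>V\<in>F. \<phi> V)"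
        unfolding cq unfolding comb_def \<phi>_def[symmetric] sum\<phi> by simp
      also have "\<dots> = (\<Sum>V\<in>F. (q V - f x) * \<phi> V)"
        by (simp add: sum_distrib_left sum_subtractf[symmetric] algebra_simps)
      finally have "\<bar>comb F q' x - f x\<bar> \<le> (\<Sum>V\<in>F. \<bar>(q V - f x) * \<phi> V\<bar>)"
        by (simp only: sum_abs)
      also have "\<dots> \<le> (\<Sum>V\<in>F. e / 2 * \<phi> V)"
      proof (rule sum_mono)
        fix V assume V: "V \<in> F"
        show "\<bar>(q V - f x) * \<phi> V\<bar> \<le> e / 2 * \<phi> V"
        proof (cases "x \<in> V")
          case True
          then have "\<bar>q V - f x\<bar> \<le> e / 2" using q(2)[OF V True] by linarith
          then show ?thesis
            unfolding abs_mult abs_of_nonneg[OF \<phi>[OF V]] by (rule mult_right_mono[OF _ \<phi>[OF V]])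
        next
          case False
          then have "h V x = 0" using h(2)[OF _ x, of V] V FB by (auto simp: less_le)
          then show ?thesis by (simp add: \<phi>_def)
        qed
      qed
      also have "\<dots> = e / 2" unfolding sum_distrib_left[symmetric] sum\<phi> by simp
      finally show ?thesis .
    qed
    then have "norm (J (\<lambda>x. comb F q' x - f x)) \<le> e / 2"
      by (intro norm_J_le CT_diff f comb_CT Fin)
    then have "dist (J (comb F q')) v < e"
      unfolding dist_norm f(2) J_diff[OF comb_CT[OF Fin] f(1)] using e by linarith
    moreover have "J (comb F q') \<in> D"
      unfolding D_def using Fin q(1) by (auto intro!: bexI[of _ F] imageI simp: q'_def)
    ultimately show ?thesis by blast
  qed
  show ?thesis
    unfolding separable_space_def
  proof (intro exI[of _ D] conjI)
    show "(top_of_set E) closure_of D = topspace (top_of_set E)"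
    proof
      show "topspace (top_of_set E) \<subseteq> (top_of_set E) closure_of D"
      proof
        fix v assume "v \<in> topspace (top_of_set E)"
        then have v: "v \<in> E" by simp
        have "\<exists>y. y \<in> D \<and> y \<in> U" if U: "v \<in> U" "openin (top_of_set E) U" for U
        proof -
          obtain e where "e > 0" "\<forall>x'\<in>E. dist x' v < e \<longrightarrow> x' \<in> U"
            using U unfolding openin_euclidean_subtopology_iff by blast
          then show ?thesis using approx[OF v, of e] DE by blast
        qed
        then show "v \<in> (top_of_set E) closure_of D" using v by (simp add: in_closure_of)
      qed
    qed (rule closure_of_subset_topspace)
  qed (use D DE in auto)
qed

lemma separable_banach_E: "separable_banach E"
  unfolding separable_banach_def using subspace_E closed_E separable_E by simp

section \<open>The isometric representation on continuous functions\<close>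

text \<open>A vector of \<open>E\<close> determines its function only on \<open>topspace T\<close>,
  so a representative is chosen; \<open>\<alpha>_J\<close> shows that the choice is immaterial. The
  inverse of \<open>g\<close> in the argument makes this a left action.\<close>

definition \<alpha> :: "'g \<Rightarrow> linf \<Rightarrow> linf" where
  "\<alpha> g = (\<lambda>v\<in>E. J (\<lambda>x. (SOME f. f \<in> CT \<and> v = J f) (act (- g) x)))"

lemma \<alpha>_extensional: "\<alpha> g \<in> extensional E"
  unfolding \<alpha>_def by (rule restrict_extensional)

lemma \<alpha>_J: assumes f: "f \<in> CT" shows "\<alpha> g (J f) = J (\<lambda>x. f (act (- g) x))"
proof -
  define k where "k = (SOME k. k \<in> CT \<and> J f = J k)"
  have "k \<in> CT \<and> J f = J k" unfolding k_def by (rule someI[of _ f]) (use f in simp)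
  then have k: "k \<in> CT" "\<forall>x\<in>topspace T. f x = k x" using J_eq_iff[OF f] by auto
  have "\<alpha> g (J f) = J (\<lambda>x. k (act (- g) x))" unfolding \<alpha>_def k_def using J_in_E[OF f] by simp
  also have "\<dots> = J (\<lambda>x. f (act (- g) x))"
    unfolding J_eq_iff[OF CT_act[OF k(1)] CT_act[OF f]] using k(2) act_space by simp
  finally show ?thesis .
qed

lemma \<alpha>_E: "v \<in> E \<Longrightarrow> \<alpha> g v \<in> E"
  by (elim E_cases) (simp only: \<alpha>_J J_in_E CT_act)

lemma \<alpha>_add: assumes "v \<in> E" shows "\<alpha> (g + h) v = \<alpha> g (\<alpha> h v)"
proof -
  obtain f where f: "f \<in> CT" "v = J f" using assms by (rule E_cases)
  have "\<alpha> g (\<alpha> h v) = J (\<lambda>x. f (act (- h) (act (- g) x)))"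
    unfolding f(2) \<alpha>_J[OF f(1)] by (rule \<alpha>_J[OF CT_act[OF f(1)]])
  also have "\<dots> = J (\<lambda>x. f (act (- (g + h)) x))"
    unfolding J_eq_iff[OF CT_act[OF CT_act[OF f(1)]] CT_act[OF f(1)]]
    using act_add[of _ "- h" "- g"] by (simp add: minus_add)
  finally show ?thesis by (simp only: f(2) \<alpha>_J[OF f(1)])
qed

lemma \<alpha>_0: assumes "v \<in> E" shows "\<alpha> 0 v = v"
proof -
  obtain f where f: "f \<in> CT" "v = J f" using assms by (rule E_cases)
  have "J (\<lambda>x. f (act (- 0) x)) = J f"
    unfolding J_eq_iff[OF CT_act[OF f(1)] f(1)] by (simp add: act_0)
  then show ?thesis by (simp only: f(2) \<alpha>_J[OF f(1)])
qed

lemma \<alpha>_uminus: "v \<in> E \<Longrightarrow> \<alpha> (- g) (\<alpha> g v) = v" "v \<in> E \<Longrightarrow> \<alpha> g (\<alpha> (- g) v) = v"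
  using \<alpha>_add[of v "- g" g] \<alpha>_add[of v g "- g"] by (simp_all add: \<alpha>_0)

lemma \<alpha>_linear: "linear_on_subspace E (\<alpha> g)"
  unfolding linear_on_subspace_def
proof (intro conjI ballI allI)
  fix u v assume uv: "u \<in> E" "v \<in> E"
  obtain f where f: "f \<in> CT" "u = J f" using uv(1) by (rule E_cases)
  obtain k where k: "k \<in> CT" "v = J k" using uv(2) by (rule E_cases)
  note fk = f k
  show "\<alpha> g (u + v) = \<alpha> g u + \<alpha> g v"
    unfolding fk(2,4) J_add[OF fk(1,3), symmetric] \<alpha>_J[OF fk(1)] \<alpha>_J[OF fk(3)] \<alpha>_J[OF CT_add[OF fk(1,3)]]
    by (rule J_add[OF CT_act[OF fk(1)] CT_act[OF fk(3)]])
next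
  fix c v assume "v \<in> E"
  then obtain f where f: "f \<in> CT" "v = J f" by (rule E_cases)
  show "\<alpha> g (c *\<^sub>R v) = c *\<^sub>R \<alpha> g v"
    unfolding f(2) J_scale[OF f(1), symmetric] \<alpha>_J[OF f(1)] \<alpha>_J[OF CT_scale[OF f(1)]]
    by (rule J_scale[OF CT_act[OF f(1)]])
qed

lemma \<alpha>_norm: assumes v: "v \<in> E" shows "norm (\<alpha> g v) = norm v"
proof -
  have le: "norm (\<alpha> g v) \<le> norm v" if v: "v \<in> E" for g v
  proof -
    obtain f where f: "f \<in> CT" "v = J f" using v by (rule E_cases)
    show ?thesis unfolding f(2) \<alpha>_J[OF f(1)]
      by (rule norm_J_le[OF CT_act[OF f(1)]]) (rule abs_le_norm_J[OF f(1) act_space])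
  qed
  show ?thesis using le[OF v, of g] le[OF \<alpha>_E[OF v], of "- g" g] by (simp add: \<alpha>_uminus[OF v])
qed

lemma \<alpha>_bij: "bij_betw (\<alpha> g) E E"
  by (rule bij_betw_byWitness[where f'="\<alpha> (- g)"]) (auto simp: \<alpha>_uminus \<alpha>_E)

lemma \<alpha>_isometry: "\<alpha> g \<in> isometries E"
  unfolding isometries_def using \<alpha>_extensional \<alpha>_bij \<alpha>_linear \<alpha>_norm by simp

lemma \<alpha>_inv: "v \<in> E \<Longrightarrow> inv_into E (\<alpha> g) v = \<alpha> (- g) v"
  using \<alpha>_bij[of g] by (intro inv_into_f_eq) (auto simp: bij_betw_def \<alpha>_E \<alpha>_uminus)

text \<open>By the tube lemma, a neighbourhood of \<open>{g} \<times> topspace T\<close> on which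
  the difference of the translates is small contains a product neighbourhood. Compactness thus makes
  the estimate uniform in the point.\<close>

lemma \<alpha>_continuous: assumes "v \<in> E" shows "continuous_on UNIV (\<lambda>g. \<alpha> g v)"
proof -
  obtain f where f: "f \<in> CT" "v = J f" using assms by (rule E_cases)
  have ex: "\<exists>U. open U \<and> g \<in> U \<and> (\<forall>h\<in>U. dist (\<alpha> h v) (\<alpha> g v) < e)" if e: "e > 0" for g e
  proof -
    define k where "k = (\<lambda>p. f (act (- fst p) (snd p)) - f (act (- g) (snd p)))"
    have m: "continuous_map (prod_topology (euclidean :: 'g topology) T) (prod_topology euclidean T) (\<lambda>p. (- fst p, snd p))"
    proof (intro continuous_map_pairedI continuous_map_snd)
      have "continuous_map (prod_topology euclidean T) euclidean (uminus \<circ> (fst :: 'g \<times> 'a \<Rightarrow> 'g))"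
        by (rule continuous_map_compose[OF continuous_map_fst]) (simp add: continuous_on_minus continuous_on_id)
      then show "continuous_map (prod_topology euclidean T) euclidean (\<lambda>p. - fst p :: 'g)" by (simp add: o_def)
    qed
    have "continuous_map (prod_topology euclidean T) euclideanreal (\<lambda>p. f (act (- fst p) (snd p)))"
      using continuous_map_compose[OF continuous_map_compose[OF m cont], of euclideanreal f] f(1)
      by (simp add: o_def)
    moreover have "continuous_map (prod_topology (euclidean :: 'g topology) T) euclideanreal (\<lambda>p. f (act (- g) (snd p)))"
      using continuous_map_compose[OF continuous_map_snd, of T euclideanreal "\<lambda>x. f (act (- g) x)" "euclidean :: 'g topology"] CT_act[OF f(1), of "- g"]
      by (simp add: o_def)
    ultimately have kc: "continuous_map (prod_topology euclidean T) euclideanreal k"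
      unfolding k_def by (rule continuous_map_diff)
    define W where "W = {p \<in> topspace (prod_topology euclidean T). k p \<in> {- (e / 2) <..< e / 2}}"
    have W: "openin (prod_topology euclidean T) W"
      unfolding W_def by (rule openin_continuous_map_preimage[OF kc]) (rule open_openin[THEN iffD1, OF open_greaterThanLessThan])
    have "{g} \<times> topspace T \<subseteq> W" unfolding W_def k_def using e by auto
    moreover have "compactin euclidean {g}" by simp
    moreover have "compactin T (topspace T)" using compact by (simp add: compact_space_def)
    ultimately obtain U V where UV: "openin euclidean U" "openin T V" "{g} \<subseteq> U" "topspace T \<subseteq> V" "U \<times> V \<subseteq> W"
      using Wallace_theorem_prod_topology[OF _ _ W] by metis
    have "dist (\<alpha> h v) (\<alpha> g v) < e" if h: "h \<in> U" for h
    proof -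
      have "\<bar>f (act (- h) x) - f (act (- g) x)\<bar> \<le> e / 2" if x: "x \<in> topspace T" for x
      proof -
        have "(h, x) \<in> W" using UV h x by blast
        then have "- (e / 2) < k (h, x)" "k (h, x) < e / 2" by (auto simp: W_def)
        then show ?thesis unfolding k_def fst_conv snd_conv by linarith
      qed
      then have "norm (J (\<lambda>x. f (act (- h) x) - f (act (- g) x))) \<le> e / 2"
        by (intro norm_J_le CT_diff CT_act f)
      then show ?thesis
        unfolding dist_norm f(2) \<alpha>_J[OF f(1)] J_diff[OF CT_act[OF f(1)] CT_act[OF f(1)]] using e by linarith
    qed
    then show ?thesis using UV(1,3) open_openin[THEN iffD2, OF UV(1)] by blast
  qed
  show ?thesis
    unfolding continuous_on_def tendsto_iff
  proof (intro ballI allI impI)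
    fix g :: 'g and e :: real assume "e > 0"
    from ex[OF this, of g] obtain U where "open U" "g \<in> U" "\<forall>h\<in>U. dist (\<alpha> h v) (\<alpha> g v) < e" by (elim exE conjE)
    then show "\<forall>\<^sub>F h in at g. dist (\<alpha> h v) (\<alpha> g v) < e"
      unfolding eventually_at_topological by (intro exI[of _ U]) simp
  qed
qed

text \<open>A group representation is a cocycle that is constant in the point; its strong continuity
  yields measurability.\<close>

lemma \<alpha>_cocycle: "isometric_cocycle M actM E (\<lambda>g x. \<alpha> g)"
  unfolding isometric_cocycle_def
proof (intro conjI allI)
  have "continuous_map euclidean (product_topology (\<lambda>_. euclidean) E) \<alpha>"
    unfolding continuous_map_componentwise
  proof (intro conjI ballI)
    show "\<alpha> ` topspace euclidean \<subseteq> extensional E" using \<alpha>_extensional by blast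
    show "continuous_map euclidean euclidean (\<lambda>g. \<alpha> g v)" if "v \<in> E" for v
      using \<alpha>_continuous[OF that] by simp
  qed
  then have "continuous_map euclidean (strong_topology E) \<alpha>"
    unfolding strong_topology_def continuous_map_in_subtopology using \<alpha>_isometry by blast
  then have m: "\<alpha> \<in> borel \<rightarrow>\<^sub>M borel_of (strong_topology E)"
    unfolding measurable_cong_sets[OF sets_borel_of_euclidean[symmetric] refl]
    by (rule continuous_map_measurable_borel_of)
  show "(\<lambda>(g, x). \<alpha> g) \<in> borel \<Otimes>\<^sub>M M \<rightarrow>\<^sub>M borel_of (strong_topology E)"
    unfolding case_prod_beta' by (rule measurable_compose[OF measurable_fst m])
  fix g h
  have "\<alpha> (g + h) = compose E (\<alpha> g) (\<alpha> h)"
  proof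
    fix v
    show "\<alpha> (g + h) v = compose E (\<alpha> g) (\<alpha> h) v"
      by (cases "v \<in> E") (simp_all add: compose_def \<alpha>_add extensional_arb[OF \<alpha>_extensional])
  qed
  then show "AE x in M. \<alpha> (g + h) = compose E (\<alpha> g) (\<alpha> h)" by simp
qed

section \<open>States and their weak-* compactness\<close>

text \<open>Norm at most 1 together with value 1 at the constant 1 forces positivity, see
  \<open>state_functional\<close>; these functionals correspond to the probability measures on
  \<open>T\<close>.\<close>

definition states :: "(linf \<Rightarrow> real) set" where
  "states = {\<xi> \<in> dual_ball E. \<xi> (J (\<lambda>_. 1)) = 1}"

text \<open>The witness is evaluation at the first point of the dense sequence.\<close>

lemma states_nonempty: "(\<lambda>v\<in>E. apply_bcontfun v 0) \<in> states"
proof -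
  have nb: "\<bar>apply_bcontfun v 0\<bar> \<le> norm v" for v :: linf
    using norm_bounded[of v 0] by simp
  show ?thesis
  unfolding states_def dual_ball_def linear_on_subspace_def
    using J_in_E[OF CT_const[of 1]] subspace_add[OF subspace_E] subspace_scale[OF subspace_E]
    by (auto simp: J_apply plus_bcontfun.rep_eq scaleR_bcontfun.rep_eq nb)
qed

lemma closedin_states: "closedin (dual_ball_topology E) states"
proof -
  have "closedin (product_topology (\<lambda>_. euclideanreal) E)
      {\<xi> \<in> topspace (product_topology (\<lambda>_. euclideanreal) E). \<xi> (J (\<lambda>_. 1)) \<in> {1}}"
    by (rule closedin_continuous_map_preimage[OF continuous_map_product_projection]) (auto intro: J_in_E)
  moreover have "states = {\<xi> \<in> topspace (product_topology (\<lambda>_. euclideanreal) E). \<xi> (J (\<lambda>_. 1)) \<in> {1}} \<inter> dual_ball E"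
    unfolding states_def dual_ball_def by (auto simp: PiE_def)
  ultimately show ?thesis unfolding dual_ball_topology_def closedin_subtopology by blast
qed

text \<open>The Banach-Alaoglu argument: linearity cuts a closed set out of the product of the
  intervals from \<open>- norm v\<close> to \<open>norm v\<close>, which is compact by Tychonoff's
  theorem.\<close>

lemma compactin_dual_ball: "compactin (product_topology (\<lambda>_. euclideanreal) E) (dual_ball E)"
proof -
  let ?P = "product_topology (\<lambda>_. euclideanreal) E"
  have top: "topspace ?P = extensional E" by (auto simp: PiE_def)
  have c: "compactin ?P (PiE E (\<lambda>v. {- norm v..norm v}))"
    by (simp add: compactin_PiE)
  define C1 where "C1 u v = {\<xi> \<in> topspace ?P. \<xi> (u + v) - (\<xi> u + \<xi> v) \<in> {0}}" for u v
  define C2 where "C2 c v = {\<xi> \<in> topspace ?P. \<xi> (c *\<^sub>R v) - c * \<xi> v \<in> {0}}" for c v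
  have C1: "closedin ?P (C1 u v)" if "u \<in> E" "v \<in> E" for u v
    unfolding C1_def using that subspace_add[OF subspace_E that]
    by (intro closedin_continuous_map_preimage[where Y=euclideanreal] continuous_map_diff continuous_map_add continuous_map_product_projection) auto
  have C2: "closedin ?P (C2 c v)" if "v \<in> E" for c v
    unfolding C2_def using that subspace_scale[OF subspace_E that]
    by (intro closedin_continuous_map_preimage[where Y=euclideanreal] continuous_map_diff continuous_map_real_mult_left continuous_map_product_projection) auto
  define K where "K = (\<lambda>(u, v). C1 u v) ` (E \<times> E) \<union> (\<lambda>(c, v). C2 c v) ` (UNIV \<times> E)"
  have "closedin ?P (\<Inter>K)"
    by (rule closedin_Inter) (use J_in_E[OF CT_const[of 1]] C1 C2 in \<open>auto simp: K_def\<close>)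
  moreover have "dual_ball E = PiE E (\<lambda>v. {- norm v..norm v}) \<inter> \<Inter>K"
  proof (intro set_eqI iffI)
    fix \<xi> assume \<xi>: "\<xi> \<in> dual_ball E"
    have "\<xi> v \<in> {- norm v..norm v}" if "v \<in> E" for v
    proof -
      have "\<bar>\<xi> v\<bar> \<le> norm v" using \<xi> that by (simp add: dual_ball_def)
      then show ?thesis by (auto simp: abs_le_iff)
    qed
    then show "\<xi> \<in> PiE E (\<lambda>v. {- norm v..norm v}) \<inter> \<Inter>K"
      using \<xi> by (auto simp: dual_ball_def linear_on_subspace_def K_def C1_def C2_def PiE_def)
  next
    fix \<xi> assume \<xi>: "\<xi> \<in> PiE E (\<lambda>v. {- norm v..norm v}) \<inter> \<Inter>K"
    have "\<bar>\<xi> v\<bar> \<le> norm v" if "v \<in> E" for v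
    proof -
      have "\<xi> v \<in> {- norm v..norm v}" using \<xi> that by auto
      then show ?thesis by (auto simp: abs_le_iff)
    qed
    moreover have "\<xi> (u + v) = \<xi> u + \<xi> v" if "u \<in> E" "v \<in> E" for u v
    proof -
      have "\<xi> \<in> C1 u v" using \<xi> that unfolding K_def by blast
      then show ?thesis by (simp add: C1_def)
    qed
    moreover have "\<xi> (c *\<^sub>R v) = c * \<xi> v" if "v \<in> E" for c v
    proof -
      have "\<xi> \<in> C2 c v" using \<xi> that unfolding K_def by blast
      then show ?thesis by (simp add: C2_def)
    qed
    moreover have "\<xi> \<in> extensional E" using \<xi> by (auto simp: PiE_def)
    ultimately show "\<xi> \<in> dual_ball E" by (simp add: dual_ball_def linear_on_subspace_def)
  qed
  ultimately show ?thesis using compact_Int_closedin[OF c] by simp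
qed

lemma compactin_states: "compactin (dual_ball_topology E) states"
proof -
  have "compactin (dual_ball_topology E) (dual_ball E)"
    unfolding dual_ball_topology_def compactin_subtopology using compactin_dual_ball by simp
  from compact_Int_closedin[OF this closedin_states] show ?thesis
    by (simp add: Int_absorb1 states_def)
qed

lemma dual_\<alpha>: "dual_isometry E (\<alpha> g) \<xi> = (\<lambda>v\<in>E. \<xi> (\<alpha> (- g) v))"
  unfolding dual_isometry_def by (rule ext) (simp add: restrict_def \<alpha>_inv)

lemma dual_\<alpha>_states: assumes "\<xi> \<in> states" shows "dual_isometry E (\<alpha> g) \<xi> \<in> states"
proof -
  have one: "\<alpha> (- g) (J (\<lambda>_. 1)) = J (\<lambda>_. 1)" by (simp only: \<alpha>_J[OF CT_const])
  have lin: "\<alpha> (- g) (u + v) = \<alpha> (- g) u + \<alpha> (- g) v" "\<alpha> (- g) (c *\<^sub>R v) = c *\<^sub>R \<alpha> (- g) v"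
    if "u \<in> E" "v \<in> E" for u v c
    using \<alpha>_linear[of "- g"] that by (auto simp: linear_on_subspace_def)
  have \<xi>: "\<xi> (u + v) = \<xi> u + \<xi> v" "\<xi> (c *\<^sub>R v) = c * \<xi> v" "\<bar>\<xi> v\<bar> \<le> norm v"
    if "u \<in> E" "v \<in> E" for u v c
    using assms that by (auto simp: states_def dual_ball_def linear_on_subspace_def)
  have 1: "\<xi> (J (\<lambda>_. 1)) = 1" using assms by (simp add: states_def)
  have "\<bar>\<xi> (\<alpha> (- g) v)\<bar> \<le> norm v" if "v \<in> E" for v
    using \<xi>(3)[OF \<alpha>_E[OF that] \<alpha>_E[OF that], of "- g"] by (simp only: \<alpha>_norm[OF that])
  then show ?thesis
    unfolding dual_\<alpha> states_def dual_ball_def linear_on_subspace_def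
    using J_in_E[OF CT_const[of 1]] subspace_add[OF subspace_E] subspace_scale[OF subspace_E]
    by (simp add: lin \<xi> \<alpha>_E one 1)
qed

lemma affine_field_states: "affine_field M actM E (\<lambda>g x. \<alpha> g) (\<lambda>_. states)"
  unfolding affine_field_def
proof (intro conjI ballI allI)
  show "states \<noteq> {}" using states_nonempty by auto
  show "compactin (dual_ball_topology E) states" by (rule compactin_states)
  show "(\<lambda>v\<in>E. (1 - t) * \<xi> v + t * \<eta> v) \<in> states"
    if \<xi>: "\<xi> \<in> states" and \<eta>: "\<eta> \<in> states" and t: "t \<in> {0..1}" for \<xi> \<eta> t
  proof -
    have "\<bar>(1 - t) * \<xi> v + t * \<eta> v\<bar> \<le> norm v" if "v \<in> E" for v
    proof -
      have "\<bar>\<xi> v\<bar> \<le> norm v" "\<bar>\<eta> v\<bar> \<le> norm v" using \<xi> \<eta> that by (auto simp: states_def dual_ball_def)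
      then have "(1 - t) * \<bar>\<xi> v\<bar> + t * \<bar>\<eta> v\<bar> \<le> (1 - t) * norm v + t * norm v"
        using t by (intro add_mono mult_left_mono) auto
      moreover have "\<bar>(1 - t) * \<xi> v + t * \<eta> v\<bar> \<le> (1 - t) * \<bar>\<xi> v\<bar> + t * \<bar>\<eta> v\<bar>"
        using t abs_triangle_ineq[of "(1 - t) * \<xi> v" "t * \<eta> v"] by (simp add: abs_mult)
      ultimately show ?thesis by (simp add: algebra_simps)
    qed
    then show ?thesis
      using \<xi> \<eta> J_in_E[OF CT_const[of 1]] subspace_add[OF subspace_E] subspace_scale[OF subspace_E]
      unfolding states_def dual_ball_def linear_on_subspace_def by (simp add: algebra_simps)
  qed
  have "states \<in> sets (borel_of (dual_ball_topology E))" by (rule borel_of_closedin[OF closedin_states])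
  then show "(SIGMA x:space M. states) \<in> sets (M \<Otimes>\<^sub>M borel_of (dual_ball_topology E))"
    by (intro pair_measureI) auto
  fix g
  have "dual_isometry E (\<alpha> g) ` states = states"
  proof
    show "dual_isometry E (\<alpha> g) ` states \<subseteq> states" using dual_\<alpha>_states by blast
    show "states \<subseteq> dual_isometry E (\<alpha> g) ` states"
    proof
      fix \<xi> assume \<xi>: "\<xi> \<in> states"
      have ext: "\<xi> \<in> extensional E" using \<xi> by (simp add: states_def dual_ball_def)
      have "\<xi> = dual_isometry E (\<alpha> g) (dual_isometry E (\<alpha> (- g)) \<xi>)"
      proof
        fix v
        show "\<xi> v = dual_isometry E (\<alpha> g) (dual_isometry E (\<alpha> (- g)) \<xi>) v"
          unfolding dual_\<alpha> using extensional_arb[OF ext, of v]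
          by (cases "v \<in> E") (simp_all add: \<alpha>_E \<alpha>_uminus)
      qed
      then show "\<xi> \<in> dual_isometry E (\<alpha> g) ` states" using dual_\<alpha>_states[OF \<xi>, of "- g"] by blast
    qed
  qed
  then show "AE x in M. dual_isometry E (\<alpha> g) ` states = states" by simp
qed

text \<open>For positivity, a function between 0 and \<open>c\<close> is within \<open>c / 2\<close>
  of the constant \<open>c / 2\<close>. The norm bound and normalisation give the same for the
  values, so the value of \<open>f\<close> is nonnegative.\<close>

lemma state_functional:
  assumes \<xi>: "\<xi> \<in> states" shows "positive_functional T (\<lambda>f. \<xi> (J f))"
proof
  have lin: "\<xi> (u + v) = \<xi> u + \<xi> v" "\<xi> (c *\<^sub>R v) = c * \<xi> v" "\<bar>\<xi> v\<bar> \<le> norm v" if "u \<in> E" "v \<in> E" for u v c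
    using \<xi> that by (auto simp: states_def dual_ball_def linear_on_subspace_def)
  have one: "\<xi> (J (\<lambda>_. 1)) = 1" using \<xi> by (simp add: states_def)
  show add: "\<xi> (J (\<lambda>x. f x + k x)) = \<xi> (J f) + \<xi> (J k)"
    if "continuous_map T euclideanreal f" "continuous_map T euclideanreal k" for f k
    using that lin(1)[of "J f" "J k"] J_add[of f k] J_in_E[of f] J_in_E[of k] by simp
  show scale: "\<xi> (J (\<lambda>x. c * f x)) = c * \<xi> (J f)" if "continuous_map T euclideanreal f" for f c
    using that lin(2)[of "J f" "J f" c] J_scale[of f c] J_in_E[of f] by simp
  show "0 \<le> \<xi> (J f)" if f: "continuous_map T euclideanreal f" and nn: "\<And>x. x \<in> topspace T \<Longrightarrow> 0 \<le> f x" for f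
  proof -
    define c where "c = norm (J f)"
    have fC: "f \<in> CT" using f by simp
    have cf: "(\<lambda>x. c / 2 + (-1) * f x) \<in> CT" by (intro CT_add CT_const CT_scale fC)
    have "norm (J (\<lambda>x. c / 2 + (-1) * f x)) \<le> c / 2"
    proof (rule norm_J_le[OF cf])
      fix x assume x: "x \<in> topspace T"
      then show "\<bar>c / 2 + (-1) * f x\<bar> \<le> c / 2"
        using nn[OF x] abs_le_norm_J[OF fC x] unfolding c_def by linarith
    qed
    moreover have "\<xi> (J (\<lambda>x. c / 2 + (-1) * f x)) = c / 2 - \<xi> (J f)"
    proof -
      have "\<xi> (J (\<lambda>x. c / 2 + (-1) * f x)) = \<xi> (J (\<lambda>x. c / 2 * 1)) + \<xi> (J (\<lambda>x. (-1) * f x))"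
        using add[of "\<lambda>x. c / 2 * 1" "\<lambda>x. (-1) * f x"] CT_const[of "c / 2"] CT_scale[OF fC, of "-1"] by simp
      also have "\<dots> = c / 2 * 1 + (-1) * \<xi> (J f)"
        unfolding scale[OF f] using scale[of "\<lambda>_. 1" "c / 2"] CT_const[of 1] one by simp
      finally show ?thesis by simp
    qed
    ultimately have "\<bar>c / 2 - \<xi> (J f)\<bar> \<le> c / 2"
      using lin(3)[OF J_in_E[OF cf] J_in_E[OF cf]] by simp
    then show ?thesis by linarith
  qed
  show "\<xi> (J (\<lambda>_. 1)) = 1" by (rule one)
qed (rule compact, rule metrizable)

end

section \<open>Existence of the coupling\<close>

context compact_flow
begin

text \<open>The representation gives the constant field of states, so amenability yields an
  invariant section, which the Riesz theorem converts into measures. Measurability and equivariance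
  are both checked on continuous functions, that is, on coordinates of the section.\<close>

lemma equivariant_kernel:
  fixes Y :: "'y measure" and actY :: "'g \<Rightarrow> 'y \<Rightarrow> 'y"
  assumes ns: "nonsingular_space Y actY" and amenable: "zimmer_amenable Y actY"
  obtains \<kappa> where "\<kappa> \<in> Y \<rightarrow>\<^sub>M subprob_algebra (borel_of T)"
    "\<And>y. prob_space (\<kappa> y)" "\<And>y. sets (\<kappa> y) = sets (borel_of T)"
    "\<And>g. AE y in Y. \<kappa> (actY g y) = distr (\<kappa> y) (borel_of T) (act g)"
proof -
  interpret Y: nonsingular_action Y actY by unfold_locales (rule ns)
  obtain \<phi> where \<phi>: "invariant_section Y actY E (\<lambda>g x. \<alpha> g) (\<lambda>_. states) \<phi>"
    using amenable separable_banach_E \<alpha>_cocycle affine_field_states unfolding zimmer_amenable_def by blast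
  then have \<phi>m: "\<phi> \<in> Y \<rightarrow>\<^sub>M borel_of (dual_ball_topology E)" and \<phi>s: "AE y in Y. \<phi> y \<in> states"
    and \<phi>g: "\<And>g. AE y in Y. dual_isometry E (\<alpha> g) (\<phi> y) = \<phi> (actY g y)"
    unfolding invariant_section_def by blast+
  obtain \<xi>0 where \<xi>0: "\<xi>0 \<in> states" using states_nonempty by blast
  \<comment> \<open>The section takes values in states only almost everywhere; a fixed state off
    that set makes every \<open>\<kappa> y\<close> a probability measure.\<close>
  define \<phi>' where "\<phi>' y = (if \<phi> y \<in> states then \<phi> y else \<xi>0)" for y
  have \<phi>': "\<phi>' y \<in> states" for y using \<xi>0 by (simp add: \<phi>'_def)
  have pf: "positive_functional T (\<lambda>f. \<phi>' y (J f))" for y by (rule state_functional[OF \<phi>'])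
  define \<kappa> where "\<kappa> y = positive_functional.riesz_measure T (\<lambda>f. \<phi>' y (J f))" for y
  have prob: "prob_space (\<kappa> y)" for y unfolding \<kappa>_def by (rule positive_functional.prob_space_riesz_measure[OF pf])
  have sets: "sets (\<kappa> y) = sets (borel_of T)" for y unfolding \<kappa>_def by (rule positive_functional.sets_riesz_measure[OF pf])
  have int: "(\<integral>x. f x \<partial>\<kappa> y) = \<phi>' y (J f)" if "continuous_map T euclideanreal f" for f y
    unfolding \<kappa>_def by (rule positive_functional.integral_riesz_measure[OF pf that])
  have m: "(\<lambda>y. \<phi>' y v) \<in> borel_measurable Y" if v: "v \<in> E" for v
  proof -
    have "continuous_map (dual_ball_topology E) euclideanreal (\<lambda>\<xi>. \<xi> v)"
      unfolding dual_ball_topology_def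
      by (rule continuous_map_from_subtopology[OF continuous_map_product_projection[OF v]])
    then have "(\<lambda>y. \<phi> y v) \<in> borel_measurable Y"
      by (rule measurable_compose[OF \<phi>m continuous_map_borel_measurable])
    moreover have "{y \<in> space Y. \<phi> y \<in> states} \<in> sets Y"
      using measurable_sets[OF \<phi>m borel_of_closedin[OF closedin_states]]
      by (simp add: vimage_def Int_def conj_commute)
    ultimately have "(\<lambda>y. if \<phi> y \<in> states then \<phi> y v else \<xi>0 v) \<in> borel_measurable Y"
      by (intro measurable_If) simp_all
    moreover have "(\<lambda>y. \<phi>' y v) = (\<lambda>y. if \<phi> y \<in> states then \<phi> y v else \<xi>0 v)"
      by (simp add: \<phi>'_def fun_eq_iff)
    ultimately show ?thesis by simp
  qed
  have \<kappa>m: "\<kappa> \<in> Y \<rightarrow>\<^sub>M subprob_algebra (borel_of T)"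
  proof (rule measurable_subprob_algebra_generated[where \<Omega>="topspace T" and G="{C. closedin T C}"])
    show "sets (borel_of T) = sigma_sets (topspace T) {C. closedin T C}" by (rule sets_borel_of_closedin)
    show "subprob_space (\<kappa> y)" for y using prob by (rule prob_space_imp_subprob_space)
    have C: "(\<lambda>y. emeasure (\<kappa> y) C) \<in> borel_measurable Y" if C: "closedin T C" for C
    proof -
      obtain f :: "nat \<Rightarrow> 'a \<Rightarrow> real" where f: "\<And>n. continuous_map T euclideanreal (f n)"
        "\<And>n x. 0 \<le> f n x \<and> f n x \<le> 1" "\<And>x. x \<in> topspace T \<Longrightarrow> (\<lambda>n. f n x) \<longlonglongrightarrow> indicator C x"
        using closedin_indicator_limit[OF metrizable C] by metis
      have "(\<lambda>y. measure (\<kappa> y) C) \<in> borel_measurable Y"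
      proof (rule borel_measurable_LIMSEQ_metric)
        show "(\<lambda>y. \<phi>' y (J (f n))) \<in> borel_measurable Y" for n
          by (rule m[OF J_in_E]) (use f(1) in simp)
        show "(\<lambda>n. \<phi>' y (J (f n))) \<longlonglongrightarrow> measure (\<kappa> y) C" for y
          using measure_closedin_limit[OF f C prob sets, of y] by (simp add: int[OF f(1)])
      qed
      then have "(\<lambda>y. ennreal (measure (\<kappa> y) C)) \<in> borel_measurable Y" by measurable
      moreover have "emeasure (\<kappa> y) C = ennreal (measure (\<kappa> y) C)" for y
        by (rule finite_measure.emeasure_eq_measure[OF prob_space.finite_measure[OF prob]])
      ultimately show ?thesis by simp
    qed
    then show "(\<lambda>y. emeasure (\<kappa> y) C) \<in> borel_measurable Y" if "C \<in> {C. closedin T C}" for C using that by blast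
    show "(\<lambda>y. emeasure (\<kappa> y) (topspace T)) \<in> borel_measurable Y" by (rule C[OF closedin_topspace])
    show "Int_stable {C. closedin T C}" by (auto simp: Int_stable_def)
    show "{C. closedin T C} \<subseteq> Pow (topspace T)" by (auto dest: closedin_subset)
  qed (rule sets)
  have am: "act g \<in> \<kappa> y \<rightarrow>\<^sub>M borel_of T" for g y
    unfolding measurable_cong_sets[OF sets refl]
    by (rule continuous_map_measurable_borel_of[OF act_continuous])
  have "AE y in Y. \<kappa> (actY g y) = distr (\<kappa> y) (borel_of T) (act g)" for g
    using \<phi>s Y.AE_act[OF \<phi>s, of g] \<phi>g[of g]
  proof eventually_elim
    case (elim y)
    show ?case
    proof (rule prob_measure_eqI_continuous[OF metrizable prob sets])
      show "prob_space (distr (\<kappa> y) (borel_of T) (act g))" by (rule prob_space.prob_space_distr[OF prob am])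
      show "sets (distr (\<kappa> y) (borel_of T) (act g)) = sets (borel_of T)" by simp
      fix f :: "'a \<Rightarrow> real" assume f: "continuous_map T euclideanreal f"
      then have fC: "f \<in> CT" by simp
      have fg: "continuous_map T euclideanreal (\<lambda>x. f (act g x))" using CT_act[OF fC] by simp
      have "(\<integral>x. f x \<partial>\<kappa> (actY g y)) = dual_isometry E (\<alpha> g) (\<phi> y) (J f)"
        using elim by (simp add: int[OF f] \<phi>'_def)
      also have "\<dots> = \<phi> y (\<alpha> (- g) (J f))" unfolding dual_\<alpha> by (simp only: restrict_apply' J_in_E[OF fC])
      also have "\<dots> = \<phi> y (J (\<lambda>x. f (act g x)))" by (simp only: \<alpha>_J[OF fC] minus_minus)
      also have "\<dots> = (\<integral>x. f (act g x) \<partial>\<kappa> y)" using elim(1) by (simp add: int[OF fg] \<phi>'_def)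
      also have "\<dots> = (\<integral>x. f x \<partial>distr (\<kappa> y) (borel_of T) (act g))"
        by (rule integral_distr[OF am continuous_map_borel_measurable[OF f], symmetric])
      finally show "(\<integral>x. f x \<partial>\<kappa> (actY g y)) = (\<integral>x. f x \<partial>distr (\<kappa> y) (borel_of T) (act g))" .
    qed
  qed
  then show ?thesis by (rule that[OF \<kappa>m prob sets])
qed

end

section \<open>The coupling from unique stationarity\<close>

theorem coupling_exists:
  fixes X :: "'x measure" and Y :: "'y measure"
    and \<mu> :: "'g::{topological_group_add, second_countable_topology} measure"
  assumes \<mu>: "prob_space \<mu>" "sets \<mu> = sets borel"
    and us: "unique_stationary \<mu> X actX"
    and st: "stationary_space \<mu> Y actY" and amenable: "zimmer_amenable Y actY"
  obtains Z where "coupling X actX Y actY Z"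
proof -
  interpret \<mu>: prob_space \<mu> by fact
  have nsX: "nonsingular_space X actX" using us by (simp add: unique_stationary_def stationary_space_def)
  have nsY: "nonsingular_space Y actY" and stY: "stationary \<mu> Y actY" using st by (simp_all add: stationary_space_def)
  interpret X: nonsingular_action X actX by unfold_locales (rule nsX)
  interpret Y: nonsingular_action Y actY by unfold_locales (rule nsY)
  obtain T N act where cm: "compact_model X actX T N act"
    and uniq: "\<And>N'. prob_space N' \<Longrightarrow> sets N' = sets (borel_of T) \<Longrightarrow> stationary \<mu> N' act \<Longrightarrow> N' = N"
    using us unfolding unique_stationary_def by metis
  have N: "prob_space N" "sets N = sets (borel_of T)" using cm by (simp_all add: compact_model_def)
  interpret N: prob_space N by fact
  have spN: "space N = topspace T" using sets_eq_imp_space_eq[OF N(2)] by simp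
  interpret compact_flow T act
    by unfold_locales (use cm N.not_empty spN in \<open>simp_all add: compact_model_def\<close>)
  obtain q where q: "factor_map N act X actX q"
    using cm unfolding compact_model_def isomorphic_spaces_def by blast
  have qm: "q \<in> borel_of T \<rightarrow>\<^sub>M X" and qd: "distr N X q = X"
    and qg: "\<And>g. AE x in N. q (act g x) = actX g (q x)"
    using q unfolding factor_map_def measurable_cong_sets[OF N(2) refl] by blast+
  obtain \<kappa> where \<kappa>m: "\<kappa> \<in> Y \<rightarrow>\<^sub>M subprob_algebra (borel_of T)"
    and prob: "\<And>y. prob_space (\<kappa> y)" and sets: "\<And>y. sets (\<kappa> y) = sets (borel_of T)"
    and equi: "\<And>g. AE y in Y. \<kappa> (actY g y) = distr (\<kappa> y) (borel_of T) (act g)"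
    by (rule equivariant_kernel[OF nsY amenable]) (rule that)
  have actm: "act g \<in> borel_of T \<rightarrow>\<^sub>M borel_of T" for g
    by (rule continuous_map_measurable_borel_of[OF act_continuous])
  have equi_nn: "AE y in Y. (\<integral>\<^sup>+x. F (actY g y) x \<partial>\<kappa> (actY g y)) = (\<integral>\<^sup>+x. F (actY g y) (act g x) \<partial>\<kappa> y)"
    if F: "\<And>y. y \<in> space Y \<Longrightarrow> F y \<in> borel_measurable (borel_of T)" for F :: "'y \<Rightarrow> real \<Rightarrow> ennreal" and g
    using equi[of g] AE_space
  proof eventually_elim
    case (elim y)
    have am: "act g \<in> \<kappa> y \<rightarrow>\<^sub>M borel_of T" using actm unfolding measurable_cong_sets[OF sets refl] .
    show ?case unfolding elim(1)
      by (rule nn_integral_distr[OF am]) (use F[OF Y.act_space[OF elim(2)]] in simp)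
  qed
  \<comment> \<open>This is the barycenter. Equivariance of \<open>\<kappa>\<close> moves the
    average over \<open>\<mu>\<close> from the model to \<open>Y\<close>, where stationarity of
    \<open>Y\<close> applies.\<close>
  define N' where "N' = Y \<bind> \<kappa>"
  have N': "prob_space N'" unfolding N'_def by (rule Y.prob_space_bind[OF _ \<kappa>m]) (simp add: prob)
  have sN': "sets N' = sets (borel_of T)" unfolding N'_def by (rule sets_bind[OF sets Y.not_empty])
  interpret N': prob_space N' by fact
  have nn_N': "(\<integral>\<^sup>+x. f x \<partial>N') = (\<integral>\<^sup>+y. \<integral>\<^sup>+x. f x \<partial>\<kappa> y \<partial>Y)" if "f \<in> borel_measurable (borel_of T)" for f
    unfolding N'_def by (rule nn_integral_bind[OF that \<kappa>m])
  have "stationary \<mu> N' act"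
    unfolding stationary_def
  proof (rule measure_eqI)
    fix A assume "A \<in> sets (distr (\<mu> \<Otimes>\<^sub>M N') N' (\<lambda>(g, x). act g x))"
    then have A: "A \<in> sets (borel_of T)" by (simp add: sN')
    then have iA: "(indicator A :: real \<Rightarrow> ennreal) \<in> borel_measurable (borel_of T)" by measurable
    have "(\<lambda>(g, x). act g x) \<in> borel_of euclidean \<Otimes>\<^sub>M borel_of T \<rightarrow>\<^sub>M borel_of T"
      by (rule continuous_map_prod_measurable[OF cont second_countable_euclidean second_countable])
    then have jm: "(\<lambda>(g, x). act g x) \<in> \<mu> \<Otimes>\<^sub>M N' \<rightarrow>\<^sub>M N'"
      using measurable_cong_sets[OF sets_pair_measure_cong[OF \<mu>(2)[folded sets_borel_of_euclidean] sN'] sN'] by blast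
    have iA': "(indicator A :: real \<Rightarrow> ennreal) \<in> borel_measurable N'"
      using iA unfolding measurable_cong_sets[OF sN' refl] .
    have im: "(\<lambda>p. indicator A ((\<lambda>(g, x). act g x) p) :: ennreal) \<in> borel_measurable (\<mu> \<Otimes>\<^sub>M N')"
      by (rule measurable_compose[OF jm iA'])
    define k where "k y = (\<integral>\<^sup>+x. indicator A x \<partial>\<kappa> y)" for y
    have km: "k \<in> borel_measurable Y"
      unfolding k_def by (rule measurable_compose[OF \<kappa>m nn_integral_measurable_subprob_algebra[OF iA]])
    have Ym: "(\<lambda>(g, y). actY g y) \<in> \<mu> \<Otimes>\<^sub>M Y \<rightarrow>\<^sub>M Y"
      using Y.act_joint unfolding measurable_cong_sets[OF sets_pair_measure_cong[OF \<mu>(2) refl] refl] .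
    have "emeasure (distr (\<mu> \<Otimes>\<^sub>M N') N' (\<lambda>(g, x). act g x)) A =
        (\<integral>\<^sup>+x. indicator A x \<partial>distr (\<mu> \<Otimes>\<^sub>M N') N' (\<lambda>(g, x). act g x))"
      using A sN' by simp
    also have "\<dots> = (\<integral>\<^sup>+p. indicator A ((\<lambda>(g, x). act g x) p) \<partial>(\<mu> \<Otimes>\<^sub>M N'))"
      by (rule nn_integral_distr[OF jm]) (use A sN' in simp)
    also have "\<dots> = (\<integral>\<^sup>+g. \<integral>\<^sup>+x. indicator A (act g x) \<partial>N' \<partial>\<mu>)"
      using N'.nn_integral_fst[OF im] by simp
    also have "\<dots> = (\<integral>\<^sup>+g. \<integral>\<^sup>+y. k (actY g y) \<partial>Y \<partial>\<mu>)"
    proof (rule nn_integral_cong)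
      fix g
      have "(\<integral>\<^sup>+x. indicator A (act g x) \<partial>N') = (\<integral>\<^sup>+y. \<integral>\<^sup>+x. indicator A (act g x) \<partial>\<kappa> y \<partial>Y)"
        by (rule nn_N'[OF measurable_compose[OF actm iA]])
      also have "\<dots> = (\<integral>\<^sup>+y. k (actY g y) \<partial>Y)"
        unfolding k_def
        by (rule nn_integral_cong_AE, use equi_nn[of "\<lambda>_. indicator A" g, OF iA] in eventually_elim) simp
      finally show "(\<integral>\<^sup>+x. indicator A (act g x) \<partial>N') = (\<integral>\<^sup>+y. k (actY g y) \<partial>Y)" .
    qed
    also have "\<dots> = (\<integral>\<^sup>+p. k ((\<lambda>(g, y). actY g y) p) \<partial>(\<mu> \<Otimes>\<^sub>M Y))"
      using Y.nn_integral_fst[OF measurable_compose[OF Ym km]] by simp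
    also have "\<dots> = (\<integral>\<^sup>+y. k y \<partial>distr (\<mu> \<Otimes>\<^sub>M Y) Y (\<lambda>(g, y). actY g y))"
      by (rule nn_integral_distr[OF Ym, symmetric]) (use km in simp)
    also have "\<dots> = (\<integral>\<^sup>+y. k y \<partial>Y)" using stY by (simp add: stationary_def)
    also have "\<dots> = (\<integral>\<^sup>+x. indicator A x \<partial>N')" unfolding k_def by (rule nn_N'[OF iA, symmetric])
    also have "\<dots> = emeasure N' A" using A sN' by simp
    finally show "emeasure (distr (\<mu> \<Otimes>\<^sub>M N') N' (\<lambda>(g, x). act g x)) A = emeasure N' A" .
  qed simp
  then have "N' = N" by (rule uniq[OF N' sN'])
  note nn_N = nn_N'[unfolded this]
  \<comment> \<open>The fibre of the coupling over \<open>y\<close>: the measure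
    \<open>\<kappa> y\<close>, carried from the model to \<open>X\<close> by
    \<open>q\<close>.\<close>
  define D where "D y = distr (\<kappa> y) (Y \<Otimes>\<^sub>M X) (\<lambda>x. (y, q x))" for y
  have pm: "(\<lambda>(y, x). (y, q x)) \<in> Y \<Otimes>\<^sub>M borel_of T \<rightarrow>\<^sub>M Y \<Otimes>\<^sub>M X"
    unfolding case_prod_unfold by (rule measurable_Pair[OF measurable_fst measurable_compose[OF measurable_snd qm]])
  have Dm: "D \<in> Y \<rightarrow>\<^sub>M subprob_algebra (Y \<Otimes>\<^sub>M X)"
    unfolding D_def by (rule measurable_distr2[OF pm \<kappa>m])
  have ym: "(\<lambda>x. (y, q x)) \<in> borel_of T \<rightarrow>\<^sub>M Y \<Otimes>\<^sub>M X" if "y \<in> space Y" for y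
    using measurable_Pair[OF measurable_const[OF that] qm] .
  have ym': "(\<lambda>x. (y, q x)) \<in> \<kappa> y \<rightarrow>\<^sub>M Y \<Otimes>\<^sub>M X" if "y \<in> space Y" for y
    using ym[OF that] unfolding measurable_cong_sets[OF sets refl] .
  have probD: "prob_space (D y)" if "y \<in> space Y" for y
    unfolding D_def by (rule prob_space.prob_space_distr[OF prob ym'[OF that]])
  define Z where "Z = Y \<bind> D"
  have Z: "prob_space Z" unfolding Z_def by (rule Y.prob_space_bind[OF _ Dm]) (simp add: probD)
  have sZ: "sets Z = sets (Y \<Otimes>\<^sub>M X)" unfolding Z_def by (rule sets_bind[OF _ Y.not_empty]) (simp add: D_def)
  have Gm: "(\<lambda>y. \<integral>\<^sup>+x. F (y, q x) \<partial>\<kappa> y) \<in> borel_measurable Y"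
    and nn_Z: "(\<integral>\<^sup>+z. F z \<partial>Z) = (\<integral>\<^sup>+y. \<integral>\<^sup>+x. F (y, q x) \<partial>\<kappa> y \<partial>Y)"
    if F: "F \<in> borel_measurable (Y \<Otimes>\<^sub>M X)" for F
  proof -
    have eq: "(\<integral>\<^sup>+z. F z \<partial>D y) = (\<integral>\<^sup>+x. F (y, q x) \<partial>\<kappa> y)" if "y \<in> space Y" for y
      unfolding D_def by (rule nn_integral_distr[OF ym'[OF that]]) (use F in simp)
    have "(\<integral>\<^sup>+z. F z \<partial>Z) = (\<integral>\<^sup>+y. \<integral>\<^sup>+z. F z \<partial>D y \<partial>Y)"
      unfolding Z_def by (rule nn_integral_bind[OF F Dm])
    also have "\<dots> = (\<integral>\<^sup>+y. \<integral>\<^sup>+x. F (y, q x) \<partial>\<kappa> y \<partial>Y)" by (rule nn_integral_cong) (rule eq)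
    finally show "(\<integral>\<^sup>+z. F z \<partial>Z) = (\<integral>\<^sup>+y. \<integral>\<^sup>+x. F (y, q x) \<partial>\<kappa> y \<partial>Y)" .
    have "(\<lambda>y. \<integral>\<^sup>+z. F z \<partial>D y) \<in> borel_measurable Y"
      by (rule measurable_compose[OF Dm nn_integral_measurable_subprob_algebra[OF F]])
    then show "(\<lambda>y. \<integral>\<^sup>+x. F (y, q x) \<partial>\<kappa> y) \<in> borel_measurable Y"
      by (rule measurable_cong[THEN iffD1, rotated]) (rule eq)
  qed
  have fm: "fst \<in> Z \<rightarrow>\<^sub>M Y" "snd \<in> Z \<rightarrow>\<^sub>M X"
    unfolding measurable_cong_sets[OF sZ refl] by (rule measurable_fst measurable_snd)+
  interpret Z: prob_space Z by (rule Z)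
  have "coupling X actX Y actY Z"
  proof (unfold_locales)
    show "sets Z = sets (Y \<Otimes>\<^sub>M X)" by (rule sZ)
    show "distr Z Y fst = Y"
    proof (rule measure_eqI)
      fix A assume "A \<in> sets (distr Z Y fst)"
      then have A: "A \<in> sets Y" by simp
      then have iA: "(indicator A :: 'y \<Rightarrow> ennreal) \<in> borel_measurable Y" by measurable
      have "emeasure (distr Z Y fst) A = (\<integral>\<^sup>+y. indicator A y \<partial>distr Z Y fst)" using A by simp
      also have "\<dots> = (\<integral>\<^sup>+z. indicator A (fst z) \<partial>Z)" by (rule nn_integral_distr[OF fm(1)]) (use iA in simp)
      also have "\<dots> = (\<integral>\<^sup>+y. \<integral>\<^sup>+x. indicator A (fst (y, q x)) \<partial>\<kappa> y \<partial>Y)"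
        by (rule nn_Z[OF measurable_compose[OF measurable_fst iA]])
      also have "\<dots> = (\<integral>\<^sup>+y. indicator A y \<partial>Y)"
        by (simp add: prob_space.emeasure_space_1[OF prob])
      also have "\<dots> = emeasure Y A" using A by simp
      finally show "emeasure (distr Z Y fst) A = emeasure Y A" .
    qed simp
    show "distr Z X snd = X"
    proof (rule measure_eqI)
      fix A assume "A \<in> sets (distr Z X snd)"
      then have A: "A \<in> sets X" by simp
      then have iA: "(indicator A :: 'x \<Rightarrow> ennreal) \<in> borel_measurable X" by measurable
      have qN: "q \<in> N \<rightarrow>\<^sub>M X" using qm unfolding measurable_cong_sets[OF N(2) refl] .
      have "emeasure (distr Z X snd) A = (\<integral>\<^sup>+y. indicator A y \<partial>distr Z X snd)" using A by simp
      also have "\<dots> = (\<integral>\<^sup>+z. indicator A (snd z) \<partial>Z)" by (rule nn_integral_distr[OF fm(2)]) (use iA in simp)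
      also have "\<dots> = (\<integral>\<^sup>+y. \<integral>\<^sup>+x. indicator A (snd (y, q x)) \<partial>\<kappa> y \<partial>Y)"
        by (rule nn_Z[OF measurable_compose[OF measurable_snd iA]])
      also have "\<dots> = (\<integral>\<^sup>+x. indicator A (q x) \<partial>N)"
        unfolding snd_conv by (rule nn_N[OF measurable_compose[OF qm iA], symmetric])
      also have "\<dots> = (\<integral>\<^sup>+x. indicator A x \<partial>distr N X q)"
        by (rule nn_integral_distr[OF qN, symmetric]) (use iA in simp)
      also have "\<dots> = emeasure X A" using A by (simp add: qd)
      finally show "emeasure (distr Z X snd) A = emeasure X A" .
    qed simp
    fix F :: "'y \<times> 'x \<Rightarrow> ennreal" and g
    assume "F \<in> borel_measurable Z"
    then have F: "F \<in> borel_measurable (Y \<Otimes>\<^sub>M X)" unfolding measurable_cong_sets[OF sZ refl] .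
    have sm: "(\<lambda>z. (actY g (fst z), actX g (snd z))) \<in> Y \<Otimes>\<^sub>M X \<rightarrow>\<^sub>M Y \<Otimes>\<^sub>M X"
      by (rule measurable_Pair[OF measurable_compose[OF measurable_fst Y.act_measurable]
            measurable_compose[OF measurable_snd X.act_measurable]])
    \<comment> \<open>\<open>q\<close> is equivariant only up to an \<open>N\<close>-null set. As
      \<open>N\<close> is the barycenter of the \<open>\<kappa> y\<close>, that set is null for
      almost every \<open>\<kappa> y\<close>.\<close>
    have qAE: "AE y in Y. AE x in \<kappa> y. q (act g x) = actX g (q x)"
    proof -
      obtain S where S: "S \<in> null_sets N" "{x \<in> space N. q (act g x) \<noteq> actX g (q x)} \<subseteq> S"
        using qg[of g] unfolding eventually_ae_filter by blast
      have SB: "S \<in> sets (borel_of T)" using S(1) N(2) by auto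
      then have iS: "(indicator S :: real \<Rightarrow> ennreal) \<in> borel_measurable (borel_of T)" by measurable
      have "(\<integral>\<^sup>+y. \<integral>\<^sup>+x. indicator S x \<partial>\<kappa> y \<partial>Y) = (\<integral>\<^sup>+x. indicator S x \<partial>N)" by (rule nn_N[OF iS, symmetric])
      also have "\<dots> = emeasure N S" by (rule nn_integral_indicator[OF null_setsD2[OF S(1)]])
      also have "\<dots> = 0" by (rule null_setsD1[OF S(1)])
      finally have "AE y in Y. (\<integral>\<^sup>+x. indicator S x \<partial>\<kappa> y) = 0"
        by (subst (asm) nn_integral_0_iff_AE)
           (rule measurable_compose[OF \<kappa>m nn_integral_measurable_subprob_algebra[OF iS]])
      then show ?thesis
      proof eventually_elim
        case (elim y)
        then have "S \<in> null_sets (\<kappa> y)" using SB sets by (intro null_setsI) simp_all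
        moreover have "{x \<in> space (\<kappa> y). q (act g x) \<noteq> actX g (q x)} \<subseteq> S"
          using S(2) sets_eq_imp_space_eq[OF sets, of y] spN by simp
        ultimately show ?case unfolding eventually_ae_filter by blast
      qed
    qed
    have "(\<integral>\<^sup>+z. F (actY g (fst z), actX g (snd z)) \<partial>Z) =
        (\<integral>\<^sup>+y. \<integral>\<^sup>+x. F (actY g y, actX g (q x)) \<partial>\<kappa> y \<partial>Y)"
      using nn_Z[OF measurable_compose[OF sm F]] by simp
    also have "\<dots> = (\<integral>\<^sup>+y. \<integral>\<^sup>+x. F (actY g y, q (act g x)) \<partial>\<kappa> y \<partial>Y)"
    proof (rule nn_integral_cong_AE, use qAE in eventually_elim)
      case (elim y)
      show ?case by (rule nn_integral_cong_AE, use elim in eventually_elim) simp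
    qed
    \<comment> \<open>Equivariance of \<open>\<kappa>\<close> absorbs the translation in the fibre,
      so only the translation of \<open>y\<close> contributes a density.\<close>
    also have "\<dots> = (\<integral>\<^sup>+y. (\<lambda>y. \<integral>\<^sup>+x. F (y, q x) \<partial>\<kappa> y) (actY g y) \<partial>Y)"
    proof (rule nn_integral_cong_AE)
      have "AE y in Y. (\<integral>\<^sup>+x. F (actY g y, q x) \<partial>\<kappa> (actY g y)) = (\<integral>\<^sup>+x. F (actY g y, q (act g x)) \<partial>\<kappa> y)"
        by (rule equi_nn[of "\<lambda>y x. F (y, q x)" g]) (rule measurable_compose[OF ym F])
      then show "AE y in Y. (\<integral>\<^sup>+x. F (actY g y, q (act g x)) \<partial>\<kappa> y) =
          (\<lambda>y. \<integral>\<^sup>+x. F (y, q x) \<partial>\<kappa> y) (actY g y)"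
        by eventually_elim simp
    qed
    also have "\<dots> = (\<integral>\<^sup>+y. rn Y actY g y * (\<integral>\<^sup>+x. F (y, q x) \<partial>\<kappa> y) \<partial>Y)"
      by (rule Y.nn_integral_act[OF Gm[OF F]])
    also have "\<dots> = (\<integral>\<^sup>+y. \<integral>\<^sup>+x. rn Y actY g (fst (y, q x)) * F (y, q x) \<partial>\<kappa> y \<partial>Y)"
    proof (rule nn_integral_cong)
      fix y assume y: "y \<in> space Y"
      have "(\<lambda>x. F (y, q x)) \<in> borel_measurable (\<kappa> y)"
        using measurable_compose[OF ym[OF y] F] unfolding measurable_cong_sets[OF sets refl] .
      then show "rn Y actY g y * (\<integral>\<^sup>+x. F (y, q x) \<partial>\<kappa> y) = (\<integral>\<^sup>+x. rn Y actY g (fst (y, q x)) * F (y, q x) \<partial>\<kappa> y)"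
        unfolding fst_conv by (rule nn_integral_cmult[symmetric])
    qed
    also have "\<dots> = (\<integral>\<^sup>+z. rn Y actY g (fst z) * F z \<partial>Z)"
      by (rule nn_Z[symmetric]) (rule borel_measurable_times_ennreal[OF measurable_compose[OF measurable_fst Y.rn_measurable] F])
    finally show "(\<integral>\<^sup>+z. F (actY g (fst z), actX g (snd z)) \<partial>Z) = (\<integral>\<^sup>+z. rn Y actY g (fst z) * F z \<partial>Z)" .
  qed
  then show ?thesis by (rule that)
qed

section \<open>Von Neumann subalgebras and isomorphisms\<close>

text \<open>Points of a T1 space are separated by a base, so the set of disagreement is the
  countable union, over base sets \<open>V\<close>, of the points that \<open>u\<close> sends into
  \<open>V\<close> and \<open>v\<close> does not.\<close>

lemma standard_borel_equality_set:
  assumes Y: "standard_borel Y" and u: "u \<in> M \<rightarrow>\<^sub>M Y" and v: "v \<in> M \<rightarrow>\<^sub>M Y"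
  shows "{x \<in> space M. u x = v x} \<in> sets M"
proof -
  obtain T where T: "completely_metrizable_space T" "second_countable T" "sets Y = sets (borel_of T)"
    using Y unfolding standard_borel_def by blast
  have sp: "space Y = topspace T" using sets_eq_imp_space_eq[OF T(3)] by simp
  have t1: "t1_space T"
    using T(1) by (intro Hausdorff_imp_t1_space metrizable_imp_Hausdorff_space completely_metrizable_imp_metrizable_space)
  obtain \<B> where \<B>: "countable \<B>" "\<And>V. V \<in> \<B> \<Longrightarrow> openin T V"
      "\<And>U x. openin T U \<Longrightarrow> x \<in> U \<Longrightarrow> \<exists>V\<in>\<B>. x \<in> V \<and> V \<subseteq> U"
    using T(2) unfolding second_countable_def by metis
  define S where "S V = (u -` V \<inter> space M) - (v -` V \<inter> space M)" for V
  have S: "S V \<in> sets M" if "V \<in> \<B>" for V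
  proof -
    have "V \<in> sets Y" using \<B>(2)[OF that] T(3) by (simp add: borel_of_openin)
    then show ?thesis unfolding S_def by (intro sets.Diff measurable_sets[OF u] measurable_sets[OF v])
  qed
  have "{x \<in> space M. u x = v x} = space M - (\<Union>V\<in>\<B>. S V)"
  proof (intro set_eqI iffI)
    fix x assume "x \<in> {x \<in> space M. u x = v x}"
    then show "x \<in> space M - (\<Union>V\<in>\<B>. S V)" by (auto simp: S_def)
  next
    fix x assume x: "x \<in> space M - (\<Union>V\<in>\<B>. S V)"
    have "u x = v x"
    proof (rule ccontr)
      assume ne: "u x \<noteq> v x"
      have "u x \<in> topspace T" "v x \<in> topspace T"
        using x measurable_space[OF u] measurable_space[OF v] sp by auto
      then have "openin T (topspace T - {v x})" "u x \<in> topspace T - {v x}"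
        using t1 ne by (auto simp: t1_space_closedin_singleton intro: openin_diff)
      then obtain V where V: "V \<in> \<B>" "u x \<in> V" "V \<subseteq> topspace T - {v x}" using \<B>(3) by meson
      then have "x \<in> S V" using x by (auto simp: S_def)
      then show False using x V(1) by blast
    qed
    then show "x \<in> {x \<in> space M. u x = v x}" using x by blast
  qed
  moreover have "(\<Union>V\<in>\<B>. S V) \<in> sets M"
    by (rule sets.countable_UN'[OF \<B>(1)]) (use S in blast)
  ultimately show ?thesis by (simp only: sets.compl_sets)
qed

section \<open>Essentially bounded functions and the ultraweak topology\<close>

lemma Linf_measurable: "f \<in> Linf M \<Longrightarrow> f \<in> borel_measurable M"
  by (simp add: Linf_def)

lemma Linf_bound: assumes "f \<in> Linf M" obtains c where "0 \<le> c" "AE x in M. cmod (f x) \<le> c"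
proof -
  obtain c where "AE x in M. cmod (f x) \<le> c" using assms by (auto simp: Linf_def)
  then have "AE x in M. cmod (f x) \<le> max 0 c" by eventually_elim simp
  then show ?thesis by (rule that[rotated]) simp
qed

lemma LinfI: "f \<in> borel_measurable M \<Longrightarrow> AE x in M. cmod (f x) \<le> c \<Longrightarrow> f \<in> Linf M"
  by (auto simp: Linf_def)

lemma Linf_add: assumes "f \<in> Linf M" "k \<in> Linf M" shows "(\<lambda>x. f x + k x) \<in> Linf M"
proof -
  obtain c where c: "AE x in M. cmod (f x) \<le> c" using assms(1) by (rule Linf_bound)
  obtain d where d: "AE x in M. cmod (k x) \<le> d" using assms(2) by (rule Linf_bound)
  have "AE x in M. cmod (f x + k x) \<le> c + d"
    using c d by eventually_elim (metis add_mono norm_triangle_le)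
  then show ?thesis by (rule LinfI[rotated]) (intro borel_measurable_add Linf_measurable assms)
qed

lemma Linf_mult: assumes "f \<in> Linf M" "k \<in> Linf M" shows "(\<lambda>x. f x * k x) \<in> Linf M"
proof -
  obtain c where c: "0 \<le> c" "AE x in M. cmod (f x) \<le> c" using assms(1) by (rule Linf_bound)
  obtain d where d: "0 \<le> d" "AE x in M. cmod (k x) \<le> d" using assms(2) by (rule Linf_bound)
  have "AE x in M. cmod (f x * k x) \<le> c * d"
    using c(2) d(2) by eventually_elim (use c(1) in \<open>simp add: norm_mult mult_mono\<close>)
  then show ?thesis by (rule LinfI[rotated]) (intro borel_measurable_times Linf_measurable assms)
qed

lemma Linf_const: "(\<lambda>_. c) \<in> Linf M"
  by (rule LinfI[of _ _ "cmod c"]) auto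

lemma Linf_cnj: assumes "f \<in> Linf M" shows "(\<lambda>x. cnj (f x)) \<in> Linf M"
proof -
  obtain c where c: "AE x in M. cmod (f x) \<le> c" using assms by (rule Linf_bound)
  have "cnj \<in> borel_measurable borel" by (intro borel_measurable_continuous_onI continuous_intros)
  then have "(\<lambda>x. cnj (f x)) \<in> borel_measurable M" by (rule measurable_compose[OF Linf_measurable[OF assms]])
  then show ?thesis using c by (intro LinfI[of _ _ c]) simp_all
qed

lemma (in prob_space) Linf_integrable: assumes "f \<in> Linf M" shows "integrable M f"
proof -
  obtain c where "AE x in M. cmod (f x) \<le> c" using assms by (rule Linf_bound)
  then show ?thesis by (rule integrable_const_bound) (rule Linf_measurable[OF assms])
qed

lemma topspace_ultraweak: "topspace (ultraweak_topology M) = Linf M"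
  unfolding ultraweak_topology_def topspace_pullback_topology by auto

text \<open>Pairing with \<open>w\<close> is one coordinate of the map from which the topology is
  pulled back, hence continuous.\<close>

lemma closedin_ultraweak_kernel:
  assumes w: "integrable M w"
  shows "closedin (ultraweak_topology M) {f \<in> Linf M. (\<integral>x. f x * w x \<partial>M) = 0}"
proof -
  let ?F = "\<lambda>f :: 'a \<Rightarrow> complex. \<lambda>k\<in>{k. integrable M k}. \<integral>x. f x * k x \<partial>M"
  have "continuous_map (product_topology (\<lambda>_. euclidean) {k. integrable M k}) euclidean (\<lambda>F :: ('a \<Rightarrow> complex) \<Rightarrow> complex. F w)"
    by (rule continuous_map_product_projection) (use w in simp)
  then have "continuous_map (ultraweak_topology M) euclidean ((\<lambda>F :: ('a \<Rightarrow> complex) \<Rightarrow> complex. F w) \<circ> ?F)"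
    unfolding ultraweak_topology_def by (rule continuous_map_pullback)
  moreover have "(\<lambda>F :: ('a \<Rightarrow> complex) \<Rightarrow> complex. F w) \<circ> ?F = (\<lambda>f. \<integral>x. f x * w x \<partial>M)"
    using w by (simp add: fun_eq_iff)
  ultimately have "continuous_map (ultraweak_topology M) euclidean (\<lambda>f. \<integral>x. f x * w x \<partial>M)" by simp
  then have "closedin (ultraweak_topology M) {f \<in> topspace (ultraweak_topology M). (\<integral>x. f x * w x \<partial>M) \<in> {0}}"
    by (rule closedin_continuous_map_preimage) simp
  then show ?thesis by (simp add: topspace_ultraweak)
qed

section \<open>The functions shared by two factors\<close>

text \<open>The data are symmetric in the two factors; through \<open>swap\<close> every result also
  serves with the roles of the two spaces of a coupling exchanged.\<close>

locale two_factors = Z: prob_space Z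
  for Z :: "'z measure" and P :: "'p measure" and Q :: "'q measure"
    and \<pi> :: "'z \<Rightarrow> 'p" and \<rho> :: "'z \<Rightarrow> 'q" +
  assumes \<pi>[measurable]: "\<pi> \<in> Z \<rightarrow>\<^sub>M P" and \<rho>[measurable]: "\<rho> \<in> Z \<rightarrow>\<^sub>M Q"
    and distr_\<pi>: "distr Z P \<pi> = P" and distr_\<rho>: "distr Z Q \<rho> = Q"
begin

lemma swap: "two_factors Z Q P \<rho> \<pi>"
  by unfold_locales (rule \<pi> \<rho> distr_\<pi> distr_\<rho>)+

lemma prob_P: "prob_space P"
  using Z.prob_space_distr[OF \<pi>] by (simp only: distr_\<pi>)

lemma AE_\<pi>: "AE x in P. R x \<Longrightarrow> AE z in Z. R (\<pi> z)"
  using AE_distrD[OF \<pi>, of R] by (simp only: distr_\<pi>)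

lemma AE_\<pi>_iff: assumes "{x \<in> space P. R x} \<in> sets P" shows "(AE z in Z. R (\<pi> z)) \<longleftrightarrow> (AE x in P. R x)"
  using AE_distr_iff[OF \<pi> assms] by (simp only: distr_\<pi>)

lemma Linf_\<pi>: assumes "f \<in> Linf P" shows "(\<lambda>z. f (\<pi> z)) \<in> Linf Z"
proof -
  obtain c where "AE x in P. cmod (f x) \<le> c" using assms by (rule Linf_bound)
  then have "AE z in Z. cmod (f (\<pi> z)) \<le> c" by (rule AE_\<pi>)
  then show ?thesis by (rule LinfI[OF measurable_compose[OF \<pi> Linf_measurable[OF assms]]])
qed

lemma integral_\<pi>: "f \<in> borel_measurable P \<Longrightarrow> (\<integral>z. f (\<pi> z) \<partial>Z) = (\<integral>x. f x \<partial>P)" for f :: "'p \<Rightarrow> complex"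
  using integral_distr[OF \<pi>, of f] by (simp add: distr_\<pi>)

text \<open>The image measure is read off on \<open>Z\<close>, where \<open>p\<close> after
  \<open>\<rho>\<close> is \<open>\<pi>\<close>. Equivariance descends from \<open>Z\<close> to
  \<open>Q\<close> because equality sets in a standard Borel space are measurable.\<close>

lemma factor_mapI:
  assumes p: "p \<in> Q \<rightarrow>\<^sub>M P" "AE z in Z. \<pi> z = p (\<rho> z)" and std: "standard_borel P"
    and act: "\<And>g. actQ g \<in> Q \<rightarrow>\<^sub>M Q" "\<And>g. actP g \<in> P \<rightarrow>\<^sub>M P"
    and eq: "\<And>g. AE z in Z. p (actQ g (\<rho> z)) = actP g (p (\<rho> z))"
  shows "factor_map Q actQ P actP p"
  unfolding factor_map_def
proof (intro conjI allI)
  show "p \<in> Q \<rightarrow>\<^sub>M P" by (rule p(1))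
  have "distr Q P p = distr (distr Z Q \<rho>) P p" by (simp only: distr_\<rho>)
  also have "\<dots> = distr Z P (p \<circ> \<rho>)" by (rule distr_distr[OF p(1) \<rho>])
  also have "\<dots> = distr Z P \<pi>"
  proof (rule distr_cong_AE)
    show "AE z in Z. (p \<circ> \<rho>) z = \<pi> z" using p(2) by eventually_elim simp
  qed (simp_all add: measurable_comp[OF \<rho> p(1)] \<pi>)
  finally show "distr Q P p = P" by (simp only: distr_\<pi>)
  show "AE y in Q. p (actQ g y) = actP g (p y)" for g
    using two_factors.AE_\<pi>_iff[OF swap standard_borel_equality_set[OF std
          measurable_compose[OF act(1) p(1)] measurable_compose[OF p(1) act(2)], of g g]] eq[of g]
    by blast
qed

text \<open>\<open>k\<close> is the conditional expectation of \<open>V\<close> given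
  \<open>\<pi>\<close>. Shifting by \<open>c\<close> makes \<open>V\<close> a density with values
  between 0 and \<open>2 * c\<close>; the image measure on \<open>P\<close> has a density
  \<open>s\<close> with the same bound, and \<open>k\<close> is \<open>s - c\<close>.\<close>

lemma bounded_cond_exp:
  fixes V :: "'z \<Rightarrow> real"
  assumes V[measurable]: "V \<in> borel_measurable Z" and c: "\<And>z. \<bar>V z\<bar> \<le> c"
  obtains k :: "'p \<Rightarrow> real" where "k \<in> borel_measurable P" "\<And>x. \<bar>k x\<bar> \<le> c"
    "\<And>h. h \<in> Linf P \<Longrightarrow> (\<integral>z. h (\<pi> z) * complex_of_real (V z) \<partial>Z) = (\<integral>x. h x * complex_of_real (k x) \<partial>P)"
proof -
  interpret P: prob_space P by (rule prob_P)
  have c0: "0 \<le> c" using c[of undefined] by linarith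
  have Vc: "0 \<le> V z + c" "V z + c \<le> 2 * c" for z using c[of z] by linarith+
  define D where "D = density Z (\<lambda>z. ennreal (V z + c))"
  have \<pi>D: "\<pi> \<in> D \<rightarrow>\<^sub>M P" unfolding D_def using \<pi> by simp
  define N where "N = distr D P \<pi>"
  have emN: "emeasure N A = (\<integral>\<^sup>+z. ennreal (V z + c) * indicator A (\<pi> z) \<partial>Z)" if A: "A \<in> sets P" for A
  proof -
    have "emeasure N A = emeasure D (\<pi> -` A \<inter> space Z)"
      unfolding N_def using emeasure_distr[OF \<pi>D A] by (simp add: D_def)
    also have "\<dots> = (\<integral>\<^sup>+z. ennreal (V z + c) * indicator (\<pi> -` A \<inter> space Z) z \<partial>Z)"
      unfolding D_def by (rule emeasure_density) (use measurable_sets[OF \<pi> A] in simp_all)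
    also have "\<dots> = (\<integral>\<^sup>+z. ennreal (V z + c) * indicator A (\<pi> z) \<partial>Z)"
      by (rule nn_integral_cong) (simp add: indicator_def)
    finally show ?thesis .
  qed
  have le: "emeasure N A \<le> ennreal (2 * c) * emeasure P A" if A: "A \<in> sets P" for A
  proof -
    have iA: "(indicator A :: 'p \<Rightarrow> ennreal) \<in> borel_measurable P" using A by simp
    have "emeasure N A \<le> (\<integral>\<^sup>+z. ennreal (2 * c) * indicator A (\<pi> z) \<partial>Z)"
      unfolding emN[OF A] by (intro nn_integral_mono mult_right_mono ennreal_leI Vc) simp
    also have "\<dots> = ennreal (2 * c) * (\<integral>\<^sup>+z. indicator A (\<pi> z) \<partial>Z)"
      by (rule nn_integral_cmult) (rule measurable_compose[OF \<pi> iA])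
    also have "(\<integral>\<^sup>+z. indicator A (\<pi> z) \<partial>Z) = (\<integral>\<^sup>+x. indicator A x \<partial>distr Z P \<pi>)"
      by (rule nn_integral_distr[OF \<pi>, symmetric]) (use iA in simp)
    also have "\<dots> = emeasure P A" using A by (simp add: distr_\<pi>)
    finally show ?thesis .
  qed
  have "absolutely_continuous P N"
    unfolding absolutely_continuous_def
  proof
    fix A assume A: "A \<in> null_sets P"
    then have "emeasure N A = 0" using le[OF null_setsD2[OF A]] by (simp add: null_setsD1)
    then show "A \<in> null_sets N" using A by (intro null_setsI) (simp_all add: N_def null_setsD2)
  qed
  then have dN: "density P (RN_deriv P N) = N"
    by (rule P.density_RN_deriv) (simp add: N_def)
  define s where "s = RN_deriv P N"
  have sm[measurable]: "s \<in> borel_measurable P" unfolding s_def by measurable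
  have sN: "density P s = N" unfolding s_def by (rule dN)
  have s_le: "AE x in P. s x \<le> ennreal (2 * c)"
  proof -
    \<comment> \<open>On the set where \<open>s\<close> exceeds \<open>2 * c\<close> the integral of
      the excess vanishes by \<open>le\<close>, so the set is null.\<close>
    define A where "A = {x \<in> space P. ennreal (2 * c) < s x}"
    have A: "A \<in> sets P" unfolding A_def by measurable
    have i1: "(\<integral>\<^sup>+x. s x * indicator A x \<partial>P) = emeasure N A" unfolding sN[symmetric] by (rule emeasure_density[OF sm A, symmetric])
    have i2: "(\<integral>\<^sup>+x. ennreal (2 * c) * indicator A x \<partial>P) = ennreal (2 * c) * emeasure P A" using A by (rule nn_integral_cmult_indicator)
    have "(\<integral>\<^sup>+x. s x * indicator A x - ennreal (2 * c) * indicator A x \<partial>P) =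
        (\<integral>\<^sup>+x. s x * indicator A x \<partial>P) - (\<integral>\<^sup>+x. ennreal (2 * c) * indicator A x \<partial>P)"
    proof (rule nn_integral_diff)
      show "(\<integral>\<^sup>+x. ennreal (2 * c) * indicator A x \<partial>P) \<noteq> \<infinity>"
        unfolding i2 using P.emeasure_finite[of A] by (simp add: ennreal_mult_eq_top_iff)
      show "AE x in P. ennreal (2 * c) * indicator A x \<le> s x * indicator A x"
        by (rule AE_I2) (auto simp: A_def indicator_def)
    qed (use A in measurable)
    also have "\<dots> = 0"
    proof -
      have "ennreal (2 * c) * emeasure P A < \<top>"
        by (simp add: ennreal_mult_less_top P.emeasure_eq_measure)
      then show ?thesis
        unfolding i1 i2 diff_eq_0_iff_ennreal using le[OF A] le_less_trans by blast
    qed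
    finally have "(\<integral>\<^sup>+x. s x * indicator A x - ennreal (2 * c) * indicator A x \<partial>P) = 0" .
    moreover have "(\<lambda>x. s x * indicator A x - ennreal (2 * c) * indicator A x) \<in> borel_measurable P"
      using A by measurable
    ultimately have "AE x in P. s x * indicator A x - ennreal (2 * c) * indicator A x = 0"
      using nn_integral_0_iff_AE by blast
    then show ?thesis
      using AE_space
    proof eventually_elim
      case (elim x)
      show ?case
      proof (rule ccontr)
        assume "\<not> s x \<le> ennreal (2 * c)"
        then have "ennreal (2 * c) < s x" by simp
        moreover from this have "x \<in> A" using elim(2) by (simp add: A_def)
        ultimately show False using elim(1) by (auto simp: diff_eq_0_iff_ennreal dest: leD)
      qed
    qed
  qed
  \<comment> \<open>The clamp changes \<open>s - c\<close> only on a null set and gives the bound at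
    every point.\<close>
  define k where "k x = max (- c) (min c (enn2real (s x) - c))" for x
  have km: "k \<in> borel_measurable P" unfolding k_def by measurable
  have kc: "\<bar>k x\<bar> \<le> c" for x unfolding k_def using c0 enn2real_nonneg[of "s x"] by linarith
  have sk: "AE x in P. s x = ennreal (k x + c)"
    using s_le
  proof eventually_elim
    case (elim x)
    then obtain r where r: "0 \<le> r" "s x = ennreal r" by (cases "s x") (auto simp: top_unique)
    then have "r \<le> 2 * c" using elim c0 by simp
    then have "k x + c = r" using r by (auto simp: k_def)
    then show ?case using r by simp
  qed
  have Nk: "N = density P (\<lambda>x. ennreal (k x + c))"
    unfolding sN[symmetric] by (rule density_cong) (use km sk in simp_all)
  have kc0: "0 \<le> k x + c" for x using kc[of x] by linarith
  show ?thesis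
  proof (rule that[OF km kc])
    fix h assume h: "h \<in> Linf P"
    have hm: "h \<in> borel_measurable P" by (rule Linf_measurable[OF h])
    have h\<pi>m: "(\<lambda>z. h (\<pi> z)) \<in> borel_measurable Z" by (rule measurable_compose[OF \<pi> hm])
    have VL: "(\<lambda>z. complex_of_real (V z)) \<in> Linf Z"
      by (rule LinfI[of _ _ c]) (measurable, use c in simp)
    have kL: "(\<lambda>x. complex_of_real (k x)) \<in> Linf P"
      by (rule LinfI[of _ _ c]) (use km kc in simp_all)
    have "(\<integral>z. (V z + c) *\<^sub>R h (\<pi> z) \<partial>Z) = (\<integral>z. h (\<pi> z) \<partial>D)"
      unfolding D_def by (rule integral_density[symmetric]) (use h\<pi>m Vc in simp_all)
    also have "\<dots> = (\<integral>x. h x \<partial>N)" unfolding N_def by (rule integral_distr[OF \<pi>D hm, symmetric])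
    also have "\<dots> = (\<integral>x. (k x + c) *\<^sub>R h x \<partial>P)"
      unfolding Nk by (rule integral_density) (use hm km kc0 in simp_all)
    finally have eq: "(\<integral>z. (V z + c) *\<^sub>R h (\<pi> z) \<partial>Z) = (\<integral>x. (k x + c) *\<^sub>R h x \<partial>P)" .
    have i1: "integrable Z (\<lambda>z. h (\<pi> z) * complex_of_real (V z))"
      by (rule Z.Linf_integrable[OF Linf_mult[OF Linf_\<pi>[OF h] VL]])
    have i2: "integrable P (\<lambda>x. h x * complex_of_real (k x))"
      by (rule P.Linf_integrable[OF Linf_mult[OF h kL]])
    have "(\<integral>z. h (\<pi> z) * complex_of_real (V z) + of_real c * h (\<pi> z) \<partial>Z) = (\<integral>x. h x * complex_of_real (k x) + of_real c * h x \<partial>P)"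
      using eq by (simp add: scaleR_conv_of_real algebra_simps)
    then show "(\<integral>z. h (\<pi> z) * complex_of_real (V z) \<partial>Z) = (\<integral>x. h x * complex_of_real (k x) \<partial>P)"
      using i1 i2 Z.Linf_integrable[OF Linf_\<pi>[OF h]] P.Linf_integrable[OF h] integral_\<pi>[OF hm] by simp
  qed
qed

definition common :: "('p \<Rightarrow> complex) set" where
  "common = {f \<in> Linf P. \<exists>k\<in>Linf Q. AE z in Z. f (\<pi> z) = k (\<rho> z)}"

lemma commonI:
  assumes "f \<in> Linf P" "k \<in> Linf Q" "AE z in Z. f (\<pi> z) = k (\<rho> z)" shows "f \<in> common"
  unfolding common_def using assms by (intro CollectI conjI bexI[of _ k])

text \<open>These are the bounded real functions whose conditional expectation given
  \<open>\<rho>\<close> vanishes.\<close>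

definition annihilator :: "('z \<Rightarrow> real) set" where
  "annihilator = {W \<in> borel_measurable Z. (\<exists>c. \<forall>z. \<bar>W z\<bar> \<le> c) \<and>
     (\<forall>k\<in>Linf Q. (\<integral>z. k (\<rho> z) * complex_of_real (W z) \<partial>Z) = 0)}"

text \<open>Let \<open>k\<close> be the conditional expectation of \<open>f\<close> after
  \<open>\<pi>\<close> given \<open>\<rho>\<close>. The difference \<open>W\<close> lies in the
  annihilator, so it is orthogonal to \<open>f\<close> after \<open>\<pi>\<close> by
  \<open>ann\<close> and to \<open>k\<close> after \<open>\<rho>\<close>; hence \<open>W\<close> is
  orthogonal to itself and vanishes.\<close>

lemma real_part_common:
  fixes f :: "'p \<Rightarrow> real"
  assumes f: "f \<in> borel_measurable P" "\<And>x. \<bar>f x\<bar> \<le> c"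
    and ann: "\<And>W. W \<in> annihilator \<Longrightarrow> (\<integral>z. f (\<pi> z) * W z \<partial>Z) = 0"
  obtains k :: "'q \<Rightarrow> real" where "k \<in> borel_measurable Q" "\<And>y. \<bar>k y\<bar> \<le> c" "AE z in Z. f (\<pi> z) = k (\<rho> z)"
proof -
  have fm: "(\<lambda>z. f (\<pi> z)) \<in> borel_measurable Z" by (rule measurable_compose[OF \<pi> f(1)])
  have fb: "\<bar>f (\<pi> z)\<bar> \<le> c" for z by (rule f(2))
  obtain k where k: "k \<in> borel_measurable Q" "\<And>y. \<bar>k y\<bar> \<le> c"
    "\<And>h. h \<in> Linf Q \<Longrightarrow> (\<integral>z. h (\<rho> z) * complex_of_real (f (\<pi> z)) \<partial>Z) = (\<integral>y. h y * complex_of_real (k y) \<partial>Q)"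
    by (rule two_factors.bounded_cond_exp[OF swap fm fb]) (rule that)
  define W where "W z = f (\<pi> z) - k (\<rho> z)" for z
  have k\<rho>m: "(\<lambda>z. k (\<rho> z)) \<in> borel_measurable Z" by (rule measurable_compose[OF \<rho> k(1)])
  have Wm: "W \<in> borel_measurable Z" unfolding W_def using fm k\<rho>m by (rule borel_measurable_diff)
  have Wb: "\<bar>W z\<bar> \<le> 2 * c" for z using fb[of z] k(2)[of "\<rho> z"] unfolding W_def by linarith
  have fL: "(\<lambda>z. complex_of_real (f (\<pi> z))) \<in> Linf Z" by (rule LinfI[of _ _ c]) (use fm fb in simp_all)
  have kLQ: "(\<lambda>y. complex_of_real (k y)) \<in> Linf Q" by (rule LinfI[of _ _ c]) (use k in simp_all)
  have kL: "(\<lambda>z. complex_of_real (k (\<rho> z))) \<in> Linf Z" by (rule two_factors.Linf_\<pi>[OF swap kLQ])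
  have Wann: "(\<integral>z. h (\<rho> z) * complex_of_real (W z) \<partial>Z) = 0" if h: "h \<in> Linf Q" for h
  proof -
    have hL: "(\<lambda>z. h (\<rho> z)) \<in> Linf Z" by (rule two_factors.Linf_\<pi>[OF swap h])
    have hk: "(\<lambda>y. h y * complex_of_real (k y)) \<in> borel_measurable Q"
      by (rule Linf_measurable[OF Linf_mult[OF h kLQ]])
    have "(\<integral>z. h (\<rho> z) * complex_of_real (W z) \<partial>Z) =
        (\<integral>z. h (\<rho> z) * complex_of_real (f (\<pi> z)) - h (\<rho> z) * complex_of_real (k (\<rho> z)) \<partial>Z)"
      by (simp add: W_def right_diff_distrib)
    also have "\<dots> = (\<integral>z. h (\<rho> z) * complex_of_real (f (\<pi> z)) \<partial>Z) - (\<integral>z. h (\<rho> z) * complex_of_real (k (\<rho> z)) \<partial>Z)"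
      by (intro Bochner_Integration.integral_diff Z.Linf_integrable Linf_mult hL fL kL)
    also have "\<dots> = 0" using k(3)[OF h] two_factors.integral_\<pi>[OF swap hk] by simp
    finally show ?thesis .
  qed
  have W: "W \<in> annihilator" unfolding annihilator_def using Wm Wb Wann by blast
  have prod_bound: "norm (a * W z) \<le> c * (2 * c)" if "\<bar>a\<bar> \<le> c" for a z
    unfolding real_norm_def abs_mult
    by (rule mult_mono[OF that Wb]) (use order_trans[OF abs_ge_zero that] in simp_all)
  have i1: "integrable Z (\<lambda>z. f (\<pi> z) * W z)"
    by (rule Z.integrable_const_bound[OF AE_I2[OF prod_bound[OF fb]] borel_measurable_times[OF fm Wm]])
  have i2: "integrable Z (\<lambda>z. k (\<rho> z) * W z)"
    by (rule Z.integrable_const_bound[OF AE_I2[OF prod_bound[OF k(2)]] borel_measurable_times[OF k\<rho>m Wm]])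
  have "complex_of_real (\<integral>z. k (\<rho> z) * W z \<partial>Z) = 0"
    using Wann[OF kLQ] by (simp only: of_real_mult[symmetric] integral_complex_of_real)
  then have z2: "(\<integral>z. k (\<rho> z) * W z \<partial>Z) = 0" by simp
  have "(\<integral>z. W z * W z \<partial>Z) = (\<integral>z. f (\<pi> z) * W z - k (\<rho> z) * W z \<partial>Z)"
    by (simp add: W_def left_diff_distrib)
  also have "\<dots> = 0" using i1 i2 ann[OF W] z2 by simp
  finally have "(\<integral>z. W z * W z \<partial>Z) = 0" .
  moreover have "integrable Z (\<lambda>z. W z * W z)"
    using Bochner_Integration.integrable_diff[OF i1 i2] by (simp add: W_def left_diff_distrib)
  ultimately have "AE z in Z. W z * W z = 0" using integral_nonneg_eq_0_iff_AE[of Z "\<lambda>z. W z * W z"] by simp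
  then have "AE z in Z. f (\<pi> z) = k (\<rho> z)" by eventually_elim (simp add: W_def)
  then show ?thesis by (rule that[OF k(1,2)])
qed

text \<open>This description shows that the set is ultraweakly closed.\<close>
lemma common_eq: "common = {f \<in> Linf P. \<forall>W\<in>annihilator. (\<integral>z. f (\<pi> z) * complex_of_real (W z) \<partial>Z) = 0}"
proof (intro set_eqI iffI)
  fix f assume "f \<in> common"
  then obtain k where f: "f \<in> Linf P" and k: "k \<in> Linf Q" and eq: "AE z in Z. f (\<pi> z) = k (\<rho> z)"
    unfolding common_def by blast
  have "(\<integral>z. f (\<pi> z) * complex_of_real (W z) \<partial>Z) = 0" if W: "W \<in> annihilator" for W
  proof -
    have Wm: "W \<in> borel_measurable Z" using W by (simp add: annihilator_def)
    have "(\<integral>z. f (\<pi> z) * complex_of_real (W z) \<partial>Z) = (\<integral>z. k (\<rho> z) * complex_of_real (W z) \<partial>Z)"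
    proof (rule integral_cong_AE)
      show "(\<lambda>z. f (\<pi> z) * complex_of_real (W z)) \<in> borel_measurable Z"
        using measurable_compose[OF \<pi> Linf_measurable[OF f]] Wm by measurable
      show "(\<lambda>z. k (\<rho> z) * complex_of_real (W z)) \<in> borel_measurable Z"
        using measurable_compose[OF \<rho> Linf_measurable[OF k]] Wm by measurable
      show "AE z in Z. f (\<pi> z) * complex_of_real (W z) = k (\<rho> z) * complex_of_real (W z)"
        using eq by eventually_elim simp
    qed
    also have "\<dots> = 0" using W k by (simp add: annihilator_def)
    finally show ?thesis .
  qed
  then show "f \<in> {f \<in> Linf P. \<forall>W\<in>annihilator. (\<integral>z. f (\<pi> z) * complex_of_real (W z) \<partial>Z) = 0}" using f by blast
next
  fix f assume "f \<in> {f \<in> Linf P. \<forall>W\<in>annihilator. (\<integral>z. f (\<pi> z) * complex_of_real (W z) \<partial>Z) = 0}"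
  then have f: "f \<in> Linf P" and ann: "\<And>W. W \<in> annihilator \<Longrightarrow> (\<integral>z. f (\<pi> z) * complex_of_real (W z) \<partial>Z) = 0"
    by blast+
  obtain c where c: "0 \<le> c" "AE x in P. cmod (f x) \<le> c" using f by (rule Linf_bound)
  have fm: "f \<in> borel_measurable P" by (rule Linf_measurable[OF f])
  \<comment> \<open>The essential bound becomes a bound at every point, as
    \<open>real_part_common\<close> asks.\<close>
  define fr where "fr x = max (- c) (min c (Re (f x)))" for x
  define fi where "fi x = max (- c) (min c (Im (f x)))" for x
  have frm: "fr \<in> borel_measurable P" "fi \<in> borel_measurable P" unfolding fr_def fi_def using fm by measurable
  have frb: "\<bar>fr x\<bar> \<le> c" "\<bar>fi x\<bar> \<le> c" for x unfolding fr_def fi_def using c(1) by auto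
  have "AE x in P. fr x = Re (f x) \<and> fi x = Im (f x)"
    using c(2)
  proof eventually_elim
    case (elim x)
    have "\<bar>Re (f x)\<bar> \<le> c" "\<bar>Im (f x)\<bar> \<le> c"
      using elim abs_Re_le_cmod[of "f x"] abs_Im_le_cmod[of "f x"] by linarith+
    then show ?case unfolding fr_def fi_def by auto
  qed
  then have eqf: "AE z in Z. fr (\<pi> z) = Re (f (\<pi> z)) \<and> fi (\<pi> z) = Im (f (\<pi> z))" by (rule AE_\<pi>)
  have f\<pi>m: "(\<lambda>z. f (\<pi> z)) \<in> borel_measurable Z" by (rule measurable_compose[OF \<pi> fm])
  have annr: "(\<integral>z. fr (\<pi> z) * W z \<partial>Z) = 0" "(\<integral>z. fi (\<pi> z) * W z \<partial>Z) = 0" if W: "W \<in> annihilator" for W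
  proof -
    obtain d where d: "W \<in> borel_measurable Z" "\<And>z. \<bar>W z\<bar> \<le> d" using W by (auto simp: annihilator_def)
    have WL: "(\<lambda>z. complex_of_real (W z)) \<in> Linf Z" by (rule LinfI[of _ _ d]) (use d in simp_all)
    have i: "integrable Z (\<lambda>z. f (\<pi> z) * complex_of_real (W z))"
      by (rule Z.Linf_integrable[OF Linf_mult[OF Linf_\<pi>[OF f] WL]])
    have mm: "(\<lambda>z. fr (\<pi> z) * W z) \<in> borel_measurable Z" "(\<lambda>z. fi (\<pi> z) * W z) \<in> borel_measurable Z"
      "(\<lambda>z. Re (f (\<pi> z) * complex_of_real (W z))) \<in> borel_measurable Z"
      "(\<lambda>z. Im (f (\<pi> z) * complex_of_real (W z))) \<in> borel_measurable Z"
      using measurable_compose[OF \<pi> frm(1)] measurable_compose[OF \<pi> frm(2)] f\<pi>m d(1) by measurable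
    have "(\<integral>z. fr (\<pi> z) * W z \<partial>Z) = (\<integral>z. Re (f (\<pi> z) * complex_of_real (W z)) \<partial>Z)"
      by (rule integral_cong_AE[OF mm(1,3)]) (use eqf in eventually_elim, simp)
    also have "\<dots> = 0" using integral_Re[OF i] ann[OF W] by simp
    finally show "(\<integral>z. fr (\<pi> z) * W z \<partial>Z) = 0" .
    have "(\<integral>z. fi (\<pi> z) * W z \<partial>Z) = (\<integral>z. Im (f (\<pi> z) * complex_of_real (W z)) \<partial>Z)"
      by (rule integral_cong_AE[OF mm(2,4)]) (use eqf in eventually_elim, simp)
    also have "\<dots> = 0" using integral_Im[OF i] ann[OF W] by simp
    finally show "(\<integral>z. fi (\<pi> z) * W z \<partial>Z) = 0" .
  qed
  obtain kr :: "'q \<Rightarrow> real" where kr: "kr \<in> borel_measurable Q" "\<And>y. \<bar>kr y\<bar> \<le> c" "AE z in Z. fr (\<pi> z) = kr (\<rho> z)"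
    by (rule real_part_common[OF frm(1) frb(1)], erule annr(1), rule that)
  obtain ki :: "'q \<Rightarrow> real" where ki: "ki \<in> borel_measurable Q" "\<And>y. \<bar>ki y\<bar> \<le> c" "AE z in Z. fi (\<pi> z) = ki (\<rho> z)"
    by (rule real_part_common[OF frm(2) frb(2)], erule annr(2), rule that)
  have "(\<lambda>y. complex_of_real (kr y)) \<in> Linf Q" "(\<lambda>y. complex_of_real (ki y)) \<in> Linf Q"
    by (rule LinfI[of _ _ c]; use kr ki in simp)+
  then have "(\<lambda>y. complex_of_real (kr y) + \<i> * complex_of_real (ki y)) \<in> Linf Q"
    by (intro Linf_add Linf_mult Linf_const)
  from f this show "f \<in> common"
  proof (rule commonI)
    show "AE z in Z. f (\<pi> z) = complex_of_real (kr (\<rho> z)) + \<i> * complex_of_real (ki (\<rho> z))"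
    using eqf kr(3) ki(3) by eventually_elim (simp add: complex_eq_iff)
  qed
qed

text \<open>Conditioning an annihilating \<open>W\<close> on \<open>\<pi>\<close> turns its pairing
  into one with an integrable function on \<open>P\<close>. By \<open>common_eq\<close> the set is
  thus an intersection of kernels of ultraweakly continuous functionals; the algebraic closure is
  pointwise.\<close>

lemma von_neumann_common: "von_neumann_subalgebra P common"
  unfolding von_neumann_subalgebra_def
proof (intro conjI ballI allI)
  have ex: "\<exists>w. integrable P w \<and> (\<forall>f\<in>Linf P. (\<integral>z. f (\<pi> z) * complex_of_real (W z) \<partial>Z) = (\<integral>x. f x * w x \<partial>P))"
    if W: "W \<in> annihilator" for W
  proof -
    obtain d where d: "W \<in> borel_measurable Z" "\<And>z. \<bar>W z\<bar> \<le> d" using W by (auto simp: annihilator_def)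
    obtain k where k: "k \<in> borel_measurable P" "\<And>x. \<bar>k x\<bar> \<le> d"
      "\<And>h. h \<in> Linf P \<Longrightarrow> (\<integral>z. h (\<pi> z) * complex_of_real (W z) \<partial>Z) = (\<integral>x. h x * complex_of_real (k x) \<partial>P)"
      by (rule bounded_cond_exp[OF d]) (rule that)
    have "(\<lambda>x. complex_of_real (k x)) \<in> Linf P" by (rule LinfI[of _ _ d]) (use k in simp_all)
    then have "integrable P (\<lambda>x. complex_of_real (k x))" by (rule prob_space.Linf_integrable[OF prob_P])
    then show ?thesis using k(3) by (intro exI[of _ "\<lambda>x. complex_of_real (k x)"]) blast
  qed
  then obtain w where w: "\<And>W. W \<in> annihilator \<Longrightarrow> integrable P (w W)"
    "\<And>W f. W \<in> annihilator \<Longrightarrow> f \<in> Linf P \<Longrightarrow> (\<integral>z. f (\<pi> z) * complex_of_real (W z) \<partial>Z) = (\<integral>x. f x * w W x \<partial>P)"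
    by metis
  have zero: "(\<lambda>_. 0) \<in> annihilator" by (auto simp: annihilator_def)
  have "common = (\<Inter>W\<in>annihilator. {f \<in> Linf P. (\<integral>x. f x * w W x \<partial>P) = 0})"
    unfolding common_eq using w(2) zero by auto
  moreover have "closedin (ultraweak_topology P) (\<Inter>W\<in>annihilator. {f \<in> Linf P. (\<integral>x. f x * w W x \<partial>P) = 0})"
  proof (rule closedin_Inter)
    show "(\<lambda>W. {f \<in> Linf P. (\<integral>x. f x * w W x \<partial>P) = 0}) ` annihilator \<noteq> {}" using zero by blast
    fix S assume "S \<in> (\<lambda>W. {f \<in> Linf P. (\<integral>x. f x * w W x \<partial>P) = 0}) ` annihilator"
    then obtain W where "W \<in> annihilator" "S = {f \<in> Linf P. (\<integral>x. f x * w W x \<partial>P) = 0}" by blast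
    then show "closedin (ultraweak_topology P) S" using closedin_ultraweak_kernel[OF w(1)] by simp
  qed
  ultimately show "closedin (ultraweak_topology P) common" by simp
  show "(\<lambda>_. 1) \<in> common"
    unfolding common_def by (intro CollectI conjI bexI[of _ "\<lambda>_. 1"] Linf_const AE_I2 refl)
  fix f assume "f \<in> common"
  then obtain f' where f: "f \<in> Linf P" "f' \<in> Linf Q" "AE z in Z. f (\<pi> z) = f' (\<rho> z)" unfolding common_def by blast
  show "(\<lambda>x. cnj (f x)) \<in> common"
    unfolding common_def
  proof (intro CollectI conjI bexI)
    show "AE z in Z. cnj (f (\<pi> z)) = cnj (f' (\<rho> z))" using f(3) by eventually_elim simp
  qed (intro Linf_cnj f)+
  show "(\<lambda>x. c * f x) \<in> common" for c
    unfolding common_def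
  proof (intro CollectI conjI bexI)
    show "AE z in Z. c * f (\<pi> z) = c * f' (\<rho> z)" using f(3) by eventually_elim simp
  qed (intro Linf_mult Linf_const f)+
  fix k assume "k \<in> common"
  then obtain k' where k: "k \<in> Linf P" "k' \<in> Linf Q" "AE z in Z. k (\<pi> z) = k' (\<rho> z)" unfolding common_def by blast
  show "(\<lambda>x. f x + k x) \<in> common"
    unfolding common_def
  proof (intro CollectI conjI bexI)
    show "AE z in Z. f (\<pi> z) + k (\<pi> z) = f' (\<rho> z) + k' (\<rho> z)" using f(3) k(3) by eventually_elim simp
  qed (intro Linf_add f k)+
  show "(\<lambda>x. f x * k x) \<in> common"
    unfolding common_def
  proof (intro CollectI conjI bexI)
    show "AE z in Z. f (\<pi> z) * k (\<pi> z) = f' (\<rho> z) * k' (\<rho> z)" using f(3) k(3) by eventually_elim simp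
  qed (intro Linf_mult f k)+
qed

end

section \<open>RN-irreducibility and the isomorphism\<close>

lemma powr_imaginary: "0 \<le> r \<Longrightarrow> complex_of_real r powr (\<i> * of_real t) = (if r = 0 then 0 else cis (t * ln r))"
  by (simp add: powr_def Ln_of_real cis_conv_exp mult.assoc)

lemma RN_powers_Linf:
  "(\<lambda>x. complex_of_real (enn2real (rn M act g x)) powr (\<i> * of_real t)) \<in> Linf M"
proof (rule LinfI[of _ _ 1])
  have "cis \<in> borel_measurable borel" by (intro borel_measurable_continuous_onI continuous_intros)
  moreover have "(\<lambda>x. t * ln (enn2real (rn M act g x))) \<in> borel_measurable M" unfolding rn_def by measurable
  ultimately have c: "(\<lambda>x. cis (t * ln (enn2real (rn M act g x)))) \<in> borel_measurable M"
    by (rule measurable_compose[rotated])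
  have "(\<lambda>x. enn2real (rn M act g x)) \<in> borel_measurable M" unfolding rn_def by measurable
  then have "{x \<in> space M. enn2real (rn M act g x) = 0} \<in> sets M" by measurable
  then show "(\<lambda>x. complex_of_real (enn2real (rn M act g x)) powr (\<i> * of_real t)) \<in> borel_measurable M"
    unfolding powr_imaginary[OF enn2real_nonneg] by (intro measurable_If c) simp_all
  show "AE x in M. cmod (complex_of_real (enn2real (rn M act g x)) powr (\<i> * of_real t)) \<le> 1"
    unfolding powr_imaginary[OF enn2real_nonneg] by simp
qed

lemma RN_irreducible_factor_map:
  fixes P :: "'p measure" and Q :: "'q measure"
    and actP :: "'g::topological_group_add \<Rightarrow> 'p \<Rightarrow> 'p" and actQ :: "'g \<Rightarrow> 'q \<Rightarrow> 'q"
  assumes tf: "two_factors Z P Q \<pi> \<rho>" and irr: "RN_irreducible P actP" and ns: "nonsingular_space P actP"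
    and rn: "\<And>g. AE z in Z. rn P actP g (\<pi> z) = rn Q actQ g (\<rho> z)"
  obtains p where "p \<in> Q \<rightarrow>\<^sub>M P" "AE z in Z. \<pi> z = p (\<rho> z)"
proof -
  interpret two_factors Z P Q \<pi> \<rho> by fact
  interpret P: prob_space P by (rule prob_P)
  have "RN_powers P actP \<subseteq> common"
  proof
    fix f assume "f \<in> RN_powers P actP"
    then obtain g t where f: "f = (\<lambda>x. complex_of_real (enn2real (rn P actP g x)) powr (\<i> * of_real t))"
      unfolding RN_powers_def rn_def by blast
    have "AE z in Z. f (\<pi> z) = complex_of_real (enn2real (rn Q actQ g (\<rho> z))) powr (\<i> * of_real t)"
      using rn[of g] by eventually_elim (simp add: f)
    moreover have "f \<in> Linf P" unfolding f by (rule RN_powers_Linf)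
    ultimately show "f \<in> common" by (rule commonI[OF _ RN_powers_Linf, rotated])
  qed
  then have "von_neumann_generated P (RN_powers P actP) \<subseteq> common"
    unfolding von_neumann_generated_def using von_neumann_common by blast
  moreover have "{f \<in> Linf P. \<exists>k\<in>Linf P. AE x in P. f x = k x} = von_neumann_generated P (RN_powers P actP)"
    using irr unfolding RN_irreducible_def RN_factor_def by blast
  ultimately have all: "f \<in> common" if "f \<in> Linf P" for f using that by blast
  show ?thesis
  proof (rule point_realization[where X=P and Y=Q and \<pi>=\<pi> and \<rho>=\<rho> and Z=Z])
    show "standard_borel P" using ns by (simp add: nonsingular_space_def)
    show "space P \<noteq> {}" by (rule P.not_empty)
    show "\<pi> \<in> Z \<rightarrow>\<^sub>M P" "\<rho> \<in> Z \<rightarrow>\<^sub>M Q" by (rule \<pi>, rule \<rho>)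
    fix A assume A: "A \<in> sets P"
    have "indicator A \<in> Linf P"
      by (rule LinfI[of _ _ 1]) (use A in \<open>simp_all add: indicator_def\<close>)
    from all[OF this] obtain k where k: "k \<in> Linf Q" "AE z in Z. indicator A (\<pi> z) = k (\<rho> z)"
      unfolding common_def by blast
    \<comment> \<open>Since \<open>k\<close> agrees almost everywhere with an indicator, its level
      set at 1 represents \<open>A\<close> on the other factor.\<close>
    define B where "B = {y \<in> space Q. k y = 1}"
    have "B \<in> sets Q" unfolding B_def using Linf_measurable[OF k(1)] by measurable
    moreover have "AE z in Z. \<pi> z \<in> A \<longleftrightarrow> \<rho> z \<in> B"
      using k(2) AE_space
    proof eventually_elim
      case (elim z)
      then show ?case using measurable_space[OF \<rho> elim(2)] by (auto simp: B_def indicator_def split: if_splits)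
    qed
    ultimately show "\<exists>B\<in>sets Q. AE z in Z. \<pi> z \<in> A \<longleftrightarrow> \<rho> z \<in> B" by blast
  next
    fix p assume "p \<in> Q \<rightarrow>\<^sub>M P" "AE z in Z. \<pi> z = p (\<rho> z)"
    then show ?thesis by (rule that)
  qed
qed

context coupling
begin

lemma tf: "two_factors Z X Y snd fst"
  by unfold_locales (rule fst_measurable snd_measurable distr_fst distr_snd)+

lemma AE_sh: assumes "AE z in Z. R z" shows "AE z in Z. R (sh g z)"
proof -
  obtain S where S: "S \<in> null_sets Z" "{z \<in> space Z. \<not> R z} \<subseteq> S"
    using assms unfolding eventually_ae_filter by blast
  have iS: "(indicator S :: _ \<Rightarrow> ennreal) \<in> borel_measurable Z" using null_setsD2[OF S(1)] by simp
  have S0: "AE z in Z. z \<notin> S" by (rule AE_not_in[OF S(1)])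
  have "(\<integral>\<^sup>+z. indicator S (sh g z) \<partial>Z) = (\<integral>\<^sup>+z. rn Y actY g (fst z) * indicator S z \<partial>Z)"
    by (rule nn_integral_sh[OF iS])
  also have "\<dots> = (\<integral>\<^sup>+z. 0 \<partial>Z)"
    by (rule nn_integral_cong_AE, use S0 in eventually_elim) simp
  finally have "(\<integral>\<^sup>+z. indicator S (sh g z) \<partial>Z) = 0" by simp
  then have "AE z in Z. (indicator S (sh g z) :: ennreal) = 0"
    using nn_integral_0_iff_AE[OF measurable_compose[OF sh_measurable iS]] by blast
  then show ?thesis using AE_space
  proof eventually_elim
    case (elim z)
    then have "sh g z \<notin> S" by (simp add: indicator_def split: if_splits)
    then show ?case using S(2) measurable_space[OF sh_measurable elim(2)] by blast
  qed
qed

lemma factor_map_snd_fst: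
  assumes q: "q \<in> X \<rightarrow>\<^sub>M Y" "AE z in Z. fst z = q (snd z)"
  shows "factor_map X actX Y actY q"
proof (rule two_factors.factor_mapI[OF two_factors.swap[OF tf] q Y.std X.act_measurable Y.act_measurable])
  show "AE z in Z. q (actX g (snd z)) = actY g (q (snd z))" for g
    using q(2) AE_sh[OF q(2), of g] by eventually_elim (simp add: sh_def)
qed

lemma factor_map_fst_snd:
  assumes p: "p \<in> Y \<rightarrow>\<^sub>M X" "AE z in Z. snd z = p (fst z)"
  shows "factor_map Y actY X actX p"
proof (rule two_factors.factor_mapI[OF tf p X.std Y.act_measurable X.act_measurable])
  show "AE z in Z. p (actY g (fst z)) = actX g (p (fst z))" for g
    using p(2) AE_sh[OF p(2), of g] by eventually_elim (simp add: sh_def)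
qed

theorem isomorphic_if_RN_irreducible:
  assumes agree: "agree = UNIV" and irrX: "RN_irreducible X actX" and irrY: "RN_irreducible Y actY"
  shows "isomorphic_spaces X actX Y actY"
proof -
  have rn: "AE z in Z. rn X actX g (snd z) = rn Y actY g (fst z)" for g
    by (rule agreeE(2)) (simp add: agree)
  then have rn': "AE z in Z. rn Y actY g (fst z) = rn X actX g (snd z)" for g
    using rn[of g] by eventually_elim simp
  obtain p where p: "p \<in> Y \<rightarrow>\<^sub>M X" "AE z in Z. snd z = p (fst z)"
    by (rule RN_irreducible_factor_map[OF tf irrX X.ns rn]) (rule that)
  obtain q where q: "q \<in> X \<rightarrow>\<^sub>M Y" "AE z in Z. fst z = q (snd z)"
    by (rule RN_irreducible_factor_map[OF two_factors.swap[OF tf] irrY Y.ns rn']) (rule that)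
  have "AE z in Z. p (q (snd z)) = snd z" using p(2) q(2) by eventually_elim simp
  then have pq: "AE x in X. p (q x) = x"
    using two_factors.AE_\<pi>_iff[OF tf standard_borel_equality_set[OF X.std
          measurable_compose[OF q(1) p(1)] measurable_ident]] by simp
  have "AE z in Z. q (p (fst z)) = fst z" using p(2) q(2) by eventually_elim simp
  then have qp: "AE y in Y. q (p y) = y"
    using two_factors.AE_\<pi>_iff[OF two_factors.swap[OF tf] standard_borel_equality_set[OF Y.std
          measurable_compose[OF p(1) q(1)] measurable_ident]] by simp
  show ?thesis
    unfolding isomorphic_spaces_def
    using factor_map_snd_fst[OF q] factor_map_fst_snd[OF p] pq qp by blast
qed

end

section \<open>The entropy inequality and the conclusion\<close>

theorem furstenberg_entropy_le:
  fixes \<mu> :: "'g::{topological_group_add, second_countable_topology} measure"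
  assumes \<mu>: "prob_space \<mu>" "sets \<mu> = sets borel"
    and "unique_stationary \<mu> X actX" "stationary_space \<mu> Y actY" "zimmer_amenable Y actY"
  shows "furstenberg_entropy \<mu> X actX \<le> furstenberg_entropy \<mu> Y actY"
proof -
  obtain Z where "coupling X actX Y actY Z" by (rule coupling_exists[OF assms])
  then interpret coupling X actX Y actY Z .
  have "(\<integral>\<^sup>+g. kl_div X actX g \<partial>\<mu>) \<le> (\<integral>\<^sup>+g. kl_div Y actY g \<partial>\<mu>)"
    by (intro nn_integral_mono kl_div_le)
  then show ?thesis
    unfolding X.furstenberg_entropy_eq Y.furstenberg_entropy_eq by (simp add: less_eq_ennreal.rep_eq)
qed

theorem corollaryC:
  fixes \<mu> :: "'g::{topological_group_add, t2_space, second_countable_topology} measure"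
    and B :: "'b measure" and actB :: "'g \<Rightarrow> 'b \<Rightarrow> 'b"
  assumes "locally_compact_space (euclidean :: 'g topology)"
    and "prob_space \<mu>" and "sets \<mu> = sets borel"
    and "admissible \<mu>"
    and "poisson_boundary \<mu> B actB"
  shows "(\<forall>(X :: 'x measure) actX (Y :: 'y measure) actY.
            unique_stationary \<mu> X actX \<and> stationary_space \<mu> Y actY \<and> zimmer_amenable Y actY \<longrightarrow>
            furstenberg_entropy \<mu> X actX \<le> furstenberg_entropy \<mu> Y actY) \<and>
         h_us \<mu> \<le> h_am \<mu> \<and>
         (furstenberg_entropy \<mu> B actB < \<infinity> \<longrightarrow>
            (\<forall>(X :: 'x measure) actX (Y :: 'y measure) actY.
               unique_stationary \<mu> X actX \<and> zimmer_amenable X actX \<and> RN_irreducible X actX \<and>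
               unique_stationary \<mu> Y actY \<and> zimmer_amenable Y actY \<and> RN_irreducible Y actY \<longrightarrow>
               isomorphic_spaces X actX Y actY))"
proof (intro conjI allI impI)
  note \<mu> = \<open>prob_space \<mu>\<close> \<open>sets \<mu> = sets borel\<close>
  show "furstenberg_entropy \<mu> X actX \<le> furstenberg_entropy \<mu> Y actY"
    if "unique_stationary \<mu> X actX \<and> stationary_space \<mu> Y actY \<and> zimmer_amenable Y actY"
    for X :: "'x measure" and actX and Y :: "'y measure" and actY
    using that by (intro furstenberg_entropy_le[OF \<mu>]) blast+
  show "h_us \<mu> \<le> h_am \<mu>"
    unfolding h_us_def h_am_def
    by (intro Sup_least Inf_greatest, elim CollectE exE conjE) (simp only: furstenberg_entropy_le[OF \<mu>])
  fix X :: "'x measure" and actX and Y :: "'y measure" and actY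
  assume fin: "furstenberg_entropy \<mu> B actB < \<infinity>"
    and XY: "unique_stationary \<mu> X actX \<and> zimmer_amenable X actX \<and> RN_irreducible X actX \<and>
      unique_stationary \<mu> Y actY \<and> zimmer_amenable Y actY \<and> RN_irreducible Y actY"
  have stX: "stationary_space \<mu> X actX" and stY: "stationary_space \<mu> Y actY"
    using XY by (simp_all add: unique_stationary_def)
  obtain Z where "coupling X actX Y actY Z"
    by (rule coupling_exists[OF \<mu> _ stY]) (use XY in blast)+
  then interpret coupling X actX Y actY Z .
  interpret \<mu>: prob_space \<mu> by (rule \<mu>(1))
  interpret PB: poisson_boundary_space \<mu> B actB
    by unfold_locales (use assms(5) in \<open>simp_all add: \<mu>(2) poisson_boundary_def stationary_space_def\<close>)
  interpret S: stationary_over_poisson \<mu> B actB Y actY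
    by unfold_locales (use stY in \<open>simp add: stationary_space_def\<close>)
  \<comment> \<open>Both spaces are uniquely stationary and amenable, so the inequality holds in
    both directions.\<close>
  have "furstenberg_entropy \<mu> X actX = furstenberg_entropy \<mu> Y actY"
    using XY stX stY by (intro antisym furstenberg_entropy_le[OF \<mu>]) blast+
  then have eq: "(\<integral>\<^sup>+g. kl_div X actX g \<partial>\<mu>) = (\<integral>\<^sup>+g. kl_div Y actY g \<partial>\<mu>)"
    unfolding X.furstenberg_entropy_eq Y.furstenberg_entropy_eq by (simp add: enn2ereal_inject)
  have "(\<integral>\<^sup>+g. kl_div Y actY g \<partial>\<mu>) \<le> (\<integral>\<^sup>+g. kl_div B actB g \<partial>\<mu>)"
    by (intro nn_integral_mono S.kl_div_le_poisson)
  also have "\<dots> < \<infinity>"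
    using fin unfolding PB.B.furstenberg_entropy_eq by (simp add: less_ennreal.rep_eq)
  finally have "AE g in \<mu>. g \<in> agree" by (rule AE_agree[OF \<mu> eq])
  then have "agree = UNIV"
    using PB.full_measure_subgroup_eq_UNIV[OF sets_agree agree_add agree_uminus] by blast
  then show "isomorphic_spaces X actX Y actY"
    using XY by (intro isomorphic_if_RN_irreducible) blast+
qed

end
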